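(* Let $(\Omega,\mathcal{F})$ be a measurable space, $\mathcal{P}$ a nonempty set of probability measures on $(\Omega,\mathcal{F})$, $c(A)=\sup_{P\in\mathcal{P}}P(A)$, and assume that $ca_c^\ast=L^\infty_c$. Consider the discrete time market model with $\mathcal{P}$-q.s. bounded adapted price process $S$, trading strategies $\mathcal{H}$ and cone $\mathcal{C}\subset L^\infty_c$ described in the context, and suppose that $\mathcal{C}$ is $\mathcal{P}$-sensitive. The following are equivalent: (i) NA($\mathcal{P}$): for every $H\in\mathcal{H}$, $(H\bullet S)_T\ge 0$ $\mathcal{P}$-q.s. implies $(H\bullet S)_T=0$ $\mathcal{P}$-q.s. (ii) $\mathcal{C}^0_1\approx\mathcal{P}$. Moreover, the superhedging duality holds, that is, for any $X\in L^\infty_c$ the minimal superhedging price $$\pi(X):=\inf\{x\in\mathbb{R}\mid \exists H\in\mathcal{H}\text{ such that } x+(H\bullet S)_T\ge X\ \mathcal{P}\text{-q.s.}\}$$ satisfies $$\pi(X)=\sup_{Q\in\mathcal{C}^0_1}E_Q[X].$$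
   Context: $\mathcal{M}_1$ is the set of all probability measures on $(\Omega,\mathcal{F})$. A statement holds $\mathcal{P}$-q.s. if it holds $P$-almost surely for every $P\in\mathcal{P}$. $ca$ is the space of all $\sigma$-additive $\mu:\mathcal{F}\to\mathbb{R}$ (finite signed measures) with the total variation norm; $ca_c=\{\mu\in ca\mid c(A)=0\Rightarrow\mu(A)=0 \text{ for all } A\in\mathcal{F}\}$, with the same norm. $L^\infty_c$ is the space of bounded $\mathcal{F}$-measurable functions $\Omega\to\mathbb{R}$ modulo $\mathcal{P}$-q.s. equality, ordered by $X\le Y$ $\mathcal{P}$-q.s. $ca_c^\ast$ is the norm dual of $ca_c$; every $X\in L^\infty_c$ defines an element of $ca_c^\ast$ by $\mu\mapsto\int X\,d\mu$, and $ca_c^\ast=L^\infty_c$ means that every element of $ca_c^\ast$ is of this form. For sets $\widehat{\mathcal{P}},\widetilde{\mathcal{P}}\subset\mathcal{M}_1$, $\widetilde{\mathcal{P}}\ll\widehat{\mathcal{P}}$ means: for all $A\in\mathcal{F}$, $\sup_{P\in\widehat{\mathcal{P}}}P(A)=0$ implies $\sup_{P\in\widetilde{\mathcal{P}}}P(A)=0$ (with the supremum of probabilities over the empty family being $0$); $\widetilde{\mathcal{P}}\approx\widehat{\mathcal{P}}$ means domination in both directions. For $Q\in\mathcal{M}_1$ with $\{Q\}\ll\mathcal{P}$, $j_Q:L^\infty_c\to L^\infty_Q:=L^\infty(\Omega,\mathcal{F},Q)$ maps $X$ to the $Q$-a.s. equivalence class of any representative of $X$. A set $\mathcal{A}\subset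 L^\infty_c$ is $\mathcal{P}$-sensitive if there is $\mathcal{Q}\subset\mathcal{M}_1$ with $\mathcal{Q}\ll\mathcal{P}$ such that $\mathcal{A}=\bigcap_{Q\in\mathcal{Q}}j_Q^{-1}(j_Q(\mathcal{A}))$. Market model: $T\in\mathbb{N}$, $I=\{0,\dots,T\}$; $\mathbb{F}=(\mathcal{F}_t)_{t\in I}$ is a filtration of sub-$\sigma$-algebras of $\mathcal{F}$; $S=(S_t)_{t\in I}=(S^j_t)_{t\in I}^{j=1,\dots,d}$ is an $\mathbb{R}^d$-valued, $\mathbb{F}$-adapted, $\mathcal{P}$-q.s. bounded process (there is also a numeraire asset $S^0_t=1$ for all $t\in I$). $\mathcal{H}$ is the set of $\mathbb{R}^d$-valued $\mathbb{F}$-predictable processes $H=(H_t)_{t=1,\dots,T}$ (i.e. $H_t$ is $\mathcal{F}_{t-1}$-measurable). $(H\bullet S)_0=0$ and $(H\bullet S)_t:=\sum_{k=1}^t\sum_{j=1}^dH^j_k(S^j_k-S^j_{k-1})$ for $t\ge1$. $$\mathcal{C}:=\{X\in L^\infty_c\mid X\le(H\bullet S)_T\ \mathcal{P}\text{-q.s. for some }H\in\mathcal{H}\},$$ $$\mathcal{C}^0:=\{\mu\in ca_c\mid \forall X\in\mathcal{C}:\ \textstyle\int X\,d\mu\le0\},\qquad \mathcal{C}^0_1:=\mathcal{C}^0\cap\mathcal{M}_1.$$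
   Formalization: The superhedging duality is stated and proved under NA(P) (equivalently (ii)); without it the claim fails, e.g. one P, T=1, S_0=0, S_1=Y with P(Y=0)=1/2 and Y otherwise uniform on (0,1), X=1_{Y>0}: the price is 1 but the supremum is 0. *)

theory Defs
  imports "HOL-Probability.Probability"
begin

text \<open>The measurable space is carried by \<open>M :: 'a measure\<close>; only \<open>space M\<close> and \<open>sets M\<close> are
  ever used, never \<open>emeasure M\<close>. Families of probability measures are sets \<open>Ps :: 'a measure set\<close>.\<close>

definition prob_measures :: "'a measure \<Rightarrow> 'a measure set" where
  "prob_measures M = {P. prob_space P \<and> sets P = sets M}"

definition qs :: "'a measure set \<Rightarrow> ('a \<Rightarrow> bool) \<Rightarrow> bool" where
  "qs Ps \<phi> \<longleftrightarrow> (\<forall>P\<in>Ps. AE \<omega> in P. \<phi> \<omega>)"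

text \<open>Valued in \<^typ>\<open>ennreal\<close>, so that the supremum over the empty family is 0.\<close>

definition upper_prob :: "'a measure set \<Rightarrow> 'a set \<Rightarrow> ennreal" where
  "upper_prob Ps A = (SUP P\<in>Ps. emeasure P A)"

definition dominated :: "'a measure \<Rightarrow> 'a measure set \<Rightarrow> 'a measure set \<Rightarrow> bool" where
  "dominated M Qs Ps \<longleftrightarrow> (\<forall>A\<in>sets M. upper_prob Ps A = 0 \<longrightarrow> upper_prob Qs A = 0)"

definition equivalent :: "'a measure \<Rightarrow> 'a measure set \<Rightarrow> 'a measure set \<Rightarrow> bool" where
  "equivalent M Qs Ps \<longleftrightarrow> dominated M Qs Ps \<and> dominated M Ps Qs"


section \<open>Finite signed measures\<close>

text \<open>A finite signed measure is a real set function, normalised to 0 outside \<open>sets M\<close>. The same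
  normalisation holds for \<^term>\<open>measure Q\<close>, so a probability measure \<open>Q\<close>, regarded as an element of
  \<open>ca M\<close>, is \<^term>\<open>measure Q\<close>.\<close>

definition ca :: "'a measure \<Rightarrow> ('a set \<Rightarrow> real) set" where
  "ca M = {\<mu>. (\<forall>A. A \<notin> sets M \<longrightarrow> \<mu> A = 0) \<and>
     (\<forall>A :: nat \<Rightarrow> 'a set. range A \<subseteq> sets M \<longrightarrow> disjoint_family A \<longrightarrow>
        (\<lambda>n. \<mu> (A n)) sums \<mu> (\<Union>n. A n))}"

definition ca_c :: "'a measure \<Rightarrow> 'a measure set \<Rightarrow> ('a set \<Rightarrow> real) set" where
  "ca_c M Ps = {\<mu> \<in> ca M. \<forall>A\<in>sets M. upper_prob Ps A = 0 \<longrightarrow> \<mu> A = 0}"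

text \<open>Jordan decomposition: \<open>\<mu>\<^sup>+(A) = sup {\<mu>(B) | B \<subseteq> A}\<close>, where \<open>B = {}\<close> makes the supremum
  nonnegative (and \<^const>\<open>ennreal\<close> sends negative values to 0), and \<open>\<mu>\<^sup>- = (-\<mu>)\<^sup>+\<close>.\<close>

definition pos_part :: "'a measure \<Rightarrow> ('a set \<Rightarrow> real) \<Rightarrow> 'a measure" where
  "pos_part M \<mu> = measure_of (space M) (sets M)
     (\<lambda>A. SUP B\<in>{B \<in> sets M. B \<subseteq> A}. ennreal (\<mu> B))"

definition neg_part :: "'a measure \<Rightarrow> ('a set \<Rightarrow> real) \<Rightarrow> 'a measure" where
  "neg_part M \<mu> = pos_part M (\<lambda>A. - \<mu> A)"

definition tv_norm :: "'a measure \<Rightarrow> ('a set \<Rightarrow> real) \<Rightarrow> real" where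
  "tv_norm M \<mu> = measure (pos_part M \<mu>) (space M) + measure (neg_part M \<mu>) (space M)"

definition signed_integral :: "'a measure \<Rightarrow> ('a set \<Rightarrow> real) \<Rightarrow> ('a \<Rightarrow> real) \<Rightarrow> real" where
  "signed_integral M \<mu> X = (\<integral>\<omega>. X \<omega> \<partial>pos_part M \<mu>) - (\<integral>\<omega>. X \<omega> \<partial>neg_part M \<mu>)"

text \<open>Continuous linear functionals on \<^const>\<open>ca_c\<close>; only their values on \<^const>\<open>ca_c\<close> matter.\<close>

definition ca_c_dual :: "'a measure \<Rightarrow> 'a measure set \<Rightarrow> (('a set \<Rightarrow> real) \<Rightarrow> real) set" where
  "ca_c_dual M Ps = {l.
     (\<forall>\<mu>\<in>ca_c M Ps. \<forall>\<nu>\<in>ca_c M Ps. l (\<lambda>A. \<mu> A + \<nu> A) = l \<mu> + l \<nu>) \<and>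
     (\<forall>\<mu>\<in>ca_c M Ps. \<forall>a::real. l (\<lambda>A. a * \<mu> A) = a * l \<mu>) \<and>
     (\<exists>K. \<forall>\<mu>\<in>ca_c M Ps. \<bar>l \<mu>\<bar> \<le> K * tv_norm M \<mu>)}"


section \<open>Bounded measurable functions modulo quasi-sure equality\<close>

definition bounded_measurable :: "'a measure \<Rightarrow> ('a \<Rightarrow> real) set" where
  "bounded_measurable M = {X \<in> borel_measurable M. \<exists>K. \<forall>\<omega>\<in>space M. \<bar>X \<omega>\<bar> \<le> K}"

definition qs_rel :: "'a measure \<Rightarrow> 'a measure set \<Rightarrow> (('a \<Rightarrow> real) \<times> ('a \<Rightarrow> real)) set" where
  "qs_rel M Ps = {(X, Y). X \<in> bounded_measurable M \<and> Y \<in> bounded_measurable M \<and>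
     qs Ps (\<lambda>\<omega>. X \<omega> = Y \<omega>)}"

text \<open>An element \<open>\<xi>\<close> of \<open>Linf M Ps\<close> is an equivalence class. Below, statements about \<open>\<xi>\<close> that do
  not depend on the representative are written with a quantifier \<open>\<forall>X\<in>\<xi>\<close>.\<close>

definition Linf :: "'a measure \<Rightarrow> 'a measure set \<Rightarrow> ('a \<Rightarrow> real) set set" where
  "Linf M Ps = bounded_measurable M // qs_rel M Ps"

definition ca_c_dual_eq_Linf :: "'a measure \<Rightarrow> 'a measure set \<Rightarrow> bool" where
  "ca_c_dual_eq_Linf M Ps \<longleftrightarrow>
     (\<forall>l\<in>ca_c_dual M Ps. \<exists>\<xi>\<in>Linf M Ps. \<forall>X\<in>\<xi>. \<forall>\<mu>\<in>ca_c M Ps. l \<mu> = signed_integral M \<mu> X)"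

text \<open>Every \<open>Q\<close>-essentially bounded function has a bounded version, so \<open>Linf M {Q}\<close> is the usual
  \<open>L\<^sup>\<infinity>(Q)\<close>, and \<open>j_map M Q\<close> maps \<open>Linf M Ps\<close> into it if \<open>{Q}\<close> is dominated by \<open>Ps\<close>. All sets in
  the union below are then the same class.\<close>

definition j_map :: "'a measure \<Rightarrow> 'a measure \<Rightarrow> ('a \<Rightarrow> real) set \<Rightarrow> ('a \<Rightarrow> real) set" where
  "j_map M Q \<xi> = (\<Union>X\<in>\<xi>. qs_rel M {Q} `` {X})"

text \<open>The intersection with \<^const>\<open>Linf\<close> restricts the preimages to the domain of \<^const>\<open>j_map\<close>.\<close>

definition sensitive :: "'a measure \<Rightarrow> 'a measure set \<Rightarrow> ('a \<Rightarrow> real) set set \<Rightarrow> bool" where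
  "sensitive M Ps \<A> \<longleftrightarrow> (\<exists>Qs. Qs \<subseteq> prob_measures M \<and> dominated M Qs Ps \<and>
     \<A> = Linf M Ps \<inter> (\<Inter>Q\<in>Qs. j_map M Q -` (j_map M Q ` \<A>)))"


section \<open>The market model\<close>

definition filtration_upto :: "'a measure \<Rightarrow> nat \<Rightarrow> (nat \<Rightarrow> 'a measure) \<Rightarrow> bool" where
  "filtration_upto M T F \<longleftrightarrow> (\<forall>t\<le>T. subalgebra M (F t)) \<and>
     (\<forall>t\<le>T. \<forall>s\<le>t. sets (F s) \<subseteq> sets (F t))"

definition adapted_upto ::
    "nat \<Rightarrow> (nat \<Rightarrow> 'a measure) \<Rightarrow> (nat \<Rightarrow> 'a \<Rightarrow> real ^ 'd) \<Rightarrow> bool" where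
  "adapted_upto T F S \<longleftrightarrow> (\<forall>t\<le>T. S t \<in> borel_measurable (F t))"

definition qs_bounded ::
    "'a measure set \<Rightarrow> nat \<Rightarrow> (nat \<Rightarrow> 'a \<Rightarrow> real ^ 'd) \<Rightarrow> bool" where
  "qs_bounded Ps T S \<longleftrightarrow> (\<exists>K. \<forall>t\<le>T. qs Ps (\<lambda>\<omega>. norm (S t \<omega>) \<le> K))"

text \<open>The values \<open>H t\<close> for \<open>t = 0\<close> and \<open>t > T\<close> are unconstrained and never used.\<close>

definition strategies ::
    "nat \<Rightarrow> (nat \<Rightarrow> 'a measure) \<Rightarrow> (nat \<Rightarrow> 'a \<Rightarrow> real ^ 'd) set" where
  "strategies T F = {H. \<forall>t\<in>{1..T}. H t \<in> borel_measurable (F (t - 1))}"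

definition gain ::
    "(nat \<Rightarrow> 'a \<Rightarrow> real ^ 'd) \<Rightarrow> (nat \<Rightarrow> 'a \<Rightarrow> real ^ 'd) \<Rightarrow> nat \<Rightarrow> 'a \<Rightarrow> real" where
  "gain H S t \<omega> = (\<Sum>k=1..t. \<Sum>j\<in>UNIV. H k \<omega> $ j * (S k \<omega> $ j - S (k - 1) \<omega> $ j))"

definition no_arbitrage ::
    "'a measure set \<Rightarrow> nat \<Rightarrow> (nat \<Rightarrow> 'a measure) \<Rightarrow> (nat \<Rightarrow> 'a \<Rightarrow> real ^ 'd) \<Rightarrow> bool" where
  "no_arbitrage Ps T F S \<longleftrightarrow> (\<forall>H\<in>strategies T F.
     qs Ps (\<lambda>\<omega>. gain H S T \<omega> \<ge> 0) \<longrightarrow> qs Ps (\<lambda>\<omega>. gain H S T \<omega> = 0))"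

definition hedge_cone ::
    "'a measure \<Rightarrow> 'a measure set \<Rightarrow> nat \<Rightarrow> (nat \<Rightarrow> 'a measure) \<Rightarrow> (nat \<Rightarrow> 'a \<Rightarrow> real ^ 'd)
      \<Rightarrow> ('a \<Rightarrow> real) set set" where
  "hedge_cone M Ps T F S =
     {\<xi> \<in> Linf M Ps. \<exists>H\<in>strategies T F. \<forall>X\<in>\<xi>. qs Ps (\<lambda>\<omega>. X \<omega> \<le> gain H S T \<omega>)}"

definition polar ::
    "'a measure \<Rightarrow> 'a measure set \<Rightarrow> ('a \<Rightarrow> real) set set \<Rightarrow> ('a set \<Rightarrow> real) set" where
  "polar M Ps \<C> = {\<mu> \<in> ca_c M Ps. \<forall>\<xi>\<in>\<C>. \<forall>X\<in>\<xi>. signed_integral M \<mu> X \<le> 0}"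

definition polar_prob ::
    "'a measure \<Rightarrow> 'a measure set \<Rightarrow> ('a \<Rightarrow> real) set set \<Rightarrow> 'a measure set" where
  "polar_prob M Ps \<C> = {Q \<in> prob_measures M. measure Q \<in> polar M Ps \<C>}"

text \<open>Valued in \<^typ>\<open>ereal\<close>, with the usual conventions for the infimum of an empty or unbounded
  set.\<close>

definition superhedging_price ::
    "'a measure set \<Rightarrow> nat \<Rightarrow> (nat \<Rightarrow> 'a measure) \<Rightarrow> (nat \<Rightarrow> 'a \<Rightarrow> real ^ 'd)
      \<Rightarrow> ('a \<Rightarrow> real) set \<Rightarrow> ereal" where
  "superhedging_price Ps T F S \<xi> =
     Inf (ereal ` {x. \<exists>H\<in>strategies T F. \<forall>X\<in>\<xi>. qs Ps (\<lambda>\<omega>. x + gain H S T \<omega> \<ge> X \<omega>)})"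

end

theory Submission imports Defs begin

text \<open>Under no arbitrage the claims dominated by a terminal gain are closed under quasi-sure limits. This is
  the Kabanov--Stricker argument with measurable random subsequences; treating every pair (date, asset) as a
  separate scalar position makes a single induction over the positions sufficient. Hence \<open>\<C>\<close> is a
  solid cone that is closed under bounded quasi-sure limits. By \<open>\<P>\<close>-sensitivity, closedness of the
  norm-bounded parts of \<open>\<C>\<close> can be tested under each \<open>Q \<in> \<Q>\<close>, where it follows by projecting in
  \<open>L\<^sup>2(Q)\<close>; with \<open>ca\<^sub>c\<^sup>* = L\<^sup>\<infinity>\<^sub>c\<close> and Tychonoff's theorem the bounded parts are weak* compact.
  For \<open>X \<notin> \<C>\<close> a minimax argument gives a charge that separates \<open>X\<close> from a large bounded part of \<open>\<C>\<close>, and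
  a geometric series of small corrections, each again obtained by minimax, moves it into the polar cone of
  \<open>\<C>\<close> (the Krein--Smulian theorem for cones). Normalising it gives \<open>Q \<in> \<C>\<^sup>0\<^sub>1\<close> with \<open>E\<^sub>Q[X] > 0\<close>, and both
  assertions follow.\<close>

section \<open>Finite signed measures\<close>

text \<open>Without a measure dominating \<open>Ps\<close>, weak* closure points of the cone need
  not be limits of sequences, so closedness under quasi-sure limits does not yield weak* closedness
  by itself. Sensitivity bridges the gap: membership is decided under one \<open>Q\<close> at a
  time, where projection produces a sequence, and solidity turns its \<open>Q\<close>-a.s. limit
  into a quasi-sure one. This works only at a fixed bound, so a charge \<open>\<mu>\<close> that
  separates \<open>X\<close> from the claims bounded by \<open>L\<close> may still be positive
  elsewhere on the cone. By homogeneity its excess at \<open>Y\<close> is at most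
  \<open>\<epsilon>\<close> times the norm of \<open>Y\<close>, where \<open>\<epsilon>\<close> is
  the integral of \<open>X\<close> divided by \<open>L\<close>; this excess is what the corrections
  remove. Choosing \<open>L\<close> large compared with the bound on \<open>X\<close> keeps their
  total effect on \<open>X\<close> below the initial gap. Separation by hyperplanes is used only in
  the plane: minimax for two functions, induction and compactness do the rest. No vector space of
  classes is built; claims are bounded representatives, charges are set functions, and weak*
  convergence is pointwise convergence of functionals.\<close>

lemma ca_outside: "\<mu> \<in> ca M \<Longrightarrow> A \<notin> sets M \<Longrightarrow> \<mu> A = 0"
  by (simp add: ca_def)

lemma ca_sums:
  "\<mu> \<in> ca M \<Longrightarrow> range A \<subseteq> sets M \<Longrightarrow> disjoint_family A \<Longrightarrow> (\<lambda>n::nat. \<mu> (A n)) sums \<mu> (\<Union>n. A n)"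
  by (simp add: ca_def)

lemma ca_empty:
  assumes "\<mu> \<in> ca M" shows "\<mu> {} = 0"
proof -
  have "(\<lambda>n::nat. \<mu> {}) sums \<mu> (\<Union>n::nat. {})"
    by (rule ca_sums[OF assms]) (auto simp: disjoint_family_on_def)
  then show ?thesis using summable_const_iff sums_summable by blast
qed

lemma ca_union:
  assumes "\<mu> \<in> ca M" "A \<in> sets M" "B \<in> sets M" "A \<inter> B = {}"
  shows "\<mu> (A \<union> B) = \<mu> A + \<mu> B"
proof -
  have "(\<lambda>n. \<mu> (binaryset A B n)) sums \<mu> (\<Union>n. binaryset A B n)"
  proof (rule ca_sums[OF assms(1)])
    show "range (binaryset A B) \<subseteq> sets M" using assms by (auto simp: range_binaryset_eq)
    show "disjoint_family (binaryset A B)"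
      using assms(4) by (auto simp: disjoint_family_on_def binaryset_def)
  qed
  moreover have "(\<lambda>n. \<mu> (binaryset A B n)) sums (\<mu> A + \<mu> B)"
    by (rule binaryset_sums) (rule ca_empty[OF assms(1)])
  ultimately show ?thesis by (simp add: UN_binaryset_eq sums_unique2)
qed

lemma ca_diff:
  assumes "\<mu> \<in> ca M" "A \<in> sets M" "B \<in> sets M" "B \<subseteq> A"
  shows "\<mu> (A - B) = \<mu> A - \<mu> B"
  using ca_union[OF assms(1,3), of "A - B"] assms by (simp add: Un_absorb1 sets.Diff)

lemma ca_lincomb:
  assumes "\<mu> \<in> ca M" "\<nu> \<in> ca M"
  shows "(\<lambda>A. a * \<mu> A + b * \<nu> A) \<in> ca M"
  using assms by (auto simp: ca_def intro!: sums_add sums_mult)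

lemma ca_uminus: "\<mu> \<in> ca M \<Longrightarrow> (\<lambda>A. - \<mu> A) \<in> ca M"
  using ca_lincomb[of \<mu> M \<mu> "-1" 0] by simp

lemma ca_c_lincomb:
  assumes "\<mu> \<in> ca_c M Ps" "\<nu> \<in> ca_c M Ps"
  shows "(\<lambda>A. a * \<mu> A + b * \<nu> A) \<in> ca_c M Ps"
  using assms by (auto simp: ca_c_def intro!: ca_lincomb)

lemma ca_c_ca: "\<mu> \<in> ca_c M Ps \<Longrightarrow> \<mu> \<in> ca M"
  by (simp add: ca_c_def)

section \<open>Positive parts and the Jordan decomposition\<close>

definition sup_part :: "'a measure \<Rightarrow> ('a set \<Rightarrow> real) \<Rightarrow> 'a set \<Rightarrow> ennreal" where
  "sup_part M \<mu> A = (SUP B\<in>{B \<in> sets M. B \<subseteq> A}. ennreal (\<mu> B))"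

lemma sup_part_upper: "B \<in> sets M \<Longrightarrow> B \<subseteq> A \<Longrightarrow> ennreal (\<mu> B) \<le> sup_part M \<mu> A"
  unfolding sup_part_def by (rule SUP_upper) auto

lemma sup_part_least: "(\<And>B. B \<in> sets M \<Longrightarrow> B \<subseteq> A \<Longrightarrow> ennreal (\<mu> B) \<le> c) \<Longrightarrow> sup_part M \<mu> A \<le> c"
  unfolding sup_part_def by (rule SUP_least) auto

lemma sup_part_empty: "\<mu> \<in> ca M \<Longrightarrow> sup_part M \<mu> {} = 0"
  using sup_part_least[of M "{}" \<mu> 0] by (auto simp: ca_empty le_zero_eq)

lemma sup_part_mono: "A \<subseteq> A' \<Longrightarrow> sup_part M \<mu> A \<le> sup_part M \<mu> A'"
  by (rule sup_part_least, rule sup_part_upper) auto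

text \<open>Competitors for two disjoint sets unite to a competitor for the union.\<close>

lemma sup_part_superadd:
  assumes mu: "\<mu> \<in> ca M" and AB: "A \<inter> B = {}"
  shows "sup_part M \<mu> A + sup_part M \<mu> B \<le> sup_part M \<mu> (A \<union> B)"
proof -
  have ne: "{B \<in> sets M. B \<subseteq> X} \<noteq> {}" for X by (auto intro: exI[of _ "{}"])
  have *: "ennreal (\<mu> C) + ennreal (\<mu> D) \<le> sup_part M \<mu> (A \<union> B)"
    if "C \<in> sets M" "C \<subseteq> A" "D \<in> sets M" "D \<subseteq> B" for C D
  proof -
    have U: "\<mu> (C \<union> D) = \<mu> C + \<mu> D" using that AB by (intro ca_union[OF mu]) auto
    have 1: "ennreal (\<mu> (C \<union> D)) \<le> sup_part M \<mu> (A \<union> B)"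
      using that by (intro sup_part_upper) auto
    have 2: "ennreal (\<mu> C) \<le> sup_part M \<mu> (A \<union> B)" "ennreal (\<mu> D) \<le> sup_part M \<mu> (A \<union> B)"
      using that by (auto intro!: sup_part_upper)
    show ?thesis
    proof (cases "0 \<le> \<mu> C \<and> 0 \<le> \<mu> D")
      case True then show ?thesis using 1 U by (simp add: ennreal_plus)
    next
      \<comment> \<open>A negative value is truncated to 0 by \<open>ennreal\<close>, and the other
        set alone is a competitor.\<close>
      case False then show ?thesis using 2 by (auto simp: not_le ennreal_neg)
    qed
  qed
  have 1: "sup_part M \<mu> A + ennreal (\<mu> D) \<le> sup_part M \<mu> (A \<union> B)" if "D \<in> sets M" "D \<subseteq> B" for D
  proof -
    have "sup_part M \<mu> A + ennreal (\<mu> D) = (SUP C\<in>{C \<in> sets M. C \<subseteq> A}. ennreal (\<mu> C) + ennreal (\<mu> D))"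
      unfolding sup_part_def by (rule ennreal_SUP_add_left[OF ne, symmetric])
    also have "\<dots> \<le> sup_part M \<mu> (A \<union> B)" by (rule SUP_least) (use * that in auto)
    finally show ?thesis .
  qed
  have "sup_part M \<mu> A + sup_part M \<mu> B = (SUP D\<in>{D \<in> sets M. D \<subseteq> B}. sup_part M \<mu> A + ennreal (\<mu> D))"
    unfolding sup_part_def[of M \<mu> B] by (rule ennreal_SUP_add_right[OF ne])
  also have "\<dots> \<le> sup_part M \<mu> (A \<union> B)" by (rule SUP_least) (use 1 in auto)
  finally show ?thesis .
qed

text \<open>One inequality is superadditivity over finite unions. For the other, a competitor
  \<open>B\<close> for the union is cut into the pieces \<open>B \<inter> A n\<close>, and
  sigma-additivity of \<open>\<mu>\<close> adds up their values.\<close>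

lemma sup_part_countably_additive:
  assumes mu: "\<mu> \<in> ca M"
  shows "countably_additive (sets M) (sup_part M \<mu>)"
proof (rule countably_additiveI)
  fix A :: "nat \<Rightarrow> 'a set" assume A: "range A \<subseteq> sets M" "disjoint_family A" "(\<Union>i. A i) \<in> sets M"
  show "(\<Sum>i. sup_part M \<mu> (A i)) = sup_part M \<mu> (\<Union>i. A i)"
  proof (rule antisym)
    show "(\<Sum>i. sup_part M \<mu> (A i)) \<le> sup_part M \<mu> (\<Union>i. A i)"
    proof (rule suminf_le_const[OF summableI])
      show "(\<Sum>i<n. sup_part M \<mu> (A i)) \<le> sup_part M \<mu> (\<Union>i. A i)" for n
      proof -
        have "(\<Sum>i<n. sup_part M \<mu> (A i)) \<le> sup_part M \<mu> (\<Union>i<n. A i)"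
        proof (induction n)
          case 0 then show ?case by simp
        next
          case (Suc n)
          have dis: "(\<Union>i<n. A i) \<inter> A n = {}"
          proof -
            have "A i \<inter> A n = {}" if "i < n" for i
              using that by (intro disjoint_family_onD[OF A(2)]) auto
            then show ?thesis by blast
          qed
          have "(\<Sum>i<Suc n. sup_part M \<mu> (A i)) \<le> sup_part M \<mu> (\<Union>i<n. A i) + sup_part M \<mu> (A n)"
            using Suc by (simp add: add_right_mono)
          also have "\<dots> \<le> sup_part M \<mu> ((\<Union>i<n. A i) \<union> A n)" by (rule sup_part_superadd[OF mu dis])
          also have "(\<Union>i<n. A i) \<union> A n = (\<Union>i<Suc n. A i)" by (auto simp: lessThan_Suc)
          finally show ?case .
        qed
        also have "\<dots> \<le> sup_part M \<mu> (\<Union>i. A i)" by (rule sup_part_mono) auto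
        finally show ?thesis .
      qed
    qed
    show "sup_part M \<mu> (\<Union>i. A i) \<le> (\<Sum>i. sup_part M \<mu> (A i))"
    proof (rule sup_part_least)
      fix B assume B: "B \<in> sets M" "B \<subseteq> (\<Union>i. A i)"
      have s: "(\<lambda>n. \<mu> (B \<inter> A n)) sums \<mu> (\<Union>n. B \<inter> A n)"
      proof (rule ca_sums[OF mu])
        show "range (\<lambda>n. B \<inter> A n) \<subseteq> sets M" using A(1) B(1) by auto
        show "disjoint_family (\<lambda>n. B \<inter> A n)" using A(2) unfolding disjoint_family_on_def by blast
      qed
      have U: "(\<Union>n. B \<inter> A n) = B" using B by auto
      have *: "ennreal (\<mu> (B \<inter> A n)) \<le> sup_part M \<mu> (A n)" for n
        using A B by (intro sup_part_upper) auto
      show "ennreal (\<mu> B) \<le> (\<Sum>i. sup_part M \<mu> (A i))"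
      proof (rule LIMSEQ_le_const2)
        show "(\<lambda>n. ennreal (\<Sum>i<n. \<mu> (B \<inter> A i))) \<longlonglongrightarrow> ennreal (\<mu> B)"
          using s[unfolded sums_def U] by (rule tendsto_ennrealI)
        show "\<exists>N. \<forall>n\<ge>N. ennreal (\<Sum>i<n. \<mu> (B \<inter> A i)) \<le> (\<Sum>i. sup_part M \<mu> (A i))"
        proof (intro exI allI impI)
          fix n
          \<comment> \<open>\<open>sum_ennreal\<close> needs nonnegative terms, hence the passage to
            positive parts.\<close>
          have "ennreal (\<Sum>i<n. \<mu> (B \<inter> A i)) \<le> ennreal (\<Sum>i<n. max 0 (\<mu> (B \<inter> A i)))"
            by (intro ennreal_leI sum_mono) auto
          also have "\<dots> = (\<Sum>i<n. ennreal (max 0 (\<mu> (B \<inter> A i))))" by (rule sum_ennreal[symmetric]) simp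
          also have "\<dots> \<le> (\<Sum>i<n. sup_part M \<mu> (A i))"
          proof (rule sum_mono)
            show "ennreal (max 0 (\<mu> (B \<inter> A i))) \<le> sup_part M \<mu> (A i)" for i
              using *[of i] by (cases "0 \<le> \<mu> (B \<inter> A i)") (simp_all add: max_def)
          qed
          also have "\<dots> \<le> (\<Sum>i. sup_part M \<mu> (A i))" by (rule sum_le_suminf) auto
          finally show "ennreal (\<Sum>i<n. \<mu> (B \<inter> A i)) \<le> (\<Sum>i. sup_part M \<mu> (A i))" .
        qed
      qed
    qed
  qed
qed

lemma pos_part_eq: "pos_part M \<mu> = measure_of (space M) (sets M) (sup_part M \<mu>)"
  by (simp add: pos_part_def sup_part_def[abs_def])

lemma sets_pos_part [simp, measurable_cong]: "sets (pos_part M \<mu>) = sets M"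
  by (simp add: pos_part_def)

lemma space_pos_part [simp]: "space (pos_part M \<mu>) = space M"
  by (simp add: pos_part_def)

lemma sets_neg_part [simp, measurable_cong]: "sets (neg_part M \<mu>) = sets M"
  by (simp add: neg_part_def)

lemma space_neg_part [simp]: "space (neg_part M \<mu>) = space M"
  by (simp add: neg_part_def)

lemma emeasure_pos_part:
  assumes "\<mu> \<in> ca M" "A \<in> sets M"
  shows "emeasure (pos_part M \<mu>) A = sup_part M \<mu> A"
  unfolding pos_part_eq
proof (rule emeasure_measure_of_sigma)
  show "sigma_algebra (space M) (sets M)" by (rule sets.sigma_algebra_axioms)
  show "positive (sets M) (sup_part M \<mu>)" using assms(1) by (simp add: positive_def sup_part_empty)
  show "countably_additive (sets M) (sup_part M \<mu>)" by (rule sup_part_countably_additive[OF assms(1)])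
qed (rule assms(2))

lemma ca_decseq_tendsto:
  assumes mu: "\<mu> \<in> ca M" and A: "range A \<subseteq> sets M" "decseq A"
  shows "(\<lambda>n. \<mu> (A n)) \<longlonglongrightarrow> \<mu> (\<Inter>n. A n)"
proof -
  define D where "D n = A n - A (Suc n)" for n
  have D: "range D \<subseteq> sets M" using A by (auto simp: D_def)
  have dis: "disjoint_family D"
  proof -
    have "D m \<inter> D n = {}" if "m < n" for m n
      using decseqD[OF A(2), of "Suc m" n] that by (auto simp: D_def)
    then show ?thesis unfolding disjoint_family_on_def by (metis Int_commute linorder_neqE_nat)
  qed
  have *: "A 0 - A n = (\<Union>i<n. D i)" for n
  proof (induction n)
    case (Suc n)
    have "A 0 - A (Suc n) = (A 0 - A n) \<union> D n"
      using decseqD[OF A(2), of 0 n] decseqD[OF A(2), of n "Suc n"] by (auto simp: D_def)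
    then show ?case using Suc by (auto simp: lessThan_Suc)
  qed simp
  have U: "(\<Union>i. D i) = A 0 - (\<Inter>n. A n)"
  proof -
    have "(\<Union>i. D i) = (\<Union>n. \<Union>i<n. D i)" by auto
    also have "\<dots> = A 0 - (\<Inter>n. A n)" by (auto simp: *[symmetric])
    finally show ?thesis .
  qed
  have sum: "(\<Sum>i<n. \<mu> (D i)) = \<mu> (A 0) - \<mu> (A n)" for n
  proof (induction n)
    case (Suc n)
    have "\<mu> (D n) = \<mu> (A n) - \<mu> (A (Suc n))"
      unfolding D_def using A by (intro ca_diff[OF mu]) (auto simp: decseqD)
    then show ?case using Suc by simp
  qed simp
  have I: "(\<Inter>n. A n) \<in> sets M" using A by (intro sets.countable_INT) auto
  have "(\<lambda>n. \<mu> (A 0) - \<mu> (A n)) \<longlonglongrightarrow> \<mu> (A 0 - (\<Inter>n. A n))"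
    using ca_sums[OF mu D dis] by (simp add: sums_def U sum)
  also have "\<mu> (A 0 - (\<Inter>n. A n)) = \<mu> (A 0) - \<mu> (\<Inter>n. A n)"
    using A I by (intro ca_diff[OF mu]) auto
  finally have L: "(\<lambda>n. \<mu> (A 0) - \<mu> (A n)) \<longlonglongrightarrow> \<mu> (A 0) - \<mu> (\<Inter>n. A n)" .
  have "(\<lambda>n. \<mu> (A 0) - (\<mu> (A 0) - \<mu> (A n))) \<longlonglongrightarrow> \<mu> (A 0) - (\<mu> (A 0) - \<mu> (\<Inter>n. A n))"
    by (rule tendsto_diff[OF tendsto_const L])
  moreover have "a - (a - x) = x" for a x :: real by simp
  ultimately show ?thesis by (simp only:)
qed

text \<open>If \<open>\<mu>\<close> were unbounded, repeated bisection would give a decreasing sequence of sets along which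
  \<open>\<bar>\<mu>\<bar>\<close> tends to infinity, contradicting continuity from above.\<close>

lemma sup_part_finite:
  assumes mu: "\<mu> \<in> ca M"
  shows "sup_part M \<mu> (space M) < \<infinity>"
proof (rule ccontr)
  define P where "P A \<longleftrightarrow> A \<in> sets M \<and> sup_part M \<mu> A = \<infinity>" for A
  assume "\<not> ?thesis"
  then have "sup_part M \<mu> (space M) = \<infinity>" by (metis infinity_ennreal_def top.not_eq_extremum)
  then have P0: "P (space M)" by (simp add: P_def)
  have step: "\<exists>B. P B \<and> B \<subseteq> A \<and> real n \<le> \<bar>\<mu> B\<bar>" if PA: "P A" for A n
  proof -
    \<comment> \<open>The offset \<open>\<bar>\<mu> A\<bar>\<close> makes both \<open>B\<close> and
      \<open>A - B\<close> large in absolute value, so whichever of them has infinite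
      \<open>sup_part\<close> can be kept.\<close>
    have "ennreal (real n + \<bar>\<mu> A\<bar>) < sup_part M \<mu> A" using PA by (simp add: P_def)
    then obtain B where B: "B \<in> sets M" "B \<subseteq> A" and "ennreal (real n + \<bar>\<mu> A\<bar>) < ennreal (\<mu> B)"
      unfolding sup_part_def by (auto simp: less_SUP_iff)
    then have big: "real n + \<bar>\<mu> A\<bar> < \<mu> B" by (subst (asm) ennreal_less_iff) auto
    have "\<mu> (A - B) = \<mu> A - \<mu> B" using B PA by (intro ca_diff[OF mu]) (auto simp: P_def)
    then have big2: "real n \<le> \<bar>\<mu> (A - B)\<bar>" using big by linarith
    have "additive (sets M) (sup_part M \<mu>)"
      by (rule sets.countably_additive_additive)
        (auto simp: positive_def sup_part_empty[OF mu] sup_part_countably_additive[OF mu])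
    then have "sup_part M \<mu> (A - B) + sup_part M \<mu> B = sup_part M \<mu> (A - B \<union> B)"
      using B PA by (intro additiveD[symmetric]) (auto simp: P_def)
    also have "A - B \<union> B = A" using B by auto
    finally have "sup_part M \<mu> (A - B) = \<infinity> \<or> sup_part M \<mu> B = \<infinity>"
      using PA by (auto simp: P_def)
    then show ?thesis
    proof
      assume "sup_part M \<mu> (A - B) = \<infinity>"
      then show ?thesis using big2 B PA by (intro exI[of _ "A - B"]) (auto simp: P_def)
    next
      assume "sup_part M \<mu> B = \<infinity>"
      then show ?thesis using big B by (intro exI[of _ B]) (auto simp: P_def)
    qed
  qed
  have "\<exists>A. \<forall>n. P (A n) \<and> A (Suc n) \<subseteq> A n \<and> real n \<le> \<bar>\<mu> (A (Suc n))\<bar>"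
  proof (rule exE[OF dependent_nat_choice[of "\<lambda>n. P" "\<lambda>n A B. B \<subseteq> A \<and> real n \<le> \<bar>\<mu> B\<bar>"]])
    show "\<exists>A. P A" using P0 by blast
    show "\<exists>B. P B \<and> B \<subseteq> A \<and> real n \<le> \<bar>\<mu> B\<bar>" if "P A" for A n by (rule step[OF that])
  qed blast
  then obtain A where A: "\<And>n. P (A n)" "\<And>n. A (Suc n) \<subseteq> A n" "\<And>n. real n \<le> \<bar>\<mu> (A (Suc n))\<bar>"
    by auto
  have "(\<lambda>n. \<mu> (A n)) \<longlonglongrightarrow> \<mu> (\<Inter>n. A n)"
    using A by (intro ca_decseq_tendsto[OF mu]) (auto simp: P_def decseq_Suc_iff)
  then have "Bseq (\<lambda>n. \<mu> (A (Suc n)))"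
    by (intro convergent_imp_Bseq convergentI LIMSEQ_Suc)
  then obtain K where "\<And>n. \<bar>\<mu> (A (Suc n))\<bar> \<le> K" by (auto simp: Bseq_def)
  then have "real n \<le> K" for n by (rule order_trans[OF A(3)])
  then show False using reals_Archimedean2[of K] by (auto simp: not_less[symmetric])
qed

lemma finite_measure_pos_part:
  assumes "\<mu> \<in> ca M" shows "finite_measure (pos_part M \<mu>)"
  using sup_part_finite[OF assms] by (intro finite_measureI) (simp add: emeasure_pos_part[OF assms])

lemma finite_measure_neg_part:
  assumes "\<mu> \<in> ca M" shows "finite_measure (neg_part M \<mu>)"
  unfolding neg_part_def by (intro finite_measure_pos_part ca_uminus assms)

lemma measure_pos_part_upper:
  assumes mu: "\<mu> \<in> ca M" and "A \<in> sets M" "B \<in> sets M" "B \<subseteq> A"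
  shows "\<mu> B \<le> measure (pos_part M \<mu>) A"
proof -
  interpret finite_measure "pos_part M \<mu>" by (rule finite_measure_pos_part[OF mu])
  have "ennreal (\<mu> B) \<le> ennreal (measure (pos_part M \<mu>) A)"
    using sup_part_upper[of B M A \<mu>] assms by (simp add: emeasure_pos_part flip: emeasure_eq_measure)
  then show ?thesis by (simp add: ennreal_le_iff2) (smt (verit) measure_nonneg)
qed

lemma measure_pos_part_least:
  assumes mu: "\<mu> \<in> ca M" and A: "A \<in> sets M"
    and *: "\<And>B. B \<in> sets M \<Longrightarrow> B \<subseteq> A \<Longrightarrow> \<mu> B \<le> c"
  shows "measure (pos_part M \<mu>) A \<le> c"
proof -
  interpret finite_measure "pos_part M \<mu>" by (rule finite_measure_pos_part[OF mu])
  have c: "0 \<le> c" using *[of "{}"] ca_empty[OF mu] by auto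
  have "emeasure (pos_part M \<mu>) A \<le> ennreal c"
    unfolding emeasure_pos_part[OF mu A] by (intro sup_part_least ennreal_leI *)
  then show ?thesis using c by (simp add: emeasure_eq_measure)
qed

text \<open>The two suprema determine each other by complementation: with \<open>B\<close> also
  \<open>A - B\<close> is a competitor, and
  \<open>\<mu> B + \<mu> (A - B) = \<mu> A\<close>.\<close>

lemma ca_jordan:
  assumes mu: "\<mu> \<in> ca M" and A: "A \<in> sets M"
  shows "\<mu> A = measure (pos_part M \<mu>) A - measure (neg_part M \<mu>) A"
proof -
  have "measure (neg_part M \<mu>) A \<le> measure (pos_part M \<mu>) A - \<mu> A"
    unfolding neg_part_def
  proof (rule measure_pos_part_least[OF ca_uminus[OF mu] A])
    fix B assume B: "B \<in> sets M" "B \<subseteq> A"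
    then show "- \<mu> B \<le> measure (pos_part M \<mu>) A - \<mu> A"
      using measure_pos_part_upper[OF mu A, of "A - B"] ca_diff[OF mu A, of B] A by auto
  qed
  moreover have "measure (pos_part M \<mu>) A \<le> measure (neg_part M \<mu>) A + \<mu> A"
  proof (rule measure_pos_part_least[OF mu A])
    fix B assume B: "B \<in> sets M" "B \<subseteq> A"
    then show "\<mu> B \<le> measure (neg_part M \<mu>) A + \<mu> A"
      using measure_pos_part_upper[OF ca_uminus[OF mu] A, of "A - B"] ca_diff[OF mu A, of B] A
      by (auto simp: neg_part_def)
  qed
  ultimately show ?thesis by linarith
qed

section \<open>Bounded functions and their integrals against charges\<close>

lemma bounded_measurableD:
  assumes "X \<in> bounded_measurable M"
  shows "X \<in> borel_measurable M" "\<exists>K\<ge>0. \<forall>\<omega>\<in>space M. \<bar>X \<omega>\<bar> \<le> K"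
proof -
  obtain K where "\<forall>\<omega>\<in>space M. \<bar>X \<omega>\<bar> \<le> K" using assms by (auto simp: bounded_measurable_def)
  then show "\<exists>K\<ge>0. \<forall>\<omega>\<in>space M. \<bar>X \<omega>\<bar> \<le> K" by (intro exI[of _ "\<bar>K\<bar>"]) auto
qed (use assms in \<open>simp add: bounded_measurable_def\<close>)

lemma bounded_measurableI:
  "X \<in> borel_measurable M \<Longrightarrow> (\<And>\<omega>. \<omega> \<in> space M \<Longrightarrow> \<bar>X \<omega>\<bar> \<le> K) \<Longrightarrow> X \<in> bounded_measurable M"
  by (auto simp: bounded_measurable_def)

lemma bounded_measurable_lincomb:
  assumes "X \<in> bounded_measurable M" "Y \<in> bounded_measurable M"
  shows "(\<lambda>\<omega>. a * X \<omega> + b * Y \<omega>) \<in> bounded_measurable M"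
proof -
  obtain K L where "\<forall>\<omega>\<in>space M. \<bar>X \<omega>\<bar> \<le> K" "\<forall>\<omega>\<in>space M. \<bar>Y \<omega>\<bar> \<le> L"
    using bounded_measurableD(2)[OF assms(1)] bounded_measurableD(2)[OF assms(2)] by auto
  then show ?thesis
    using bounded_measurableD(1)[OF assms(1)] bounded_measurableD(1)[OF assms(2)]
    by (intro bounded_measurableI[where K="\<bar>a\<bar> * K + \<bar>b\<bar> * L"])
      (auto intro!: order_trans[OF abs_triangle_ineq] add_mono mult_left_mono simp: abs_mult)
qed

lemma bounded_measurable_const: "(\<lambda>_. c) \<in> bounded_measurable M"
  by (rule bounded_measurableI[where K="\<bar>c\<bar>"]) auto

lemma bounded_measurable_mult:
  assumes "X \<in> bounded_measurable M" "Y \<in> bounded_measurable M"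
  shows "(\<lambda>\<omega>. X \<omega> * Y \<omega>) \<in> bounded_measurable M"
proof -
  obtain K L where "0 \<le> K" "\<forall>\<omega>\<in>space M. \<bar>X \<omega>\<bar> \<le> K" "\<forall>\<omega>\<in>space M. \<bar>Y \<omega>\<bar> \<le> L"
    using bounded_measurableD(2)[OF assms(1)] bounded_measurableD(2)[OF assms(2)] by auto
  then show ?thesis
    using bounded_measurableD(1)[OF assms(1)] bounded_measurableD(1)[OF assms(2)]
    by (intro bounded_measurableI[where K="K * L"]) (auto simp: abs_mult intro!: mult_mono)
qed

lemma bounded_measurable_indicator: "A \<in> sets M \<Longrightarrow> indicator A \<in> bounded_measurable M"
  by (rule bounded_measurableI[where K=1]) (auto simp: indicator_def)

lemma integrable_bounded_measurable:
  assumes "finite_measure N" "sets N = sets M" "X \<in> bounded_measurable M"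
  shows "integrable N X"
proof -
  interpret finite_measure N by fact
  obtain K where "\<forall>\<omega>\<in>space M. \<bar>X \<omega>\<bar> \<le> K" using bounded_measurableD(2)[OF assms(3)] by auto
  then show ?thesis
    using bounded_measurableD(1)[OF assms(3)] assms(2)
    by (intro integrable_const_bound[where B=K])
      (auto simp: sets_eq_imp_space_eq[OF assms(2)] cong: measurable_cong_sets)
qed

text \<open>With sums at hand, an identity between differences of measures can be restated as one
  between measures.\<close>

definition add_measure :: "'a measure \<Rightarrow> 'a measure \<Rightarrow> 'a measure" where
  "add_measure N N' = measure_of (space N) (sets N) (\<lambda>A. emeasure N A + emeasure N' A)"

lemma sets_add_measure [simp, measurable_cong]: "sets (add_measure N N') = sets N"
  by (simp add: add_measure_def)

lemma space_add_measure [simp]: "space (add_measure N N') = space N"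
  by (simp add: add_measure_def)

lemma emeasure_add_measure:
  assumes "sets N' = sets N" "A \<in> sets N"
  shows "emeasure (add_measure N N') A = emeasure N A + emeasure N' A"
  unfolding add_measure_def
proof (rule emeasure_measure_of_sigma)
  show "sigma_algebra (space N) (sets N)" by (rule sets.sigma_algebra_axioms)
  show "positive (sets N) (\<lambda>A. emeasure N A + emeasure N' A)" by (simp add: positive_def)
  show "countably_additive (sets N) (\<lambda>A. emeasure N A + emeasure N' A)"
  proof (rule countably_additiveI)
    fix B :: "nat \<Rightarrow> 'a set"
    assume "range B \<subseteq> sets N" "disjoint_family B"
    then have "(\<Sum>i. emeasure N (B i)) = emeasure N (\<Union>i. B i)"
      "(\<Sum>i. emeasure N' (B i)) = emeasure N' (\<Union>i. B i)"
      using assms(1) by (simp_all add: suminf_emeasure)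
    then show "(\<Sum>i. emeasure N (B i) + emeasure N' (B i)) = emeasure N (\<Union>i. B i) + emeasure N' (\<Union>i. B i)"
      by (simp add: suminf_add[symmetric])
  qed
qed fact

lemma nn_integral_add_measure:
  assumes s: "sets N' = sets N" and f: "f \<in> borel_measurable N"
  shows "(\<integral>\<^sup>+x. f x \<partial>add_measure N N') = (\<integral>\<^sup>+x. f x \<partial>N) + (\<integral>\<^sup>+x. f x \<partial>N')"
  using f
proof (induction rule: borel_measurable_induct)
  case (cong f g)
  have "space N' = space N" using s by (rule sets_eq_imp_space_eq)
  then have "(\<integral>\<^sup>+x. f x \<partial>L) = (\<integral>\<^sup>+x. g x \<partial>L)" if "space L = space N" for L
    using cong(3) that by (intro nn_integral_cong) simp
  then show ?case using cong(4) \<open>space N' = space N\<close> by simp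
next
  case (set A)
  then show ?case using s by (simp add: emeasure_add_measure)
next
  case (mult u v)
  then have "u \<in> borel_measurable N'" using s by (simp cong: measurable_cong_sets)
  then show ?case using mult by (simp add: nn_integral_cmult distrib_left)
next
  case (add u v)
  then have "u \<in> borel_measurable N'" "v \<in> borel_measurable N'"
    using s by (simp_all cong: measurable_cong_sets)
  then show ?case using add by (simp add: nn_integral_add ac_simps)
next
  case (seq U)
  then have m: "\<And>i. U i \<in> borel_measurable N'" using s by (simp cong: measurable_cong_sets)
  have i: "incseq (\<lambda>i. \<integral>\<^sup>+x. U i x \<partial>N)" "incseq (\<lambda>i. \<integral>\<^sup>+x. U i x \<partial>N')"
    using seq(3) by (auto simp: incseq_def le_fun_def intro!: nn_integral_mono)
  have E: "(\<integral>\<^sup>+x. (SUP i. U i) x \<partial>L) = (SUP i. \<integral>\<^sup>+x. U i x \<partial>L)"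
    if "\<And>i. U i \<in> borel_measurable L" for L
    unfolding SUP_apply using that seq(3) by (intro nn_integral_monotone_convergence_SUP)
  have mA: "\<And>i. U i \<in> borel_measurable (add_measure N N')" using seq(1) by (simp cong: measurable_cong_sets)
  show ?case unfolding seq(4) E[OF mA] E[OF seq(1)] E[OF m] seq(5) by (rule ennreal_SUP_add[OF i])
qed

lemma finite_add_measure:
  assumes "finite_measure N" "finite_measure N'" "sets N' = sets N"
  shows "finite_measure (add_measure N N')"
    and "A \<in> sets N \<Longrightarrow> measure (add_measure N N') A = measure N A + measure N' A"
proof -
  interpret N: finite_measure N by fact
  interpret N': finite_measure N' by fact
  show "finite_measure (add_measure N N')"
    by (rule finite_measureI) (use assms(3) in \<open>simp add: emeasure_add_measure\<close>)
  show "measure (add_measure N N') A = measure N A + measure N' A" if "A \<in> sets N"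
    using that assms(3)
    by (simp add: measure_def emeasure_add_measure enn2real_plus less_top[symmetric])
qed

lemma integral_add_measure:
  fixes X :: "'a \<Rightarrow> real"
  assumes "finite_measure N" "finite_measure N'" "sets N = sets M" "sets N' = sets M"
    and X: "X \<in> bounded_measurable M"
  shows "(\<integral>x. X x \<partial>add_measure N N') = (\<integral>x. X x \<partial>N) + (\<integral>x. X x \<partial>N')"
proof -
  have s: "sets N' = sets N" using assms by simp
  have m: "X \<in> borel_measurable N" using bounded_measurableD(1)[OF X] assms(3) by (simp cong: measurable_cong_sets)
  note fin = assms(1,2) finite_add_measure(1)[OF assms(1,2) s]
  have int: "integrable N X" "integrable N' X" "integrable (add_measure N N') X"
    using integrable_bounded_measurable[OF assms(1,3) X] integrable_bounded_measurable[OF assms(2,4) X]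
      integrable_bounded_measurable[OF fin(3) _ X] assms(3) by simp_all
  have fin': "(\<integral>\<^sup>+x. ennreal (X x) \<partial>L) < top" "(\<integral>\<^sup>+x. ennreal (- X x) \<partial>L) < top"
    if "integrable L X" for L
    using that by (simp_all add: real_integrable_def less_top[symmetric])
  have p: "(\<lambda>x. ennreal (X x)) \<in> borel_measurable N" and n: "(\<lambda>x. ennreal (- X x)) \<in> borel_measurable N"
    using m by simp_all
  show ?thesis
    unfolding real_lebesgue_integral_def[OF int(1)] real_lebesgue_integral_def[OF int(2)]
      real_lebesgue_integral_def[OF int(3)] nn_integral_add_measure[OF s p] nn_integral_add_measure[OF s n]
      enn2real_plus[OF fin'(1)[OF int(1)] fin'(1)[OF int(2)]] enn2real_plus[OF fin'(2)[OF int(1)] fin'(2)[OF int(2)]]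
    by (rule add_diff_add)
qed

text \<open>From \<open>p - n = N - N'\<close> follows \<open>p + N' = n + N\<close>, an equality of
  measures that can be integrated. The integral may therefore be computed from any decomposition,
  which gives linearity in \<open>\<mu>\<close> although \<open>pos_part\<close> is not
  additive.\<close>

lemma signed_integral_eqI:
  assumes mu: "\<mu> \<in> ca M" and N: "finite_measure N" "finite_measure N'" "sets N = sets M" "sets N' = sets M"
    and eq: "\<And>A. A \<in> sets M \<Longrightarrow> \<mu> A = measure N A - measure N' A"
    and X: "X \<in> bounded_measurable M"
  shows "signed_integral M \<mu> X = (\<integral>x. X x \<partial>N) - (\<integral>x. X x \<partial>N')"
proof -
  let ?p = "pos_part M \<mu>" and ?n = "neg_part M \<mu>"
  note fin = finite_measure_pos_part[OF mu] finite_measure_neg_part[OF mu]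
  have "add_measure ?p N' = add_measure ?n N"
  proof (rule measure_eqI)
    fix A assume "A \<in> sets (add_measure ?p N')"
    then have A: "A \<in> sets M" by simp
    have f: "finite_measure (add_measure ?p N')" "finite_measure (add_measure ?n N)"
      using fin N by (auto intro!: finite_add_measure)
    have "measure (add_measure ?p N') A = measure (add_measure ?n N) A"
      using fin N A eq[OF A] ca_jordan[OF mu A] by (simp add: finite_add_measure)
    then show "emeasure (add_measure ?p N') A = emeasure (add_measure ?n N) A"
      using f by (simp add: finite_measure.emeasure_eq_measure)
  qed simp
  then have "(\<integral>x. X x \<partial>?p) + (\<integral>x. X x \<partial>N') = (\<integral>x. X x \<partial>?n) + (\<integral>x. X x \<partial>N)"
    using integral_add_measure[OF fin(1) N(2) _ N(4) X] integral_add_measure[OF fin(2) N(1) _ N(3) X]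
    by simp
  then show ?thesis by (simp add: signed_integral_def)
qed

lemma signed_integral_add:
  assumes "\<mu> \<in> ca M" "\<nu> \<in> ca M" "X \<in> bounded_measurable M"
  shows "signed_integral M (\<lambda>A. \<mu> A + \<nu> A) X = signed_integral M \<mu> X + signed_integral M \<nu> X"
proof -
  note f = finite_measure_pos_part[OF assms(1)] finite_measure_neg_part[OF assms(1)]
    finite_measure_pos_part[OF assms(2)] finite_measure_neg_part[OF assms(2)]
  have "signed_integral M (\<lambda>A. \<mu> A + \<nu> A) X =
      (\<integral>x. X x \<partial>add_measure (pos_part M \<mu>) (pos_part M \<nu>)) -
      (\<integral>x. X x \<partial>add_measure (neg_part M \<mu>) (neg_part M \<nu>))"
    using f ca_lincomb[of \<mu> M \<nu> 1 1] assms
    by (intro signed_integral_eqI) (auto simp: finite_add_measure ca_jordan)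
  then show ?thesis
    using f assms by (simp add: integral_add_measure[where M=M] signed_integral_def)
qed

lemma signed_integral_uminus:
  "signed_integral M (\<lambda>A. - \<mu> A) X = - signed_integral M \<mu> X"
  by (simp add: signed_integral_def neg_part_def)

lemma signed_integral_cmult:
  assumes "\<mu> \<in> ca M" "X \<in> bounded_measurable M"
  shows "signed_integral M (\<lambda>A. a * \<mu> A) X = a * signed_integral M \<mu> X"
proof -
  have *: "signed_integral M (\<lambda>A. a * \<mu> A) X = a * signed_integral M \<mu> X" if "0 \<le> a" for a
  proof -
    let ?p = "scale_measure (ennreal a) (pos_part M \<mu>)" and ?n = "scale_measure (ennreal a) (neg_part M \<mu>)"
    interpret p: finite_measure "pos_part M \<mu>" by (rule finite_measure_pos_part[OF assms(1)])
    interpret n: finite_measure "neg_part M \<mu>" by (rule finite_measure_neg_part[OF assms(1)])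
    have fin: "finite_measure ?p" "finite_measure ?n"
      by (auto intro!: finite_measureI simp: ennreal_mult_eq_top_iff)
    have I: "(\<integral>x. X x \<partial>scale_measure (ennreal a) N) = a * (\<integral>x. X x \<partial>N)"
      if "sets N = sets M" "finite_measure N" for N
    proof -
      have "X \<in> borel_measurable N" "integrable N X"
        using bounded_measurableD(1)[OF assms(2)] that
          integrable_bounded_measurable[OF that(2,1) assms(2)] by (auto cong: measurable_cong_sets)
      moreover have "integrable (scale_measure (ennreal a) N) X"
        using assms(2) that
        by (intro integrable_bounded_measurable[where M=M] finite_measureI)
          (auto simp: ennreal_mult_eq_top_iff finite_measure.emeasure_finite)
      ultimately show ?thesis using \<open>0 \<le> a\<close>
        by (simp add: real_lebesgue_integral_def nn_integral_scale_measure enn2real_mult right_diff_distrib)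
    qed
    have "signed_integral M (\<lambda>A. a * \<mu> A) X = (\<integral>x. X x \<partial>?p) - (\<integral>x. X x \<partial>?n)"
      using fin ca_lincomb[OF assms(1,1), of a 0] assms \<open>0 \<le> a\<close>
      by (intro signed_integral_eqI) (auto simp: ca_jordan right_diff_distrib measure_def enn2real_mult)
    then show ?thesis by (simp add: I p.finite_measure_axioms n.finite_measure_axioms
          signed_integral_def right_diff_distrib)
  qed
  show ?thesis
  proof (cases "0 \<le> a")
    case False
    then show ?thesis
      using *[of "- a"] signed_integral_uminus[of M "\<lambda>A. (- a) * \<mu> A" X] by simp
  qed (rule *)
qed

lemma signed_integral_lincomb:
  assumes "\<mu> \<in> ca M" "\<nu> \<in> ca M" "X \<in> bounded_measurable M"
  shows "signed_integral M (\<lambda>A. a * \<mu> A + b * \<nu> A) X = a * signed_integral M \<mu> X + b * signed_integral M \<nu> X"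
  using assms ca_lincomb[of \<mu> M \<mu> a 0] ca_lincomb[of \<nu> M \<nu> b 0]
  by (simp add: signed_integral_add signed_integral_cmult)

lemma signed_integral_lincomb_right:
  assumes "\<mu> \<in> ca M" "X \<in> bounded_measurable M" "Y \<in> bounded_measurable M"
  shows "signed_integral M \<mu> (\<lambda>\<omega>. a * X \<omega> + b * Y \<omega>) = a * signed_integral M \<mu> X + b * signed_integral M \<mu> Y"
proof -
  have "integrable N X" "integrable N Y" if "N = pos_part M \<mu> \<or> N = neg_part M \<mu>" for N
    using that assms finite_measure_pos_part[OF assms(1)] finite_measure_neg_part[OF assms(1)]
    by (auto intro!: integrable_bounded_measurable[where M=M])
  then show ?thesis by (simp add: signed_integral_def algebra_simps)
qed

lemma abs_signed_integral_le:
  assumes mu: "\<mu> \<in> ca M" and X: "X \<in> bounded_measurable M" and K: "\<And>\<omega>. \<omega> \<in> space M \<Longrightarrow> \<bar>X \<omega>\<bar> \<le> K"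
  shows "\<bar>signed_integral M \<mu> X\<bar> \<le> K * tv_norm M \<mu>"
proof -
  have *: "\<bar>\<integral>x. X x \<partial>N\<bar> \<le> K * measure N (space M)" if N: "finite_measure N" "sets N = sets M" for N
  proof -
    interpret finite_measure N by fact
    have sp: "space N = space M" by (rule sets_eq_imp_space_eq) fact
    have "\<bar>\<integral>x. X x \<partial>N\<bar> \<le> (\<integral>x. \<bar>X x\<bar> \<partial>N)" by (rule integral_abs_bound)
    also have "\<dots> \<le> (\<integral>x. K \<partial>N)"
      using integrable_bounded_measurable[OF N X] K sp by (intro integral_mono) auto
    finally show ?thesis by (simp add: sp mult.commute)
  qed
  show ?thesis
    using *[OF finite_measure_pos_part[OF mu]] *[OF finite_measure_neg_part[OF mu]]
    by (simp add: signed_integral_def tv_norm_def algebra_simps)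
qed

text \<open>Each of the two Jordan parts has mass at most \<open>b\<close>. This allows closeness of
  charges to be measured setwise below, which passes to limits more easily than the norm.\<close>

lemma tv_norm_le:
  assumes "\<mu> \<in> ca M" and "\<And>B. B \<in> sets M \<Longrightarrow> \<bar>\<mu> B\<bar> \<le> b"
  shows "tv_norm M \<mu> \<le> 2 * b"
proof -
  have "measure (pos_part M \<mu>) (space M) \<le> b"
    using assms(2) by (intro measure_pos_part_least[OF assms(1)]) (auto simp: abs_le_iff)
  moreover have "measure (neg_part M \<mu>) (space M) \<le> b"
    unfolding neg_part_def
    using assms(2) by (intro measure_pos_part_least ca_uminus assms(1)) (auto simp: abs_le_iff)
  ultimately show ?thesis by (simp add: tv_norm_def)
qed

lemma measure_diff_ca:
  assumes "finite_measure N" "finite_measure N'" "sets N = sets M" "sets N' = sets M"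
  shows "(\<lambda>A. measure N A - measure N' A) \<in> ca M"
  unfolding ca_def using assms
  by (auto intro!: sums_diff finite_measure.finite_measure_UNION simp: measure_notin_sets)

text \<open>Finite additivity passes to pointwise limits. The bound \<open>e n\<close> is uniform in
  \<open>A\<close>, so the limit in \<open>n\<close> can be exchanged with the one over partial
  unions.\<close>

lemma ca_uniform_limit:
  assumes mu: "\<And>n::nat. \<mu> n \<in> ca M" and le: "\<And>n A. \<bar>\<mu> n A - \<nu> A\<bar> \<le> e n" and e: "e \<longlonglongrightarrow> 0"
  shows "\<nu> \<in> ca M"
proof -
  have lim: "(\<lambda>n. \<mu> n A) \<longlonglongrightarrow> \<nu> A" for A
  proof -
    have "(\<lambda>n. \<mu> n A - \<nu> A) \<longlonglongrightarrow> 0"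
      by (rule Lim_null_comparison[OF _ e]) (simp add: le)
    then show ?thesis by (simp add: LIM_zero_iff)
  qed
  have "\<nu> A = 0" if "A \<notin> sets M" for A
    using lim[of A] ca_outside[OF mu that] by (simp add: LIMSEQ_const_iff)
  moreover have "(\<lambda>n. \<nu> (A n)) sums \<nu> (\<Union>n. A n)"
    if A: "range A \<subseteq> sets M" "disjoint_family A" for A :: "nat \<Rightarrow> 'a set"
  proof -
    have fin: "(\<Sum>i<N. \<mu> n (A i)) = \<mu> n (\<Union>i<N. A i)" for n N
    proof (induction N)
      case 0 then show ?case using ca_empty[OF mu] by simp
    next
      case (Suc N)
      have "A i \<inter> A N = {}" if "i < N" for i
        using that by (intro disjoint_family_onD[OF A(2)]) auto
      then have "(\<Union>i<N. A i) \<inter> A N = {}" by blast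
      moreover have "(\<Union>i<N. A i) \<in> sets M" "A N \<in> sets M" using A(1) by auto
      ultimately have "\<mu> n ((\<Union>i<N. A i) \<union> A N) = \<mu> n (\<Union>i<N. A i) + \<mu> n (A N)"
        by (intro ca_union[OF mu])
      moreover have "(\<Union>i<Suc N. A i) = (\<Union>i<N. A i) \<union> A N" by (auto simp: lessThan_Suc)
      ultimately show ?case using Suc by simp
    qed
    have fin': "(\<Sum>i<N. \<nu> (A i)) = \<nu> (\<Union>i<N. A i)" for N
    proof (rule LIMSEQ_unique)
      show "(\<lambda>n. \<Sum>i<N. \<mu> n (A i)) \<longlonglongrightarrow> (\<Sum>i<N. \<nu> (A i))" by (intro tendsto_sum lim)
      show "(\<lambda>n. \<Sum>i<N. \<mu> n (A i)) \<longlonglongrightarrow> \<nu> (\<Union>i<N. A i)" unfolding fin by (rule lim)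
    qed
    show ?thesis unfolding sums_def fin'
    proof (rule LIMSEQ_I)
      fix r :: real assume "0 < r"
      then obtain n where n: "\<bar>e n\<bar> < r / 3"
        using LIMSEQ_D[OF e, of "r / 3"] by auto
      have "(\<lambda>N. \<mu> n (\<Union>i<N. A i)) \<longlonglongrightarrow> \<mu> n (\<Union>n. A n)"
        using ca_sums[OF mu A, of n] by (simp add: sums_def fin)
      from LIMSEQ_D[OF this, of "r / 3"] \<open>0 < r\<close>
      obtain N0 where "\<And>N. N \<ge> N0 \<Longrightarrow> \<bar>\<mu> n (\<Union>i<N. A i) - \<mu> n (\<Union>n. A n)\<bar> < r / 3" by auto
      note N0 = this
      have "norm (\<nu> (\<Union>i<N. A i) - \<nu> (\<Union>n. A n)) < r" if "N \<ge> N0" for N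
        using N0[OF that] n le[of n "\<Union>i<N. A i"] le[of n "\<Union>n. A n"] unfolding real_norm_def by linarith
      then show "\<exists>N0. \<forall>N\<ge>N0. norm (\<nu> (\<Union>i<N. A i) - \<nu> (\<Union>n. A n)) < r" by blast
    qed
  qed
  ultimately show ?thesis by (simp add: ca_def)
qed

lemma ca_c_uniform_limit:
  assumes mu: "\<And>n::nat. \<mu> n \<in> ca_c M Ps" and le: "\<And>n A. \<bar>\<mu> n A - \<nu> A\<bar> \<le> e n" and e: "e \<longlonglongrightarrow> 0"
  shows "\<nu> \<in> ca_c M Ps"
proof -
  have "\<nu> A = 0" if "A \<in> sets M" "upper_prob Ps A = 0" for A
  proof -
    have "\<mu> n A = 0" for n using mu that by (simp add: ca_c_def)
    then have "\<bar>\<nu> A\<bar> \<le> e n" for n using le[of n A] by simp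
    then have "\<bar>\<nu> A\<bar> \<le> 0" by (intro LIMSEQ_le_const[OF e]) auto
    then show ?thesis by simp
  qed
  then show ?thesis
    using ca_uniform_limit[of \<mu> M \<nu> e, OF ca_c_ca[OF mu] le e] by (auto simp: ca_c_def)
qed

section \<open>A minimax principle\<close>

text \<open>Convexity of \<open>K\<close> as seen through the functions in \<open>\<F>\<close>. The
  points live in a mere topological space, so instead of a convex combination of points one asks for
  a point with the corresponding values.\<close>

definition convexlike :: "'x set \<Rightarrow> ('x \<Rightarrow> real) set \<Rightarrow> bool" where
  "convexlike K \<F> \<longleftrightarrow> (\<forall>x\<in>K. \<forall>y\<in>K. \<forall>t\<in>{0..1}. \<exists>z\<in>K. \<forall>f\<in>\<F>. f z = (1 - t) * f x + t * f y)"

text \<open>The image of \<open>K\<close> under \<open>(f, g)\<close> is a compact convex subset of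
  the plane that misses the closed nonnegative quadrant. A separating line has a normal with
  nonnegative components, because the quadrant is unbounded in both directions; normalising it gives
  the weights.\<close>

lemma minimax_two:
  fixes f g :: "'x::topological_space \<Rightarrow> real"
  assumes K: "compact K" "K \<noteq> {}" and f: "continuous_on K f" and g: "continuous_on K g"
    and conv: "convexlike K {f, g}" and neg: "\<And>x. x \<in> K \<Longrightarrow> f x < 0 \<or> g x < 0"
  shows "\<exists>t\<in>{0..1}. \<forall>x\<in>K. (1 - t) * f x + t * g x < 0"
proof -
  define S where "S = (\<lambda>x. (f x, g x)) ` K"
  define T where "T = {0::real..} \<times> {0::real..}"
  have "compact S" unfolding S_def using K f g by (intro compact_continuous_image continuous_intros)
  moreover have "S \<noteq> {}" using K by (simp add: S_def)
  moreover have "convex S"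
    unfolding convex_alt
  proof (intro ballI allI impI)
    fix p q and t :: real assume "p \<in> S" "q \<in> S" "0 \<le> t \<and> t \<le> 1"
    then obtain x y where xy: "x \<in> K" "y \<in> K" "p = (f x, g x)" "q = (f y, g y)" and t: "t \<in> {0..1}"
      by (auto simp: S_def)
    obtain z where "z \<in> K" "f z = (1 - t) * f x + t * f y" "g z = (1 - t) * g x + t * g y"
      using conv xy(1,2) t unfolding convexlike_def by (metis insertI1 insertI2)
    then show "(1 - t) *\<^sub>R p + t *\<^sub>R q \<in> S" by (auto simp: S_def xy image_iff intro!: bexI[of _ z])
  qed
  moreover have "convex T" "closed T" unfolding T_def by (auto intro!: convex_Times closed_Times)
  moreover have "S \<inter> T = {}" using neg by (fastforce simp: S_def T_def)
  ultimately obtain a b where a: "\<And>p. p \<in> S \<Longrightarrow> inner a p < b" and b: "\<And>p. p \<in> T \<Longrightarrow> inner a p > b"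
    using separating_hyperplane_compact_closed[of S T] by blast
  obtain a1 a2 where a12: "a = (a1, a2)" by fastforce
  have b0: "b < 0" using b[of "(0, 0)"] by (simp add: T_def a12)
  have a1: "0 \<le> a1"
  proof (rule ccontr)
    assume "\<not> 0 \<le> a1"
    \<comment> \<open>This point of the quadrant has inner product exactly \<open>b\<close> with
      \<open>a\<close>, against the strict inequality.\<close>
    then have "(b / a1, 0) \<in> T" using b0 by (simp add: T_def divide_nonpos_neg)
    with b[of "(b / a1, 0)"] \<open>\<not> 0 \<le> a1\<close> show False by (simp add: a12)
  qed
  have a2: "0 \<le> a2"
  proof (rule ccontr)
    assume "\<not> 0 \<le> a2"
    then have "(0, b / a2) \<in> T" using b0 by (simp add: T_def divide_nonpos_neg)
    with b[of "(0, b / a2)"] \<open>\<not> 0 \<le> a2\<close> show False by (simp add: a12)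
  qed
  have neg': "a1 * f x + a2 * g x < 0" if "x \<in> K" for x
    using a[of "(f x, g x)"] b0 that by (simp add: S_def a12)
  obtain x0 where "x0 \<in> K" using K by auto
  then have s: "0 < a1 + a2" using neg'[of x0] a1 a2 by (cases "a1 = 0"; cases "a2 = 0") auto
  show ?thesis
  proof (intro bexI ballI)
    show "a2 / (a1 + a2) \<in> {0..1}" using s a1 a2 by simp
    fix x assume "x \<in> K"
    have "1 - a2 / (a1 + a2) = a1 / (a1 + a2)" using s by (simp add: field_simps)
    then have "(1 - a2 / (a1 + a2)) * f x + a2 / (a1 + a2) * g x = (a1 * f x + a2 * g x) / (a1 + a2)"
      by (simp add: add_divide_distrib)
    then show "(1 - a2 / (a1 + a2)) * f x + a2 / (a1 + a2) * g x < 0"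
      using neg'[OF \<open>x \<in> K\<close>] s by (simp add: divide_neg_pos)
  qed
qed

text \<open>Induction on \<open>C\<close> with \<open>K\<close> varying: where \<open>f\<close> is
  nonnegative the remaining functions suffice and yield some \<open>g\<close>; then \<open>f\<close>
  or \<open>g\<close> is negative at every point of \<open>K\<close>, and the case of two functions
  applies.\<close>

lemma minimax_finite:
  fixes \<F> :: "('x::topological_space \<Rightarrow> real) set"
  assumes cont: "\<And>f. f \<in> \<F> \<Longrightarrow> continuous_on UNIV f" and ne: "\<F> \<noteq> {}"
    and C: "finite C" "C \<subseteq> \<F>" and K: "compact K" and conv: "convexlike K \<F>"
    and comb: "\<And>f g t. f \<in> \<F> \<Longrightarrow> g \<in> \<F> \<Longrightarrow> t \<in> {0..1} \<Longrightarrow> \<exists>h\<in>\<F>. \<forall>x\<in>K. h x = (1 - t) * f x + t * g x"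
    and neg: "\<And>x. x \<in> K \<Longrightarrow> \<exists>f\<in>C. f x < 0"
  shows "\<exists>f\<in>\<F>. \<forall>x\<in>K. f x < 0"
  using C K conv comb neg
proof (induction C arbitrary: K)
  case empty
  then have "K = {}" by blast
  then show ?case using ne by blast
next
  case (insert f C)
  have fF: "f \<in> \<F>" using insert.prems(1) by simp
  define K' where "K' = {x \<in> K. 0 \<le> f x}"
  have "K' = K \<inter> f -` {0..}" by (auto simp: K'_def)
  moreover have "closed (f -` {0..})"
    using cont[OF fF] by (intro closed_vimage) auto
  ultimately have "compact K'" using insert.prems(2) by (auto intro: compact_Int_closed)
  moreover have "convexlike K' \<F>"
    unfolding convexlike_def
  proof (intro ballI)
    fix x y t :: "_" assume xy: "x \<in> K'" "y \<in> K'" and t: "t \<in> {0..1::real}"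
    then obtain z where z: "z \<in> K" "\<forall>f\<in>\<F>. f z = (1 - t) * f x + t * f y"
      using insert.prems(3) unfolding convexlike_def K'_def by blast
    then have "0 \<le> f z" using fF xy t by (auto simp: K'_def intro!: add_nonneg_nonneg mult_nonneg_nonneg)
    then show "\<exists>z\<in>K'. \<forall>f\<in>\<F>. f z = (1 - t) * f x + t * f y" using z by (auto simp: K'_def)
  qed
  moreover have "\<exists>h\<in>C. h x < 0" if "x \<in> K'" for x
    using insert.prems(5)[of x] that by (auto simp: K'_def)
  moreover have comb': "\<exists>h\<in>\<F>. \<forall>x\<in>K'. h x = (1 - t) * f x + t * g x"
    if "f \<in> \<F>" "g \<in> \<F>" "t \<in> {0..1}" for f g t
    using insert.prems(4)[OF that] by (auto simp: K'_def)
  ultimately obtain g where g: "g \<in> \<F>" "\<And>x. x \<in> K' \<Longrightarrow> g x < 0"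
    using insert.IH[of K'] insert.prems(1) comb' by auto
  show ?case
  proof (cases "K = {}")
    case True then show ?thesis using ne by auto
  next
    case False
    have "\<exists>t\<in>{0..1}. \<forall>x\<in>K. (1 - t) * f x + t * g x < 0"
    proof (rule minimax_two)
      show "continuous_on K f" "continuous_on K g"
        using cont[OF fF] cont[OF g(1)] by (auto intro: continuous_on_subset)
      show "convexlike K {f, g}"
        using insert.prems(3) fF g(1) unfolding convexlike_def by (metis insert_iff singletonD)
      show "f x < 0 \<or> g x < 0" if "x \<in> K" for x
        using g(2)[of x] that by (cases "0 \<le> f x") (auto simp: K'_def)
    qed (use False insert.prems in auto)
    then obtain t where t: "t \<in> {0..1}" "\<forall>x\<in>K. (1 - t) * f x + t * g x < 0" by blast
    obtain h where "h \<in> \<F>" "\<forall>x\<in>K. h x = (1 - t) * f x + t * g x"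
      using insert.prems(4)[OF fF g(1) t(1)] by blast
    then show ?thesis using t(2) by (intro bexI[of _ h]) auto
  qed
qed

text \<open>The open sets on which some \<open>f \<in> \<F>\<close> is negative cover
  \<open>K\<close>; a finite subcover selects \<open>C\<close>.\<close>

lemma minimax:
  fixes \<F> :: "('x::topological_space \<Rightarrow> real) set"
  assumes cont: "\<And>f. f \<in> \<F> \<Longrightarrow> continuous_on UNIV f" and ne: "\<F> \<noteq> {}"
    and comb: "\<And>f g t. f \<in> \<F> \<Longrightarrow> g \<in> \<F> \<Longrightarrow> t \<in> {0..1} \<Longrightarrow> \<exists>h\<in>\<F>. \<forall>x\<in>K. h x = (1 - t) * f x + t * g x"
    and K: "compact K" and conv: "convexlike K \<F>"
    and neg: "\<And>x. x \<in> K \<Longrightarrow> \<exists>f\<in>\<F>. f x < 0"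
  shows "\<exists>f\<in>\<F>. \<forall>x\<in>K. f x < 0"
proof -
  have "open (f -` {..<0})" if "f \<in> \<F>" for f
    using cont[OF that] by (intro open_vimage) auto
  moreover have "K \<subseteq> (\<Union>f\<in>\<F>. f -` {..<0})" using neg by auto
  ultimately obtain C where "C \<subseteq> \<F>" "finite C" "K \<subseteq> (\<Union>f\<in>C. f -` {..<0})"
    using compactE_image[OF K, of \<F> "\<lambda>f. f -` {..<0}"] by metis
  then show ?thesis by (intro minimax_finite[OF cont ne _ _ K conv comb, of C]) auto
qed

section \<open>Quasi-sure statements and densities\<close>

lemma prob_measuresD:
  assumes "P \<in> prob_measures M"
  shows "prob_space P" "sets P = sets M" "space P = space M" "finite_measure P"
  using assms sets_eq_imp_space_eq[of P M]
  by (auto simp: prob_measures_def prob_space_def)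

lemma upper_prob_eq_0_iff: "upper_prob Ps A = 0 \<longleftrightarrow> (\<forall>P\<in>Ps. emeasure P A = 0)"
  by (simp add: upper_prob_def SUP_bot_conv flip: bot_ennreal)

lemma qs_iff_upper_prob:
  assumes "Ps \<subseteq> prob_measures M" "{\<omega> \<in> space M. \<not> \<phi> \<omega>} \<in> sets M"
  shows "qs Ps \<phi> \<longleftrightarrow> upper_prob Ps {\<omega> \<in> space M. \<not> \<phi> \<omega>} = 0"
proof -
  have "(AE \<omega> in P. \<phi> \<omega>) \<longleftrightarrow> emeasure P {\<omega> \<in> space M. \<not> \<phi> \<omega>} = 0" if "P \<in> Ps" for P
  proof -
    have P: "sets P = sets M" "space P = space M" using that assms(1) prob_measuresD by blast+
    then show ?thesis using assms(2) by (subst AE_iff_measurable[OF _ refl]) simp_all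
  qed
  then show ?thesis by (auto simp: qs_def upper_prob_eq_0_iff)
qed

lemma qs_dominated:
  assumes "Ps \<subseteq> prob_measures M" "Qs \<subseteq> prob_measures M" "dominated M Qs Ps"
    and "{\<omega> \<in> space M. \<not> \<phi> \<omega>} \<in> sets M" "qs Ps \<phi>"
  shows "qs Qs \<phi>"
  using assms unfolding dominated_def by (simp add: qs_iff_upper_prob[where M=M])

lemma qs_mp: "qs Ps \<phi> \<Longrightarrow> (\<And>\<omega>. \<phi> \<omega> \<Longrightarrow> \<psi> \<omega>) \<Longrightarrow> qs Ps \<psi>"
  unfolding qs_def by (auto elim: AE_mp)

lemma qs_mp2: "qs Ps \<phi> \<Longrightarrow> qs Ps \<phi>' \<Longrightarrow> (\<And>\<omega>. \<phi> \<omega> \<Longrightarrow> \<phi>' \<omega> \<Longrightarrow> \<psi> \<omega>) \<Longrightarrow> qs Ps \<psi>"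
  unfolding qs_def by (intro ballI) (rule eventually_elim2[of \<phi> _ \<phi>'], auto)

lemma qs_all_countable: "qs Ps (\<lambda>\<omega>. \<forall>n::'n::countable. \<phi> n \<omega>) \<longleftrightarrow> (\<forall>n. qs Ps (\<phi> n))"
  by (auto simp: qs_def AE_all_countable)

text \<open>Every measurable subset of a null set of \<open>upper_prob Ps\<close> is again null, so
  \<open>\<mu>\<close> vanishes on all competitors in the supremum defining the positive
  part.\<close>

lemma AE_pos_part:
  assumes "Ps \<subseteq> prob_measures M" "\<mu> \<in> ca_c M Ps" "{\<omega> \<in> space M. \<not> \<phi> \<omega>} \<in> sets M" "qs Ps \<phi>"
  shows "AE \<omega> in pos_part M \<mu>. \<phi> \<omega>"
proof -
  let ?A = "{\<omega> \<in> space M. \<not> \<phi> \<omega>}"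
  have A: "upper_prob Ps ?A = 0" using assms by (simp add: qs_iff_upper_prob)
  have "ennreal (\<mu> B) \<le> 0" if B: "B \<in> sets M" "B \<subseteq> ?A" for B
  proof -
    have "emeasure P B = 0" if "P \<in> Ps" for P
    proof -
      have "?A \<in> sets P" using that assms(1,3) prob_measuresD(2) by blast
      then have "emeasure P B \<le> emeasure P ?A" by (intro emeasure_mono B)
      then show ?thesis using A that by (simp add: upper_prob_eq_0_iff)
    qed
    then have "upper_prob Ps B = 0" by (simp add: upper_prob_eq_0_iff)
    then have "\<mu> B = 0" using assms(2) B by (simp add: ca_c_def)
    then show ?thesis by simp
  qed
  then have "emeasure (pos_part M \<mu>) ?A \<le> 0"
    unfolding emeasure_pos_part[OF ca_c_ca[OF assms(2)] assms(3)] by (rule sup_part_least)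
  then show ?thesis using assms(3) by (subst AE_iff_measurable[OF _ refl]) auto
qed

lemma ca_c_uminus: "\<mu> \<in> ca_c M Ps \<Longrightarrow> (\<lambda>A. - \<mu> A) \<in> ca_c M Ps"
  using ca_c_lincomb[of \<mu> M Ps \<mu> "-1" 0] by simp

lemma signed_integral_qs_cong:
  assumes "Ps \<subseteq> prob_measures M" "\<mu> \<in> ca_c M Ps"
    and X: "X \<in> bounded_measurable M" and Y: "Y \<in> bounded_measurable M"
    and eq: "qs Ps (\<lambda>\<omega>. X \<omega> = Y \<omega>)"
  shows "signed_integral M \<mu> X = signed_integral M \<mu> Y"
proof -
  note [measurable] = bounded_measurableD(1)[OF X] bounded_measurableD(1)[OF Y]
  have A: "{\<omega> \<in> space M. \<not> X \<omega> = Y \<omega>} \<in> sets M" by measurable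
  have "(\<integral>\<omega>. X \<omega> \<partial>pos_part M \<mu>) = (\<integral>\<omega>. Y \<omega> \<partial>pos_part M \<mu>)"
    using AE_pos_part[OF assms(1,2) A eq] by (intro integral_cong_AE) auto
  moreover have "(\<integral>\<omega>. X \<omega> \<partial>neg_part M \<mu>) = (\<integral>\<omega>. Y \<omega> \<partial>neg_part M \<mu>)"
    unfolding neg_part_def
    using AE_pos_part[OF assms(1) ca_c_uminus[OF assms(2)] A eq] by (intro integral_cong_AE) auto
  ultimately show ?thesis by (simp add: signed_integral_def)
qed

text \<open>The charge with signed density \<open>Z\<close> under \<open>Q\<close>, split into two
  measures because \<open>density\<close> takes values in \<open>ennreal\<close>. Such charges serve
  as the test elements of \<open>ca_c\<close>.\<close>

definition density_charge :: "'a measure \<Rightarrow> ('a \<Rightarrow> real) \<Rightarrow> 'a set \<Rightarrow> real" where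
  "density_charge Q Z A = measure (density Q (\<lambda>\<omega>. ennreal (max 0 (Z \<omega>)))) A
     - measure (density Q (\<lambda>\<omega>. ennreal (max 0 (- Z \<omega>)))) A"

lemma density_charge:
  assumes Q: "Q \<in> prob_measures M" "dominated M {Q} Ps" and Z: "Z \<in> bounded_measurable M"
  shows density_charge_ca_c: "density_charge Q Z \<in> ca_c M Ps"
    and signed_integral_density_charge: "X \<in> bounded_measurable M \<Longrightarrow>
      signed_integral M (density_charge Q Z) X = (\<integral>\<omega>. Z \<omega> * X \<omega> \<partial>Q)"
proof -
  note Qs = prob_measuresD[OF Q(1)]
  let ?d = "\<lambda>Z. density Q (\<lambda>\<omega>. ennreal (max 0 (Z \<omega>)))"
  have meas: "Y \<in> borel_measurable Q" if "Y \<in> bounded_measurable M" for Y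
    using bounded_measurableD(1)[OF that] Qs(2) by (simp cong: measurable_cong_sets)
  have Zm: "(\<lambda>\<omega>. - Z \<omega>) \<in> bounded_measurable M" using bounded_measurable_lincomb[OF Z Z, of "-1" 0] by simp
  have bm0: "(\<lambda>\<omega>. max 0 (Y \<omega>)) \<in> bounded_measurable M" if Y: "Y \<in> bounded_measurable M" for Y
  proof -
    obtain K where "\<forall>\<omega>\<in>space M. \<bar>Y \<omega>\<bar> \<le> K" using bounded_measurableD(2)[OF Y] by blast
    then show ?thesis using bounded_measurableD(1)[OF Y]
      by (intro bounded_measurableI[where K=K]) (auto simp: max_def)
  qed
  have fin: "finite_measure (?d Y)" if "Y \<in> bounded_measurable M" for Y
  proof (rule finite_measureI)
    have "integrable Q (\<lambda>\<omega>. max 0 (Y \<omega>))"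
      by (rule integrable_bounded_measurable[OF Qs(4,2) bm0[OF that]])
    then have "(\<integral>\<^sup>+\<omega>. ennreal (max 0 (Y \<omega>)) \<partial>Q) \<noteq> \<infinity>"
      unfolding real_integrable_def by blast
    also have "(\<integral>\<^sup>+\<omega>. ennreal (max 0 (Y \<omega>)) \<partial>Q) =
        (\<integral>\<^sup>+\<omega>. ennreal (max 0 (Y \<omega>)) * indicator (space Q) \<omega> \<partial>Q)"
      by (intro nn_integral_cong) simp
    also have "\<dots> = emeasure (?d Y) (space Q)"
      using meas[OF that] by (intro emeasure_density[symmetric]) auto
    finally show "emeasure (?d Y) (space (?d Y)) \<noteq> \<infinity>" by simp
  qed
  have ss: "sets (?d Y) = sets M" for Y using Qs(2) by simp
  have null: "measure (?d Y) A = 0" if "Y \<in> bounded_measurable M" "A \<in> sets M" "upper_prob Ps A = 0" for Y A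
  proof -
    have "upper_prob {Q} A = 0" using Q(2) that(2,3) by (auto simp: dominated_def)
    then have "A \<in> null_sets Q" using that(2) Qs(2) by (auto simp: upper_prob_eq_0_iff)
    then have "AE \<omega> in Q. \<omega> \<notin> A" by (rule AE_not_in)
    then have "A \<in> null_sets (?d Y)"
      using meas[OF that(1)] that(2) Qs(2) by (subst null_sets_density_iff) auto
    then show ?thesis by (simp add: measure_def null_sets_def)
  qed
  have ca: "density_charge Q Z \<in> ca M"
    unfolding density_charge_def[abs_def] by (rule measure_diff_ca[OF fin[OF Z] fin[OF Zm] ss ss])
  then show "density_charge Q Z \<in> ca_c M Ps"
    using null[OF Z] null[OF Zm] by (simp add: ca_c_def density_charge_def)
  assume X: "X \<in> bounded_measurable M"
  have I: "(\<integral>\<omega>. X \<omega> \<partial>?d Y) = (\<integral>\<omega>. max 0 (Y \<omega>) * X \<omega> \<partial>Q)" if "Y \<in> bounded_measurable M" for Y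
    using meas[OF X] meas[OF that] by (subst integral_density) auto
  have "signed_integral M (density_charge Q Z) X = (\<integral>\<omega>. X \<omega> \<partial>?d Z) - (\<integral>\<omega>. X \<omega> \<partial>?d (\<lambda>\<omega>. - Z \<omega>))"
    by (rule signed_integral_eqI[OF ca fin[OF Z] fin[OF Zm] ss ss _ X]) (simp add: density_charge_def)
  also have "\<dots> = (\<integral>\<omega>. max 0 (Z \<omega>) * X \<omega> \<partial>Q) - (\<integral>\<omega>. max 0 (- Z \<omega>) * X \<omega> \<partial>Q)"
    using I[OF Z] I[OF Zm] by (simp only:)
  also have "\<dots> = (\<integral>\<omega>. max 0 (Z \<omega>) * X \<omega> - max 0 (- Z \<omega>) * X \<omega> \<partial>Q)"
    using integrable_bounded_measurable[OF Qs(4,2) bounded_measurable_mult[OF bm0[OF Z] X]]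
      integrable_bounded_measurable[OF Qs(4,2) bounded_measurable_mult[OF bm0[OF Zm] X]] by simp
  also have "\<dots> = (\<integral>\<omega>. Z \<omega> * X \<omega> \<partial>Q)"
    by (intro Bochner_Integration.integral_cong) (auto simp: max_def)
  finally show "signed_integral M (density_charge Q Z) X = (\<integral>\<omega>. Z \<omega> * X \<omega> \<partial>Q)" .
qed

section \<open>Nearest points in bounded convex sets of random variables\<close>

text \<open>The sum of the absolute increments has finite expectation, hence is finite almost
  everywhere, and there the telescoping series converges.\<close>

lemma AE_convergent_of_summable_L1:
  fixes Y :: "nat \<Rightarrow> 'a \<Rightarrow> real"
  assumes int: "\<And>n. integrable Q (Y n)"
    and b: "\<And>n. (\<integral>\<omega>. \<bar>Y (Suc n) \<omega> - Y n \<omega>\<bar> \<partial>Q) \<le> b n" and "summable b"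
  shows "AE \<omega> in Q. convergent (\<lambda>n. Y n \<omega>)"
proof -
  note [measurable] = borel_measurable_integrable[OF int]
  have b0: "0 \<le> b n" for n by (rule order_trans[OF _ b]) simp
  have "(\<integral>\<^sup>+\<omega>. (\<Sum>n. ennreal \<bar>Y (Suc n) \<omega> - Y n \<omega>\<bar>) \<partial>Q) =
      (\<Sum>n. \<integral>\<^sup>+\<omega>. ennreal \<bar>Y (Suc n) \<omega> - Y n \<omega>\<bar> \<partial>Q)"
    by (rule nn_integral_suminf) measurable
  also have "\<dots> \<le> (\<Sum>n. ennreal (b n))"
  proof (rule suminf_le)
    fix n
    have "(\<integral>\<^sup>+\<omega>. ennreal \<bar>Y (Suc n) \<omega> - Y n \<omega>\<bar> \<partial>Q) = ennreal (\<integral>\<omega>. \<bar>Y (Suc n) \<omega> - Y n \<omega>\<bar> \<partial>Q)"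
      using int by (intro nn_integral_eq_integral) auto
    also have "\<dots> \<le> ennreal (b n)" using b by (rule ennreal_leI)
    finally show "(\<integral>\<^sup>+\<omega>. ennreal \<bar>Y (Suc n) \<omega> - Y n \<omega>\<bar> \<partial>Q) \<le> ennreal (b n)" .
  qed auto
  also have "\<dots> = ennreal (\<Sum>n. b n)" using b0 \<open>summable b\<close> by (rule suminf_ennreal2)
  also have "\<dots> < \<infinity>" by simp
  finally have "(\<integral>\<^sup>+\<omega>. (\<Sum>n. ennreal \<bar>Y (Suc n) \<omega> - Y n \<omega>\<bar>) \<partial>Q) \<noteq> \<infinity>" by simp
  then have "AE \<omega> in Q. (\<Sum>n. ennreal \<bar>Y (Suc n) \<omega> - Y n \<omega>\<bar>) \<noteq> \<infinity>"
    by (intro nn_integral_noteq_infinite) auto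
  then show ?thesis
  proof (eventually_elim)
    fix \<omega> assume "(\<Sum>n. ennreal \<bar>Y (Suc n) \<omega> - Y n \<omega>\<bar>) \<noteq> \<infinity>"
    then have "summable (\<lambda>n. \<bar>Y (Suc n) \<omega> - Y n \<omega>\<bar>)"
      by (intro summable_suminf_not_top) auto
    then have "summable (\<lambda>n. Y (Suc n) \<omega> - Y n \<omega>)" by (rule summable_rabs_cancel)
    then have "convergent (\<lambda>n. \<Sum>i<n. Y (Suc i) \<omega> - Y i \<omega>)" by (simp add: summable_iff_convergent)
    then have "convergent (\<lambda>n. Y n \<omega> - Y 0 \<omega>)" 
      by (simp only: sum_lessThan_telescope[of "\<lambda>n. Y n \<omega>"])
    then have "convergent (\<lambda>n. (Y n \<omega> - Y 0 \<omega>) + Y 0 \<omega>)" by (intro convergent_add convergent_const)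
    then show "convergent (\<lambda>n. Y n \<omega>)" by simp
  qed
qed

text \<open>\<open>D\<close> need not be closed, so the nearest point \<open>Z\<close> is only a
  limit of members of \<open>D\<close>. A minimising sequence is Cauchy by the parallelogram law,
  and a fast rate makes it converge almost everywhere. The final inequality is the first-order
  condition for the minimum.\<close>

lemma L2_nearest_point:
  fixes D :: "('a \<Rightarrow> real) set"
  assumes Q: "prob_space Q" and X: "X \<in> bounded_measurable Q"
    and D: "D \<noteq> {}" "D \<subseteq> borel_measurable Q" "\<And>Y \<omega>. Y \<in> D \<Longrightarrow> \<omega> \<in> space Q \<Longrightarrow> \<bar>Y \<omega>\<bar> \<le> K"
    and conv: "\<And>Y W t. Y \<in> D \<Longrightarrow> W \<in> D \<Longrightarrow> t \<in> {0..1} \<Longrightarrow> (\<lambda>\<omega>. (1 - t) * Y \<omega> + t * W \<omega>) \<in> D"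
  shows "\<exists>Y Z. (\<forall>n::nat. Y n \<in> D) \<and> Z \<in> borel_measurable Q \<and> (\<forall>\<omega>\<in>space Q. \<bar>Z \<omega>\<bar> \<le> K) \<and>
    (AE \<omega> in Q. (\<lambda>n. Y n \<omega>) \<longlonglongrightarrow> Z \<omega>) \<and> (\<forall>W\<in>D. (\<integral>\<omega>. (X \<omega> - Z \<omega>) * (W \<omega> - Z \<omega>) \<partial>Q) \<le> 0)"
proof -
  interpret prob_space Q by fact
  define d where "d Y = (\<integral>\<omega>. (X \<omega> - Y \<omega>)^2 \<partial>Q)" for Y
  define \<delta> where "\<delta> = (INF Y\<in>D. d Y)"
  have K0: "0 \<le> K"
  proof -
    obtain Y \<omega> where "Y \<in> D" "\<omega> \<in> space Q" using D(1) not_empty by auto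
    then show ?thesis using D(3) by force
  qed
  have Dbm: "Y \<in> bounded_measurable Q" if "Y \<in> D" for Y
    using that D by (intro bounded_measurableI[where K=K]) auto
  have int: "integrable Q Y" if "Y \<in> bounded_measurable Q" for Y
    by (rule integrable_bounded_measurable[OF finite_measure_axioms refl that])
  have diff: "(\<lambda>\<omega>. Y \<omega> - W \<omega>) \<in> bounded_measurable Q"
    if "Y \<in> bounded_measurable Q" "W \<in> bounded_measurable Q" for Y W
    using bounded_measurable_lincomb[OF that, of 1 "-1"] by simp
  have sq: "(\<lambda>\<omega>. (Y \<omega> - W \<omega>)^2) \<in> bounded_measurable Q"
    if "Y \<in> bounded_measurable Q" "W \<in> bounded_measurable Q" for Y W
    using bounded_measurable_mult[OF diff[OF that] diff[OF that]] by (simp add: power2_eq_square)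
  have \<delta>: "\<delta> \<le> d Y" if "Y \<in> D" for Y
    unfolding \<delta>_def using that by (intro cINF_lower bdd_belowI2[where m=0]) (auto simp: d_def)
  have "\<exists>Y\<in>D. d Y < \<delta> + (1/8)^n" for n
  proof (rule ccontr)
    assume "\<not> ?thesis"
    then have "\<delta> + (1/8)^n \<le> (INF Y\<in>D. d Y)" using D(1) by (intro cINF_greatest) (auto simp: not_less)
    then have "\<delta> + (1/8)^n \<le> \<delta>" by (simp only: \<delta>_def)
    then show False using zero_less_power[of "1/8 :: real" n] by linarith
  qed
  then obtain Y where YD: "\<And>n. Y n \<in> D" and Yd: "\<And>n. d (Y n) < \<delta> + (1/8)^n" by metis
  note Ybm = Dbm[OF YD]
  have step: "(\<integral>\<omega>. \<bar>Y (Suc n) \<omega> - Y n \<omega>\<bar> \<partial>Q) \<le> 5 * (1/2)^n" for n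
  proof -
    let ?m = "\<lambda>\<omega>. (1 - 1/2) * Y (Suc n) \<omega> + (1/2) * Y n \<omega>"
    have m: "?m \<in> D" by (rule conv[OF YD YD]) auto
    \<comment> \<open>Parallelogram law; the midpoint \<open>?m\<close> lies in \<open>D\<close>, so
      \<open>d ?m\<close> is at least \<open>\<delta>\<close>.\<close>
    have "(\<integral>\<omega>. (Y (Suc n) \<omega> - Y n \<omega>)^2 \<partial>Q) =
        (\<integral>\<omega>. (2 * (X \<omega> - Y (Suc n) \<omega>)^2 + 2 * (X \<omega> - Y n \<omega>)^2) - 4 * (X \<omega> - ?m \<omega>)^2 \<partial>Q)"
      by (intro Bochner_Integration.integral_cong refl) (simp add: power2_eq_square field_simps)
    also have "\<dots> = 2 * d (Y (Suc n)) + 2 * d (Y n) - 4 * d ?m"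
      using int[OF sq[OF X Ybm]] int[OF sq[OF X Dbm[OF m]]] by (simp add: d_def)
    also have "\<dots> \<le> 2 * (1/8)^(Suc n) + 2 * (1/8)^n"
      using Yd[of "Suc n"] Yd[of n] \<delta>[OF m] by linarith
    also have "\<dots> \<le> 4 * (1/8)^n" by simp
    finally have q: "(\<integral>\<omega>. (Y (Suc n) \<omega> - Y n \<omega>)^2 \<partial>Q) \<le> 4 * (1/8)^n" .
    \<comment> \<open>Small \<open>u\<close> are covered by the first term, large \<open>u\<close>
      by the second; the weight \<open>2^n\<close> is reciprocal to the threshold.\<close>
    have young: "\<bar>u\<bar> \<le> (1/2)^n + 2^n * u^2" for u :: real
    proof (cases "\<bar>u\<bar> \<le> (1/2)^n")
      case True then show ?thesis by (simp add: add_increasing2)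
    next
      case False
      then have "1 \<le> 2^n * \<bar>u\<bar>" by (simp add: field_simps)
      then have "\<bar>u\<bar> * 1 \<le> \<bar>u\<bar> * (2^n * \<bar>u\<bar>)" by (intro mult_left_mono) auto
      then have "\<bar>u\<bar> \<le> 2^n * u^2" by (simp add: power2_eq_square mult_ac flip: abs_mult)
      then show ?thesis by (rule order_trans) simp
    qed
    have "(\<integral>\<omega>. \<bar>Y (Suc n) \<omega> - Y n \<omega>\<bar> \<partial>Q) \<le> (\<integral>\<omega>. (1/2)^n + 2^n * (Y (Suc n) \<omega> - Y n \<omega>)^2 \<partial>Q)"
      using int[OF diff[OF Ybm Ybm]] int[OF sq[OF Ybm Ybm]] young by (intro integral_mono) auto
    also have "\<dots> = (1/2)^n + 2^n * (\<integral>\<omega>. (Y (Suc n) \<omega> - Y n \<omega>)^2 \<partial>Q)"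
      using int[OF sq[OF Ybm Ybm]] by (simp add: prob_space)
    also have "\<dots> \<le> (1/2)^n + 2^n * (4 * (1/8)^n)"
      using q by (intro add_left_mono mult_left_mono) auto
    also have "2^n * (4 * (1/8)^n) = 4 * ((2 * (1/8))^n :: real)" by (simp only: power_mult_distrib)
    also have "\<dots> \<le> 4 * (1/2)^n" by (intro mult_left_mono power_mono) auto
    finally show ?thesis by simp
  qed
  have conv_AE: "AE \<omega> in Q. convergent (\<lambda>n. Y n \<omega>)"
    by (rule AE_convergent_of_summable_L1[where Y=Y, OF int[OF Ybm] step]) (auto intro!: summable_mult summable_geometric)
  \<comment> \<open>\<open>lim\<close> is arbitrary where the sequence diverges; truncation makes
    the bound by \<open>K\<close> hold everywhere.\<close>
  define Z where "Z \<omega> = max (- K) (min K (lim (\<lambda>n. Y n \<omega>)))" for \<omega>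
  note Ym [measurable] = bounded_measurableD(1)[OF Ybm]
  have Zm [measurable]: "Z \<in> borel_measurable Q"
    unfolding Z_def[abs_def] by (intro borel_measurable_max borel_measurable_min borel_measurable_const
        borel_measurable_lim_metric Ym)
  have ZK: "\<bar>Z \<omega>\<bar> \<le> K" for \<omega> using K0 by (auto simp: Z_def)
  have Zbm: "Z \<in> bounded_measurable Q" using Zm ZK by (rule bounded_measurableI)
  have lim: "AE \<omega> in Q. (\<lambda>n. Y n \<omega>) \<longlonglongrightarrow> Z \<omega>"
    using conv_AE AE_space
  proof eventually_elim
    case (elim \<omega>)
    then have L: "(\<lambda>n. Y n \<omega>) \<longlonglongrightarrow> lim (\<lambda>n. Y n \<omega>)" by (simp add: convergent_LIMSEQ_iff)
    have "\<bar>Y n \<omega>\<bar> \<le> K" for n by (rule D(3)[OF YD elim(2)])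
    then have b: "Y n \<omega> \<le> K" "- K \<le> Y n \<omega>" for n by (auto simp: abs_le_iff minus_le_iff)
    then have "lim (\<lambda>n. Y n \<omega>) \<le> K" "- K \<le> lim (\<lambda>n. Y n \<omega>)"
      using LIMSEQ_le_const2[OF L] LIMSEQ_le_const[OF L] by blast+
    then show ?case using L by (simp add: Z_def)
  qed
  have "(\<integral>\<omega>. (X \<omega> - Z \<omega>) * (W \<omega> - Z \<omega>) \<partial>Q) \<le> 0" if W: "W \<in> D" for W
  proof -
    note Wbm = Dbm[OF W]
    note [measurable] = bounded_measurableD(1)[OF Wbm] bounded_measurableD(1)[OF X]
    obtain L where L: "0 \<le> L" "\<And>\<omega>. \<omega> \<in> space Q \<Longrightarrow> \<bar>X \<omega>\<bar> \<le> L" using bounded_measurableD(2)[OF X] by auto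
    define I where "I = (\<integral>\<omega>. (X \<omega> - Z \<omega>) * (W \<omega> - Z \<omega>) \<partial>Q)"
    define J where "J n = (\<integral>\<omega>. (X \<omega> - Y n \<omega>) * (W \<omega> - Y n \<omega>) \<partial>Q)" for n
    have JI: "J \<longlonglongrightarrow> I"
      unfolding I_def J_def
    proof (rule integral_dominated_convergence[where w="\<lambda>_. (L + K) * (K + K)"])
      show "AE \<omega> in Q. (\<lambda>n. (X \<omega> - Y n \<omega>) * (W \<omega> - Y n \<omega>)) \<longlonglongrightarrow> (X \<omega> - Z \<omega>) * (W \<omega> - Z \<omega>)"
        using lim by eventually_elim (intro tendsto_intros)
      show "AE \<omega> in Q. norm ((X \<omega> - Y n \<omega>) * (W \<omega> - Y n \<omega>)) \<le> (L + K) * (K + K)" for n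
      proof (rule AE_I2)
        fix \<omega> assume w: "\<omega> \<in> space Q"
        have "\<bar>X \<omega> - Y n \<omega>\<bar> \<le> L + K" "\<bar>W \<omega> - Y n \<omega>\<bar> \<le> K + K"
          using L(2)[OF w] D(3)[OF YD w, of n] D(3)[OF W w] by linarith+
        then show "norm ((X \<omega> - Y n \<omega>) * (W \<omega> - Y n \<omega>)) \<le> (L + K) * (K + K)"
          unfolding real_norm_def abs_mult using L(1) K0 by (intro mult_mono) auto
      qed
    qed auto
    \<comment> \<open>Moving from \<open>Y n\<close> towards \<open>W\<close> by \<open>t\<close>
      cannot bring \<open>d\<close> below \<open>\<delta>\<close>, and \<open>Y n\<close> is within
      \<open>(1/8)^n\<close> of it. The term \<open>4 * K^2\<close> bounds the square of
      \<open>W - Y n\<close>.\<close>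
    have ineq: "2 * t * J n \<le> (1/8)^n + t^2 * (4 * K^2)" if t: "t \<in> {0..1}" for t n
    proof -
      let ?V = "\<lambda>\<omega>. (1 - t) * Y n \<omega> + t * W \<omega>"
      have V: "?V \<in> D" by (rule conv[OF YD W t])
      have p: "integrable Q (\<lambda>\<omega>. (X \<omega> - Y n \<omega>) * (W \<omega> - Y n \<omega>))"
        by (intro int bounded_measurable_mult diff X Ybm Wbm)
      have "d ?V = (\<integral>\<omega>. (X \<omega> - Y n \<omega>)^2 - 2 * t * ((X \<omega> - Y n \<omega>) * (W \<omega> - Y n \<omega>)) + t^2 * (W \<omega> - Y n \<omega>)^2 \<partial>Q)"
        unfolding d_def
        by (intro Bochner_Integration.integral_cong refl) (simp add: power2_eq_square algebra_simps)
      also have "\<dots> = d (Y n) - 2 * t * J n + t^2 * (\<integral>\<omega>. (W \<omega> - Y n \<omega>)^2 \<partial>Q)"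
        using int[OF sq[OF X Ybm]] int[OF sq[OF Wbm Ybm]] p by (simp add: d_def J_def)
      finally have dV: "d ?V = d (Y n) - 2 * t * J n + t^2 * (\<integral>\<omega>. (W \<omega> - Y n \<omega>)^2 \<partial>Q)" .
      have "(\<integral>\<omega>. (W \<omega> - Y n \<omega>)^2 \<partial>Q) \<le> (\<integral>\<omega>. 4 * K^2 \<partial>Q)"
      proof (intro integral_mono int[OF sq[OF Wbm Ybm]])
        fix \<omega> assume w: "\<omega> \<in> space Q"
        have "\<bar>W \<omega> - Y n \<omega>\<bar> \<le> 2 * K" using D(3)[OF YD w, of n] D(3)[OF W w] by linarith
        then have "\<bar>W \<omega> - Y n \<omega>\<bar>^2 \<le> (2 * K)^2" by (intro power_mono) auto
        then show "(W \<omega> - Y n \<omega>)^2 \<le> 4 * K^2" by simp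
      qed auto
      then have "(\<integral>\<omega>. (W \<omega> - Y n \<omega>)^2 \<partial>Q) \<le> 4 * K^2" by (simp add: prob_space)
      then have "t^2 * (\<integral>\<omega>. (W \<omega> - Y n \<omega>)^2 \<partial>Q) \<le> t^2 * (4 * K^2)" by (intro mult_left_mono) auto
      then show ?thesis using \<delta>[OF V] Yd[of n] dV by linarith
    qed
    have "2 * t * I \<le> 0 + t^2 * (4 * K^2)" if t: "t \<in> {0..1}" for t
    proof (rule LIMSEQ_le)
      show "(\<lambda>n. 2 * t * J n) \<longlonglongrightarrow> 2 * t * I" by (intro tendsto_mult tendsto_const JI)
      show "(\<lambda>n. (1/8)^n + t^2 * (4 * K^2)) \<longlonglongrightarrow> 0 + t^2 * (4 * K^2)"
        by (intro tendsto_add tendsto_const LIMSEQ_power_zero) simp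
      show "\<exists>N. \<forall>n\<ge>N. 2 * t * J n \<le> (1/8)^n + t^2 * (4 * K^2)" using ineq[OF t] by blast
    qed
    then have I_le: "I \<le> t * (2 * K^2)" if "0 < t" "t \<le> 1" for t
      using that by (auto simp: power2_eq_square dest!: meta_spec[of _ t])
    \<comment> \<open>The slack has disappeared with \<open>n\<close>; after division by
      \<open>2 * t\<close> the quadratic term vanishes as \<open>t\<close> decreases to 0.\<close>
    have "I \<le> 0 * (2 * K^2)"
    proof (rule tendsto_lowerbound)
      show "((\<lambda>t. t * (2 * K^2)) \<longlongrightarrow> 0 * (2 * K^2)) (at_right 0)" by (intro tendsto_intros)
      show "\<forall>\<^sub>F t in at_right 0. I \<le> t * (2 * K^2)"
        using eventually_at_right_less[of 0] eventually_at_right_real[of 0 1]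
        by (auto elim!: eventually_elim2 intro!: I_le)
    qed simp
    then show ?thesis by (simp add: I_def)
  qed
  then show ?thesis using YD Zm ZK lim by blast
qed

section \<open>The Krein--Smulian argument for solid cones\<close>

lemma signed_integral_indicator:
  assumes "\<mu> \<in> ca M" "A \<in> sets M"
  shows "signed_integral M \<mu> (indicator A) = \<mu> A"
  using assms sets.sets_into_space[OF assms(2)] by (simp add: signed_integral_def ca_jordan Int_absorb2)

lemma density_charge_eq:
  assumes "Q \<in> prob_measures M" "dominated M {Q} Ps" "Z \<in> bounded_measurable M" "A \<in> sets M"
  shows "density_charge Q Z A = (\<integral>\<omega>. Z \<omega> * indicator A \<omega> \<partial>Q)"
  using signed_integral_density_charge[OF assms(1-3) bounded_measurable_indicator[OF assms(4)]]
    signed_integral_indicator[OF ca_c_ca[OF density_charge_ca_c[OF assms(1-3)]] assms(4)] by simp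

text \<open>Truncation replaces a quasi-sure bound by the pointwise bound that
  \<open>bounded_part\<close> asks for, without leaving the quasi-sure class.\<close>

definition clamp :: "real \<Rightarrow> real \<Rightarrow> real" where
  "clamp k x = max (- k) (min k x)"

lemma clamp: "0 \<le> k \<Longrightarrow> \<bar>clamp k x\<bar> \<le> k" "\<bar>x\<bar> \<le> k \<Longrightarrow> clamp k x = x"
  by (auto simp: clamp_def)

lemma bounded_measurable_clamp:
  "X \<in> borel_measurable M \<Longrightarrow> (\<lambda>\<omega>. clamp k (X \<omega>)) \<in> bounded_measurable M"
  by (rule bounded_measurableI[where K="\<bar>k\<bar>"]) (auto simp: clamp_def)

lemma bounded_measurable_prob:
  "Q \<in> prob_measures M \<Longrightarrow> bounded_measurable Q = bounded_measurable M"
  using prob_measuresD[of Q M] by (auto simp: bounded_measurable_def cong: measurable_cong_sets)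

text \<open>\<open>signed_functional M Ps X\<close> is the image of \<open>X\<close> under \<open>L\<^sup>\<infinity>\<^sub>c \<rightarrow> ca\<^sub>c\<^sup>*\<close>, extended by 0 outside
  \<open>ca\<^sub>c\<close>, so that the weak* topology becomes the product topology on functions.\<close>

definition signed_functional ::
    "'a measure \<Rightarrow> 'a measure set \<Rightarrow> ('a \<Rightarrow> real) \<Rightarrow> ('a set \<Rightarrow> real) \<Rightarrow> real" where
  "signed_functional M Ps X \<mu> = (if \<mu> \<in> ca_c M Ps then signed_integral M \<mu> X else 0)"

text \<open>The market enters the separation argument only through these properties. Sensitivity is
  stated for representatives: \<open>X\<close> belongs to \<open>C\<close> as soon as each
  \<open>Q\<close> finds it almost surely equal to a member of \<open>C\<close>, which may depend on
  \<open>Q\<close>.\<close>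

locale sensitive_cone =
  fixes M :: "'a measure" and Ps :: "'a measure set" and C :: "('a \<Rightarrow> real) set"
  assumes Ps: "Ps \<subseteq> prob_measures M"
    and dual: "ca_c_dual_eq_Linf M Ps"
    and bm: "C \<subseteq> bounded_measurable M"
    and zero: "(\<lambda>_. 0) \<in> C"
    and lincomb: "\<And>X Y a b. X \<in> C \<Longrightarrow> Y \<in> C \<Longrightarrow> 0 \<le> a \<Longrightarrow> 0 \<le> b \<Longrightarrow> (\<lambda>\<omega>. a * X \<omega> + b * Y \<omega>) \<in> C"
    and solid: "\<And>X Y. Y \<in> bounded_measurable M \<Longrightarrow> X \<in> C \<Longrightarrow> qs Ps (\<lambda>\<omega>. Y \<omega> \<le> X \<omega>) \<Longrightarrow> Y \<in> C"
    and fatou: "\<And>X Y K. (\<And>n::nat. Y n \<in> C) \<Longrightarrow> (\<And>n \<omega>. \<omega> \<in> space M \<Longrightarrow> \<bar>Y n \<omega>\<bar> \<le> K) \<Longrightarrow>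
       X \<in> bounded_measurable M \<Longrightarrow> qs Ps (\<lambda>\<omega>. (\<lambda>n. Y n \<omega>) \<longlonglongrightarrow> X \<omega>) \<Longrightarrow> X \<in> C"
    and sensitive: "\<exists>Qs. Qs \<subseteq> prob_measures M \<and> dominated M Qs Ps \<and>
       (\<forall>X\<in>bounded_measurable M. (\<forall>Q\<in>Qs. \<exists>Y\<in>C. AE \<omega> in Q. Y \<omega> = X \<omega>) \<longrightarrow> X \<in> C)"
begin

definition bounded_part :: "real \<Rightarrow> ('a \<Rightarrow> real) set" where
  "bounded_part k = {Y \<in> C. \<forall>\<omega>\<in>space M. \<bar>Y \<omega>\<bar> \<le> k}"

lemma bounded_partD:
  assumes "Y \<in> bounded_part k"
  shows "Y \<in> C" "\<And>\<omega>. \<omega> \<in> space M \<Longrightarrow> \<bar>Y \<omega>\<bar> \<le> k" "Y \<in> bounded_measurable M"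
  using assms bm by (auto simp: bounded_part_def)

lemma zero_bounded_part: "0 \<le> k \<Longrightarrow> (\<lambda>_. 0) \<in> bounded_part k"
  by (simp add: bounded_part_def zero)

lemma bounded_part_convex:
  assumes "Y \<in> bounded_part k" "W \<in> bounded_part k" "t \<in> {0..1}"
  shows "(\<lambda>\<omega>. (1 - t) * Y \<omega> + t * W \<omega>) \<in> bounded_part k"
  unfolding bounded_part_def
proof (intro CollectI conjI ballI)
  show "(\<lambda>\<omega>. (1 - t) * Y \<omega> + t * W \<omega>) \<in> C"
    using assms by (intro lincomb bounded_partD) auto
  fix \<omega> assume w: "\<omega> \<in> space M"
  have "\<bar>(1 - t) * Y \<omega> + t * W \<omega>\<bar> \<le> (1 - t) * \<bar>Y \<omega>\<bar> + t * \<bar>W \<omega>\<bar>"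
    using assms(3) by (intro order_trans[OF abs_triangle_ineq]) (simp add: abs_mult)
  also have "\<dots> \<le> (1 - t) * k + t * k"
    using assms(3) bounded_partD(2)[OF assms(1) w] bounded_partD(2)[OF assms(2) w]
    by (intro add_mono mult_left_mono) auto
  finally show "\<bar>(1 - t) * Y \<omega> + t * W \<omega>\<bar> \<le> k" by (simp add: algebra_simps)
qed

lemma qs_cong: "X \<in> C \<Longrightarrow> Y \<in> bounded_measurable M \<Longrightarrow> qs Ps (\<lambda>\<omega>. X \<omega> = Y \<omega>) \<Longrightarrow> Y \<in> C"
  by (rule solid) (auto elim: qs_mp)

lemma dominated_single: "P \<in> Ps \<Longrightarrow> dominated M {P} Ps"
  by (auto simp: dominated_def upper_prob_eq_0_iff)

text \<open>A limit that exists only \<open>Q\<close>-a.s. is turned into one that exists quasi-surely by lowering the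
  sequence to \<open>-k\<close> where it diverges; this stays in \<open>C\<close> because \<open>C\<close> is solid.\<close>

lemma AE_limit_bounded_part:
  assumes Q: "Q \<in> prob_measures M" and Y: "\<And>n::nat. Y n \<in> bounded_part k" and k: "0 \<le> k"
    and lim: "AE \<omega> in Q. (\<lambda>n. Y n \<omega>) \<longlonglongrightarrow> Z \<omega>" and Z: "Z \<in> borel_measurable M"
    and Zk: "\<And>\<omega>. \<omega> \<in> space M \<Longrightarrow> \<bar>Z \<omega>\<bar> \<le> k"
  shows "\<exists>W\<in>C. AE \<omega> in Q. W \<omega> = Z \<omega>"
proof -
  note [measurable] = Z bounded_measurableD(1)[OF bounded_partD(3)[OF Y]]
  define N where "N = {\<omega> \<in> space M. (\<lambda>n. Y n \<omega>) \<longlonglongrightarrow> Z \<omega>}"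
  have N [measurable]: "N \<in> sets M" unfolding N_def by measurable
  define Y' where "Y' n \<omega> = (if \<omega> \<in> N then Y n \<omega> else - k)" for n \<omega>
  define W where "W \<omega> = (if \<omega> \<in> N then Z \<omega> else - k)" for \<omega>
  have "W \<in> C"
  proof (rule fatou)
    show "Y' n \<in> C" for n
    proof (rule solid)
      show "Y' n \<in> bounded_measurable M"
        unfolding Y'_def[abs_def] using bounded_partD(2)[OF Y] k
        by (intro bounded_measurableI[where K=k]) auto
      show "Y n \<in> C" by (rule bounded_partD[OF Y])
      have "AE \<omega> in P. Y' n \<omega> \<le> Y n \<omega>" if "P \<in> Ps" for P
      proof (rule AE_I2)
        fix \<omega> assume "\<omega> \<in> space P"
        then have "\<omega> \<in> space M" using that Ps prob_measuresD(3) by blast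
        then have "\<bar>Y n \<omega>\<bar> \<le> k" by (rule bounded_partD(2)[OF Y])
        then show "Y' n \<omega> \<le> Y n \<omega>" by (auto simp: Y'_def)
      qed
      then show "qs Ps (\<lambda>\<omega>. Y' n \<omega> \<le> Y n \<omega>)" by (simp add: qs_def)
    qed
    show "\<bar>Y' n \<omega>\<bar> \<le> k" if "\<omega> \<in> space M" for n \<omega>
      using bounded_partD(2)[OF Y that, of n] k by (simp add: Y'_def)
    show "W \<in> bounded_measurable M"
      unfolding W_def[abs_def] using Zk k by (intro bounded_measurableI[where K=k]) auto
    have "(\<lambda>n. Y' n \<omega>) \<longlonglongrightarrow> W \<omega>" for \<omega>
      by (cases "\<omega> \<in> N") (simp_all add: Y'_def W_def, simp add: N_def)
    then show "qs Ps (\<lambda>\<omega>. (\<lambda>n. Y' n \<omega>) \<longlonglongrightarrow> W \<omega>)" by (simp add: qs_def)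
  qed
  moreover have "AE \<omega> in Q. W \<omega> = Z \<omega>"
    using lim AE_space
  proof eventually_elim
    case (elim \<omega>)
    then show ?case using prob_measuresD(3)[OF Q] by (simp add: W_def N_def)
  qed
  ultimately show ?thesis by blast
qed

text \<open>\<open>X\<close> is assumed to lie in the \<open>\<sigma>(L\<^sup>\<infinity>(Q), L\<^sup>1(Q))\<close>-closure of the bounded part; testing with
  \<open>X - Z\<close>, where \<open>Z\<close> is the \<open>L\<^sup>2(Q)\<close>-nearest point, gives \<open>X = Z\<close>.\<close>

lemma weak_limit_bounded_part:
  assumes Q: "Q \<in> prob_measures M" and X: "X \<in> bounded_measurable M" and k: "0 \<le> k"
    and approx: "\<And>Z e. Z \<in> bounded_measurable M \<Longrightarrow> 0 < e \<Longrightarrow>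
      \<exists>Y\<in>bounded_part k. \<bar>(\<integral>\<omega>. Z \<omega> * Y \<omega> \<partial>Q) - (\<integral>\<omega>. Z \<omega> * X \<omega> \<partial>Q)\<bar> < e"
  shows "\<exists>W\<in>C. AE \<omega> in Q. W \<omega> = X \<omega>"
proof -
  note Qs = prob_measuresD[OF Q]
  have bmQ: "bounded_measurable Q = bounded_measurable M" by (rule bounded_measurable_prob[OF Q])
  have ex: "\<exists>Y Z. (\<forall>n::nat. Y n \<in> bounded_part k) \<and> Z \<in> borel_measurable Q \<and> (\<forall>\<omega>\<in>space Q. \<bar>Z \<omega>\<bar> \<le> k) \<and>
    (AE \<omega> in Q. (\<lambda>n. Y n \<omega>) \<longlonglongrightarrow> Z \<omega>) \<and>
    (\<forall>W\<in>bounded_part k. (\<integral>\<omega>. (X \<omega> - Z \<omega>) * (W \<omega> - Z \<omega>) \<partial>Q) \<le> 0)"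
  proof (rule L2_nearest_point)
    show "bounded_part k \<subseteq> borel_measurable Q"
      using bounded_partD(3) bounded_measurableD(1) by (auto simp flip: bmQ)
  qed (use Qs X bmQ zero_bounded_part[OF k] bounded_partD(2) bounded_part_convex in auto)
  then obtain Y Z where Y: "\<And>n::nat. Y n \<in> bounded_part k" and Zm: "Z \<in> borel_measurable Q"
    and Zk: "\<And>\<omega>. \<omega> \<in> space Q \<Longrightarrow> \<bar>Z \<omega>\<bar> \<le> k" and lim: "AE \<omega> in Q. (\<lambda>n. Y n \<omega>) \<longlonglongrightarrow> Z \<omega>"
    and opt: "\<And>W. W \<in> bounded_part k \<Longrightarrow> (\<integral>\<omega>. (X \<omega> - Z \<omega>) * (W \<omega> - Z \<omega>) \<partial>Q) \<le> 0"
    by blast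
  have Z: "Z \<in> bounded_measurable M" using Zm Zk by (auto intro: bounded_measurableI simp flip: bmQ)
  define V where "V \<omega> = X \<omega> - Z \<omega>" for \<omega>
  have V: "V \<in> bounded_measurable M"
    using bounded_measurable_lincomb[OF X Z, of 1 "-1"] by (simp add: V_def[abs_def])
  have int: "integrable Q (\<lambda>\<omega>. V \<omega> * U \<omega>)" if "U \<in> bounded_measurable M" for U
    by (rule integrable_bounded_measurable[OF Qs(4,2) bounded_measurable_mult[OF V that]])
  have small: "(\<integral>\<omega>. V \<omega> * V \<omega> \<partial>Q) \<le> 0 + e" if e: "0 < e" for e
  proof -
    obtain W where W: "W \<in> bounded_part k" and *: "\<bar>(\<integral>\<omega>. V \<omega> * W \<omega> \<partial>Q) - (\<integral>\<omega>. V \<omega> * X \<omega> \<partial>Q)\<bar> < e"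
      using approx[OF V e] by blast
    note Wb = bounded_partD(3)[OF W]
    have "(\<integral>\<omega>. V \<omega> * V \<omega> \<partial>Q) = (\<integral>\<omega>. V \<omega> * X \<omega> - V \<omega> * Z \<omega> \<partial>Q)"
      by (simp add: V_def algebra_simps)
    also have "\<dots> = (\<integral>\<omega>. V \<omega> * X \<omega> \<partial>Q) - (\<integral>\<omega>. V \<omega> * Z \<omega> \<partial>Q)"
      using int[OF X] int[OF Z] by simp
    finally have 1: "(\<integral>\<omega>. V \<omega> * V \<omega> \<partial>Q) = (\<integral>\<omega>. V \<omega> * X \<omega> \<partial>Q) - (\<integral>\<omega>. V \<omega> * Z \<omega> \<partial>Q)" .
    have "(\<integral>\<omega>. V \<omega> * W \<omega> \<partial>Q) - (\<integral>\<omega>. V \<omega> * Z \<omega> \<partial>Q) = (\<integral>\<omega>. V \<omega> * W \<omega> - V \<omega> * Z \<omega> \<partial>Q)"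
      using int[OF Wb] int[OF Z] by simp
    also have "\<dots> \<le> 0" using opt[OF W] by (simp add: V_def algebra_simps)
    finally show ?thesis using 1 * by linarith
  qed
  then have "(\<integral>\<omega>. V \<omega> * V \<omega> \<partial>Q) \<le> 0" by (rule field_le_epsilon)
  then have "(\<integral>\<omega>. V \<omega> * V \<omega> \<partial>Q) = 0" by (intro antisym) auto
  then have "AE \<omega> in Q. V \<omega> * V \<omega> = 0"
    using int[OF V] by (subst (asm) integral_nonneg_eq_0_iff_AE) auto
  then have XZ: "AE \<omega> in Q. Z \<omega> = X \<omega>" by eventually_elim (simp add: V_def)
  obtain W where "W \<in> C" and WZ: "AE \<omega> in Q. W \<omega> = Z \<omega>"
    using AE_limit_bounded_part[OF Q Y k lim bounded_measurableD(1)[OF Z]] Zk Qs(3) by auto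
  moreover have "AE \<omega> in Q. W \<omega> = X \<omega>" using WZ XZ by eventually_elim simp
  ultimately show ?thesis by blast
qed

text \<open>If \<open>s * X\<close> exceeded \<open>k\<close> on a set \<open>A\<close> of positive
  \<open>P\<close>-measure, its integral over \<open>A\<close> would exceed \<open>k\<close> times
  the measure of \<open>A\<close>. Integrals against the charges with density
  \<open>s * indicator A\<close> thus determine the quasi-sure bound.\<close>

lemma qs_abs_leI:
  assumes X: "X \<in> bounded_measurable M"
    and le: "\<And>P s. P \<in> Ps \<Longrightarrow> s \<in> {1, -1} \<Longrightarrow> 0 < measure P {\<omega> \<in> space M. k < s * X \<omega>} \<Longrightarrow>
      (\<integral>\<omega>. s * indicator {\<omega> \<in> space M. k < s * X \<omega>} \<omega> * X \<omega> \<partial>P) \<le> k * measure P {\<omega> \<in> space M. k < s * X \<omega>}"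
  shows "qs Ps (\<lambda>\<omega>. \<bar>X \<omega>\<bar> \<le> k)"
proof -
  have "AE \<omega> in P. s * X \<omega> \<le> k" if P: "P \<in> Ps" and s: "s \<in> {1, -1}" for P s
  proof -
    have PM: "P \<in> prob_measures M" using P Ps by blast
    interpret prob_space P by (rule prob_measuresD[OF PM])
    note Pf = prob_measuresD[OF PM]
    note [measurable] = bounded_measurableD(1)[OF X]
    let ?A = "{\<omega> \<in> space M. k < s * X \<omega>}"
    have A: "?A \<in> sets M" by measurable
    have AP: "?A \<in> sets P" using A Pf(2) by simp
    have "measure P ?A = 0"
    proof (rule ccontr)
      assume "measure P ?A \<noteq> 0"
      then have pos: "0 < measure P ?A" by (simp add: zero_less_measure_iff)
      let ?U = "\<lambda>\<omega>. s * indicator ?A \<omega> * X \<omega> - k * indicator ?A \<omega>"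
      have iA: "integrable P (\<lambda>\<omega>. s * indicator ?A \<omega> * X \<omega>)"
        using bounded_measurable_mult[OF bounded_measurable_mult[OF bounded_measurable_const bounded_measurable_indicator[OF A]] X]
        by (rule integrable_bounded_measurable[OF Pf(4,2)])
      have iB: "integrable P (\<lambda>\<omega>. k * indicator ?A \<omega>)" using AP by (simp add: less_top[symmetric])
      have "(\<integral>\<omega>. ?U \<omega> \<partial>P) = (\<integral>\<omega>. s * indicator ?A \<omega> * X \<omega> \<partial>P) - k * measure P ?A"
        using iA iB AP by (simp add: sets.sets_into_space Int_absorb1)
      then have "(\<integral>\<omega>. ?U \<omega> \<partial>P) \<le> 0" using le[OF P s pos] by simp
      moreover have nn: "0 \<le> ?U \<omega>" for \<omega> by (auto simp: indicator_def)
      ultimately have "(\<integral>\<omega>. ?U \<omega> \<partial>P) = 0" by (intro antisym Bochner_Integration.integral_nonneg)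
      then have "AE \<omega> in P. ?U \<omega> = 0"
        using iA iB nn by (subst (asm) integral_nonneg_eq_0_iff_AE) auto
      then have "AE \<omega> in P. \<omega> \<notin> ?A" by eventually_elim (auto simp: indicator_def split: if_splits)
      then have "measure P ?A = 0" 
        using AE_iff_null_sets[OF AP] by (simp add: measure_def null_sets_def)
      then show False using pos by simp
    qed
    then have "AE \<omega> in P. \<omega> \<notin> ?A" using AP by (intro AE_not_in) (auto simp: emeasure_eq_measure null_sets_def)
    then show ?thesis using AE_space by eventually_elim (use Pf(3) in auto)
  qed
  from this[of _ 1] this[of _ "-1"] show ?thesis
    unfolding qs_def by (auto simp: abs_le_iff intro: AE_conjI)
qed

section \<open>Weak* compactness of the bounded parts\<close>

lemma continuous_eval: "continuous_on UNIV (\<lambda>l. l \<mu> :: real)"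
  by (rule continuous_on_product_coordinates)

text \<open>The image sits in a product of compact intervals, so it remains to show that it is
  closed. A closure point is a bounded linear functional and hence given by some \<open>X\<close>;
  the bound \<open>k\<close> and membership in \<open>C\<close> still have to be recovered for this
  \<open>X\<close>.\<close>

lemma compact_bounded_part:
  assumes k: "0 \<le> k"
  shows "compact (signed_functional M Ps ` bounded_part k)"
proof -
  let ?\<Phi> = "signed_functional M Ps" and ?S = "signed_functional M Ps ` bounded_part k"
  let ?B = "\<Pi>\<^sub>E \<mu>\<in>UNIV. {- (k * tv_norm M \<mu>)..k * tv_norm M \<mu>}"
  have tv0: "0 \<le> tv_norm M \<mu>" for \<mu> by (simp add: tv_norm_def)
  have bnd: "\<bar>?\<Phi> Y \<mu>\<bar> \<le> k * tv_norm M \<mu>" if "Y \<in> bounded_part k" for Y \<mu>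
    using abs_signed_integral_le[OF ca_c_ca bounded_partD(3)[OF that] bounded_partD(2)[OF that]] k tv0
    by (auto simp: signed_functional_def)
  have "compactin (product_topology (\<lambda>_. euclidean) UNIV) ?B" by (simp add: compactin_PiE)
  then have cB: "compact ?B" by (simp add: euclidean_product_topology)
  have SB: "?S \<subseteq> ?B"
  proof (clarsimp simp: PiE_UNIV_domain)
    fix Y \<mu> assume "Y \<in> bounded_part k"
    then show "- (k * tv_norm M \<mu>) \<le> ?\<Phi> Y \<mu> \<and> ?\<Phi> Y \<mu> \<le> k * tv_norm M \<mu>" using bnd[of Y \<mu>] by (auto simp: abs_le_iff)
  qed
  have "l \<in> ?S" if l: "l \<in> closure ?S" for l
  proof -
    \<comment> \<open>Each property needed of \<open>l\<close> is a closed condition on a few of its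
      coordinates that holds on all of \<open>?S\<close>.\<close>
    have cl: "l \<in> T" if "closed T" "?S \<subseteq> T" for T using closure_minimal[OF that(2,1)] l by blast
    have 0: "l \<mu> = 0" if "\<mu> \<notin> ca_c M Ps" for \<mu>
    proof -
      have "l \<in> {l. l \<mu> = 0}"
        by (rule cl) (use that in \<open>auto intro!: closed_Collect_eq continuous_eval simp: signed_functional_def\<close>)
      then show ?thesis by simp
    qed
    have tv: "\<bar>l \<mu>\<bar> \<le> k * tv_norm M \<mu>" for \<mu>
    proof -
      have "l \<in> {l. \<bar>l \<mu>\<bar> \<le> k * tv_norm M \<mu>}"
        by (rule cl) (use bnd in \<open>auto intro!: closed_Collect_le continuous_eval continuous_intros\<close>)
      then show ?thesis by simp
    qed
    have add: "l (\<lambda>A. \<mu> A + \<nu> A) = l \<mu> + l \<nu>" if "\<mu> \<in> ca_c M Ps" "\<nu> \<in> ca_c M Ps" for \<mu> \<nu>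
    proof -
      have "(\<lambda>A. \<mu> A + \<nu> A) \<in> ca_c M Ps" using ca_c_lincomb[OF that, of 1 1] by simp
      then have "l \<in> {l. l (\<lambda>A. \<mu> A + \<nu> A) = l \<mu> + l \<nu>}"
        using that bounded_partD(3)
        by (intro cl closed_Collect_eq continuous_eval continuous_on_add)
          (auto simp: signed_functional_def signed_integral_add ca_c_ca)
      then show ?thesis by simp
    qed
    have mult: "l (\<lambda>A. a * \<mu> A) = a * l \<mu>" if "\<mu> \<in> ca_c M Ps" for \<mu> a
    proof -
      have "(\<lambda>A. a * \<mu> A) \<in> ca_c M Ps" using ca_c_lincomb[OF that that, of a 0] by simp
      then have "l \<in> {l. l (\<lambda>A. a * \<mu> A) = a * l \<mu>}"
        using that bounded_partD(3)
        by (intro cl closed_Collect_eq continuous_eval continuous_on_mult continuous_on_const)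
          (auto simp: signed_functional_def signed_integral_cmult ca_c_ca)
      then show ?thesis by simp
    qed
    have "\<exists>K. \<forall>\<mu>\<in>ca_c M Ps. \<bar>l \<mu>\<bar> \<le> K * tv_norm M \<mu>" using tv by blast
    then have "l \<in> ca_c_dual M Ps" unfolding ca_c_dual_def using add mult by auto
    then obtain \<xi> where \<xi>: "\<xi> \<in> Linf M Ps" "\<And>X \<mu>. X \<in> \<xi> \<Longrightarrow> \<mu> \<in> ca_c M Ps \<Longrightarrow> l \<mu> = signed_integral M \<mu> X"
      using dual unfolding ca_c_dual_eq_Linf_def by blast
    then obtain X where X: "X \<in> bounded_measurable M" and "\<xi> = qs_rel M Ps `` {X}"
      by (auto simp: Linf_def elim: quotientE)
    then have "X \<in> \<xi>" by (auto simp: qs_rel_def qs_def)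
    then have lX: "l \<mu> = signed_integral M \<mu> X" if "\<mu> \<in> ca_c M Ps" for \<mu> using \<xi>(2) that by blast
    \<comment> \<open>The dual representation says nothing about the size of \<open>X\<close>. The
      bound is read off from the coordinates of \<open>l\<close> at charges concentrated where it
      might fail.\<close>
    have "qs Ps (\<lambda>\<omega>. \<bar>X \<omega>\<bar> \<le> k)"
    proof (rule qs_abs_leI[OF X])
      fix P and s :: real assume P: "P \<in> Ps" and s: "s \<in> {1, -1}"
      let ?A = "{\<omega> \<in> space M. k < s * X \<omega>}" and ?Z = "\<lambda>\<omega>. s * indicator {\<omega> \<in> space M. k < s * X \<omega>} \<omega> :: real"
      have PM: "P \<in> prob_measures M" using P Ps by blast
      interpret prob_space P by (rule prob_measuresD[OF PM])
      note [measurable] = bounded_measurableD(1)[OF X]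
      have A: "?A \<in> sets M" by measurable
      have Z: "?Z \<in> bounded_measurable M"
        by (intro bounded_measurable_mult bounded_measurable_const bounded_measurable_indicator A)
      note dc = density_charge_ca_c[OF PM dominated_single[OF P] Z]
      note dci = signed_integral_density_charge[OF PM dominated_single[OF P] Z]
      have "?\<Phi> Y (density_charge P ?Z) \<le> k * measure P ?A" if Y: "Y \<in> bounded_part k" for Y
      proof -
        have AP: "?A \<in> sets P" using A prob_measuresD(2)[OF PM] by simp
        have "(\<integral>\<omega>. ?Z \<omega> * Y \<omega> \<partial>P) \<le> (\<integral>\<omega>. k * indicator ?A \<omega> \<partial>P)"
        proof (rule integral_mono)
          show "integrable P (\<lambda>\<omega>. ?Z \<omega> * Y \<omega>)"
            by (intro integrable_bounded_measurable[OF prob_measuresD(4,2)[OF PM]] bounded_measurable_mult[OF Z] bounded_partD(3)[OF Y])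
          show "integrable P (\<lambda>\<omega>. k * indicator ?A \<omega>)" using AP by (simp add: less_top[symmetric])
          show "?Z \<omega> * Y \<omega> \<le> k * indicator ?A \<omega>" if "\<omega> \<in> space P" for \<omega>
            using bounded_partD(2)[OF Y, of \<omega>] that s prob_measuresD(3)[OF PM] by (auto simp: indicator_def abs_le_iff)
        qed
        also have "\<dots> = k * measure P ?A" using Int_absorb2[OF sets.sets_into_space[OF AP]] by simp
        finally show ?thesis using dc dci[OF bounded_partD(3)[OF Y]] by (simp add: signed_functional_def)
      qed
      then have "l \<in> {l. l (density_charge P ?Z) \<le> k * measure P ?A}"
        by (intro cl closed_Collect_le continuous_eval continuous_on_const) auto
      then show "(\<integral>\<omega>. ?Z \<omega> * X \<omega> \<partial>P) \<le> k * measure P ?A"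
        using lX[OF dc] dci[OF X] by simp
    qed
    then have Xclamp: "qs Ps (\<lambda>\<omega>. X \<omega> = clamp k (X \<omega>))" by (rule qs_mp) (simp add: clamp)
    \<comment> \<open>\<open>X\<close> is bounded by \<open>k\<close> only quasi-surely, members of
      \<open>bounded_part k\<close> everywhere.\<close>
    define X' where "X' \<omega> = clamp k (X \<omega>)" for \<omega>
    have X': "X' \<in> bounded_measurable M"
      unfolding X'_def[abs_def] by (rule bounded_measurable_clamp[OF bounded_measurableD(1)[OF X]])
    have lX': "l \<mu> = signed_integral M \<mu> X'" if "\<mu> \<in> ca_c M Ps" for \<mu>
      using lX[OF that] signed_integral_qs_cong[OF Ps that X X'] Xclamp by (simp add: X'_def)
    obtain Qs where Qs: "Qs \<subseteq> prob_measures M" "dominated M Qs Ps"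
      "\<And>X. X \<in> bounded_measurable M \<Longrightarrow> (\<And>Q. Q \<in> Qs \<Longrightarrow> \<exists>Y\<in>C. AE \<omega> in Q. Y \<omega> = X \<omega>) \<Longrightarrow> X \<in> C"
      using sensitive by auto
    have "X' \<in> C"
    proof (rule Qs(3)[OF X'])
      fix Q assume Q: "Q \<in> Qs"
      have QM: "Q \<in> prob_measures M" and Qd: "dominated M {Q} Ps"
        using Q Qs(1,2) by (auto simp: dominated_def upper_prob_eq_0_iff)
      show "\<exists>Y\<in>C. AE \<omega> in Q. Y \<omega> = X' \<omega>"
      proof (rule weak_limit_bounded_part[OF QM X' k])
        fix Z and e :: real assume Z: "Z \<in> bounded_measurable M" and e: "0 < e"
        let ?\<mu> = "density_charge Q Z"
        note mu = density_charge_ca_c[OF QM Qd Z]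
        \<comment> \<open>A neighbourhood of \<open>l\<close> given by a single coordinate already
          contains an element of \<open>?S\<close> with the required integral.\<close>
        have "open {l'. \<bar>l' ?\<mu> - l ?\<mu>\<bar> < e}"
          by (intro open_Collect_less continuous_on_rabs continuous_on_diff continuous_eval continuous_on_const)
        moreover have "l \<in> {l'. \<bar>l' ?\<mu> - l ?\<mu>\<bar> < e} \<inter> closure ?S" using l e by simp
        ultimately have "{l'. \<bar>l' ?\<mu> - l ?\<mu>\<bar> < e} \<inter> ?S \<noteq> {}"
          using open_Int_closure_eq_empty by blast
        then obtain Y where "Y \<in> bounded_part k" "\<bar>?\<Phi> Y ?\<mu> - l ?\<mu>\<bar> < e" by auto
        then show "\<exists>Y\<in>bounded_part k. \<bar>(\<integral>\<omega>. Z \<omega> * Y \<omega> \<partial>Q) - (\<integral>\<omega>. Z \<omega> * X' \<omega> \<partial>Q)\<bar> < e"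
          using signed_integral_density_charge[OF QM Qd Z] bounded_partD(3) X' lX'[OF mu] mu
          by (intro bexI[of _ Y]) (simp_all add: signed_functional_def)
      qed
    qed
    then have "X' \<in> bounded_part k" using k by (simp add: bounded_part_def X'_def clamp)
    moreover have "l = ?\<Phi> X'" using 0 lX' by (intro ext) (simp add: signed_functional_def)
    ultimately show ?thesis by blast
  qed
  then have "closure ?S \<subseteq> ?S" by (rule subsetI)
  then have "closed ?S" by (simp only: closure_subset_eq)
  with cB have "compact (?B \<inter> ?S)" by (rule compact_Int_closed)
  moreover have "?B \<inter> ?S = ?S" using SB by (rule Int_absorb1)
  ultimately show ?thesis by (simp only:)
qed

section \<open>Separation from one bounded part\<close>

lemma minimax_bounded_part:
  assumes k: "0 \<le> k" and U: "U \<subseteq> ca_c M Ps" "U \<noteq> {}"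
    and conv: "\<And>\<mu> \<nu> t. \<mu> \<in> U \<Longrightarrow> \<nu> \<in> U \<Longrightarrow> t \<in> {0..1} \<Longrightarrow> (\<lambda>A. (1 - t) * \<mu> A + t * \<nu> A) \<in> U"
    and r: "\<And>\<mu> \<nu> t. \<mu> \<in> U \<Longrightarrow> \<nu> \<in> U \<Longrightarrow> t \<in> {0..1} \<Longrightarrow> r (\<lambda>A. (1 - t) * \<mu> A + t * \<nu> A) = (1 - t) * r \<mu> + t * r \<nu>"
    and ex: "\<And>Y. Y \<in> bounded_part k \<Longrightarrow> \<exists>\<mu>\<in>U. signed_integral M \<mu> Y < r \<mu>"
  shows "\<exists>\<mu>\<in>U. \<forall>Y\<in>bounded_part k. signed_integral M \<mu> Y < r \<mu>"
proof -
  let ?\<Phi> = "signed_functional M Ps" and ?S = "signed_functional M Ps ` bounded_part k"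
  \<comment> \<open>The affine term \<open>r\<close> covers both uses: the integral of
    \<open>X\<close> when a claim is separated, a constant when a charge is corrected.\<close>
  let ?F = "(\<lambda>\<mu> l. l \<mu> - r \<mu> :: real) ` U"
  have \<Phi>: "?\<Phi> Y \<mu> = signed_integral M \<mu> Y" if "\<mu> \<in> U" for Y \<mu>
    using that U by (auto simp: signed_functional_def)
  have "\<exists>f\<in>?F. \<forall>l\<in>?S. f l < 0"
  proof (rule minimax)
    show "continuous_on UNIV f" if "f \<in> ?F" for f
      using that by (auto intro!: continuous_on_diff continuous_eval continuous_on_const)
    show "?F \<noteq> {}" using U by simp
    show "compact ?S" by (rule compact_bounded_part[OF k])
    show "\<exists>h\<in>?F. \<forall>l\<in>?S. h l = (1 - t) * f l + t * g l"
      if f: "f \<in> ?F" and g: "g \<in> ?F" and t: "t \<in> {0..1}" for f g t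
    proof -
      obtain \<mu> \<nu> where mn: "\<mu> \<in> U" "\<nu> \<in> U" "f = (\<lambda>l. l \<mu> - r \<mu>)" "g = (\<lambda>l. l \<nu> - r \<nu>)" using f g by blast
      let ?m = "\<lambda>A. (1 - t) * \<mu> A + t * \<nu> A"
      have m: "?m \<in> U" by (rule conv[OF mn(1,2) t])
      have "?\<Phi> Y ?m = (1 - t) * ?\<Phi> Y \<mu> + t * ?\<Phi> Y \<nu>" if "Y \<in> bounded_part k" for Y
        unfolding \<Phi>[OF m] \<Phi>[OF mn(1)] \<Phi>[OF mn(2)]
        using mn U bounded_partD(3)[OF that] by (intro signed_integral_lincomb ca_c_ca) auto
      then have "\<forall>l\<in>?S. l ?m - r ?m = (1 - t) * f l + t * g l"
        unfolding mn(3,4) r[OF mn(1,2) t] by (simp add: algebra_simps)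
      then show ?thesis by (intro bexI[OF _ imageI[OF m]])
    qed
    show "convexlike ?S ?F"
      unfolding convexlike_def
    proof (intro ballI)
      fix l l' and t :: real assume l: "l \<in> ?S" "l' \<in> ?S" and t: "t \<in> {0..1}"
      obtain Y W where YW: "Y \<in> bounded_part k" "W \<in> bounded_part k" "l = ?\<Phi> Y" "l' = ?\<Phi> W" using l by blast
      let ?V = "\<lambda>\<omega>. (1 - t) * Y \<omega> + t * W \<omega>"
      have V: "?V \<in> bounded_part k" by (rule bounded_part_convex[OF YW(1,2) t])
      have "?\<Phi> ?V \<mu> - r \<mu> = (1 - t) * (?\<Phi> Y \<mu> - r \<mu>) + t * (?\<Phi> W \<mu> - r \<mu>)" if "\<mu> \<in> U" for \<mu>
        unfolding \<Phi>[OF that] using that U YW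
        by (subst signed_integral_lincomb_right) (auto simp: algebra_simps intro: ca_c_ca bounded_partD(3))
      then show "\<exists>z\<in>?S. \<forall>f\<in>?F. f z = (1 - t) * f l + t * f l'"
        using V YW(3,4) by blast
    qed
    show "\<exists>f\<in>?F. f l < 0" if l: "l \<in> ?S" for l
    proof -
      obtain Y where Y: "Y \<in> bounded_part k" "l = ?\<Phi> Y" using l by blast
      obtain \<mu> where "\<mu> \<in> U" "signed_integral M \<mu> Y < r \<mu>" using ex[OF Y(1)] by blast
      then show ?thesis by (intro bexI[of _ "\<lambda>l. l \<mu> - r \<mu>"]) (simp_all add: Y(2) \<Phi>)
    qed
  qed
  then show ?thesis using \<Phi> by force
qed

text \<open>By minimax it suffices to treat one \<open>Y\<close>. If no charge separated
  \<open>X\<close> from \<open>Y\<close>, the densities \<open>X - Y\<close> under each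
  \<open>P\<close> would force \<open>X = Y\<close> quasi-surely, and \<open>X\<close> would lie in
  \<open>C\<close>.\<close>

lemma separate_bounded_part:
  assumes X: "X \<in> bounded_measurable M" "X \<notin> C" and k: "0 \<le> k"
  shows "\<exists>\<mu>\<in>ca_c M Ps. \<forall>Y\<in>bounded_part k. signed_integral M \<mu> Y < signed_integral M \<mu> X"
proof (rule minimax_bounded_part[OF k subset_refl])
  have "(\<lambda>A. 0) \<in> ca_c M Ps" by (simp add: ca_c_def ca_def)
  then show "ca_c M Ps \<noteq> {}" by blast
  fix Y assume Y: "Y \<in> bounded_part k"
  note Yb = bounded_partD(3)[OF Y]
  show "\<exists>\<mu>\<in>ca_c M Ps. signed_integral M \<mu> Y < signed_integral M \<mu> X"
  proof (rule ccontr)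
    assume "\<not> ?thesis"
    then have le: "signed_integral M \<mu> X \<le> signed_integral M \<mu> Y" if "\<mu> \<in> ca_c M Ps" for \<mu>
      using that by (auto simp: not_less)
    define V where "V \<omega> = X \<omega> - Y \<omega>" for \<omega>
    have V: "V \<in> bounded_measurable M"
      using bounded_measurable_lincomb[OF X(1) Yb, of 1 "-1"] by (simp add: V_def[abs_def])
    have "AE \<omega> in P. Y \<omega> = X \<omega>" if P: "P \<in> Ps" for P
    proof -
      have PM: "P \<in> prob_measures M" using P Ps by blast
      note int = integrable_bounded_measurable[OF prob_measuresD(4,2)[OF PM]]
      note V1 = density_charge_ca_c[OF PM dominated_single[OF P] V]
        and V2 = signed_integral_density_charge[OF PM dominated_single[OF P] V]
      have "(\<integral>\<omega>. V \<omega> * V \<omega> \<partial>P) = (\<integral>\<omega>. V \<omega> * X \<omega> - V \<omega> * Y \<omega> \<partial>P)"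
        by (simp add: V_def algebra_simps)
      also have "\<dots> = (\<integral>\<omega>. V \<omega> * X \<omega> \<partial>P) - (\<integral>\<omega>. V \<omega> * Y \<omega> \<partial>P)"
        using int[OF bounded_measurable_mult[OF V X(1)]] int[OF bounded_measurable_mult[OF V Yb]] by simp
      also have "\<dots> \<le> 0" using le[OF V1] V2[OF X(1)] V2[OF Yb] by simp
      finally have "(\<integral>\<omega>. V \<omega> * V \<omega> \<partial>P) = 0" by (intro antisym) auto
      then have "AE \<omega> in P. V \<omega> * V \<omega> = 0"
        using int[OF bounded_measurable_mult[OF V V]] by (subst (asm) integral_nonneg_eq_0_iff_AE) auto
      then show ?thesis by eventually_elim (simp add: V_def)
    qed
    then have "X \<in> C" by (intro qs_cong[OF bounded_partD(1)[OF Y] X(1)]) (simp add: qs_def)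
    then show False using X(2) by simp
  qed
qed (use X(1) in \<open>auto intro!: ca_c_lincomb signed_integral_lincomb ca_c_ca\<close>)

section \<open>Correcting a separating charge to a polar one\<close>

definition nearly_polar :: "real \<Rightarrow> ('a set \<Rightarrow> real) \<Rightarrow> bool" where
  "nearly_polar \<epsilon> \<mu> \<longleftrightarrow> (\<forall>k\<ge>0. \<forall>Y\<in>bounded_part k. signed_integral M \<mu> Y \<le> \<epsilon> * k)"

lemma bounded_part_scale:
  assumes "Y \<in> bounded_part k" "0 \<le> a"
  shows "(\<lambda>\<omega>. a * Y \<omega>) \<in> bounded_part (a * k)"
  using assms lincomb[of Y Y a 0] by (auto simp: bounded_part_def abs_mult intro: mult_left_mono)

text \<open>Since \<open>C\<close> is a cone, scaling carries the bound at one \<open>k\<close> to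
  all others. The defect \<open>\<epsilon>\<close> thus measures the excess over 0 relative to the
  supremum norm, and \<open>\<epsilon> = 0\<close> describes the polar cone.\<close>

lemma nearly_polarI:
  assumes mu: "\<mu> \<in> ca M" and k: "0 < k" and le: "\<And>Y. Y \<in> bounded_part k \<Longrightarrow> signed_integral M \<mu> Y \<le> \<epsilon> * k"
  shows "nearly_polar \<epsilon> \<mu>"
  unfolding nearly_polar_def
proof (intro allI impI ballI)
  fix j Y assume j: "0 \<le> j" and Y: "Y \<in> bounded_part j"
  show "signed_integral M \<mu> Y \<le> \<epsilon> * j"
  proof (cases "j = 0")
    \<comment> \<open>Scaling is impossible here, but \<open>Y\<close> vanishes on
      \<open>space M\<close>.\<close>
    case True
    then have "\<And>\<omega>. \<omega> \<in> space M \<Longrightarrow> \<bar>Y \<omega>\<bar> \<le> 0" using bounded_partD(2)[OF Y] by simp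
    then have "\<bar>signed_integral M \<mu> Y\<bar> \<le> 0 * tv_norm M \<mu>"
      by (rule abs_signed_integral_le[OF mu bounded_partD(3)[OF Y]])
    then show ?thesis using True by simp
  next
    case False
    then have a: "0 \<le> k / j" "k / j * j = k" using j k by auto
    have "k / j * signed_integral M \<mu> Y = signed_integral M \<mu> (\<lambda>\<omega>. k / j * Y \<omega>)"
      using signed_integral_lincomb_right[OF mu bounded_partD(3)[OF Y] bounded_partD(3)[OF Y], of "k / j" 0] by simp
    also have "\<dots> \<le> \<epsilon> * k" using bounded_part_scale[OF Y a(1)] a(2) by (intro le) simp
    finally show ?thesis using j k False by (simp add: field_simps)
  qed
qed

text \<open>The minimax principle reduces this to a single \<open>Y \<in> C\<close>, for which
  \<open>inf {\<integral>Y d(\<mu> - \<nu>) | \<parallel>\<nu>\<parallel> \<le> \<epsilon>} = \<integral>Y d\<mu> - \<epsilon> \<parallel>Y\<parallel> \<le> 0\<close> because \<open>\<mu>\<close> is \<open>\<epsilon>\<close>-nearly polar.\<close>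

lemma nearly_polar_improve:
  assumes mu: "\<mu> \<in> ca_c M Ps" and pol: "nearly_polar \<epsilon> \<mu>" and \<epsilon>: "0 < \<epsilon>" and \<delta>: "0 < \<delta>"
  shows "\<exists>\<nu>\<in>ca_c M Ps. (\<forall>A. \<bar>\<nu> A - \<mu> A\<bar> \<le> \<epsilon>) \<and> nearly_polar \<delta> \<nu>"
proof -
  define U where "U = {\<nu> \<in> ca_c M Ps. \<forall>A. \<bar>\<nu> A - \<mu> A\<bar> \<le> \<epsilon>}"
  have "\<exists>\<nu>\<in>U. \<forall>Y\<in>bounded_part 1. signed_integral M \<nu> Y < \<delta>"
  proof (rule minimax_bounded_part)
    have muU: "\<mu> \<in> U" using mu \<epsilon> by (simp add: U_def)
    then show "U \<noteq> {}" by blast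
    show "U \<subseteq> ca_c M Ps" by (auto simp: U_def)
    fix \<nu> \<nu>' and t :: real assume nu: "\<nu> \<in> U" "\<nu>' \<in> U" and t: "t \<in> {0..1}"
    have "\<bar>((1 - t) * \<nu> A + t * \<nu>' A) - \<mu> A\<bar> \<le> \<epsilon>" for A
    proof -
      have "\<bar>((1 - t) * \<nu> A + t * \<nu>' A) - \<mu> A\<bar> = \<bar>(1 - t) * (\<nu> A - \<mu> A) + t * (\<nu>' A - \<mu> A)\<bar>"
        by (simp add: algebra_simps)
      also have "\<dots> \<le> (1 - t) * \<bar>\<nu> A - \<mu> A\<bar> + t * \<bar>\<nu>' A - \<mu> A\<bar>"
        using t by (intro order_trans[OF abs_triangle_ineq]) (simp add: abs_mult)
      also have "\<dots> \<le> (1 - t) * \<epsilon> + t * \<epsilon>"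
        using nu t by (intro add_mono mult_left_mono) (auto simp: U_def)
      finally show ?thesis by (simp add: algebra_simps)
    qed
    then show "(\<lambda>A. (1 - t) * \<nu> A + t * \<nu>' A) \<in> U"
      using nu by (auto simp: U_def intro: ca_c_lincomb)
    show "\<delta> = (1 - t) * \<delta> + t * \<delta>" by (simp add: algebra_simps)
  next
    fix Y assume Y: "Y \<in> bounded_part 1"
    note Yb = bounded_partD(3)[OF Y]
    show "\<exists>\<nu>\<in>U. signed_integral M \<nu> Y < \<delta>"
    proof (rule ccontr)
      assume "\<not> ?thesis"
      then have ge: "\<delta> \<le> signed_integral M \<nu> Y" if "\<nu> \<in> U" for \<nu> using that by (auto simp: not_less)
      \<comment> \<open>Chosen so that \<open>\<epsilon> * k\<close> falls short of the integral of
        \<open>Y\<close> by exactly \<open>\<delta>\<close>; a bound of \<open>Y\<close> by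
        \<open>k\<close> then contradicts near polarity.\<close>
      define k where "k = (signed_integral M \<mu> Y - \<delta>) / \<epsilon>"
      have "\<mu> \<in> U" using mu \<epsilon> by (simp add: U_def)
      then have k: "0 \<le> k" using ge[of \<mu>] \<epsilon> by (simp add: k_def)
      have "qs Ps (\<lambda>\<omega>. \<bar>Y \<omega>\<bar> \<le> k)"
      proof (rule qs_abs_leI[OF Yb])
        fix P and s :: real
        let ?A = "{\<omega> \<in> space M. k < s * Y \<omega>}"
        assume P: "P \<in> Ps" and s: "s \<in> {1, -1}" and pos: "0 < measure P ?A"
        \<comment> \<open>A charge of total variation \<open>\<epsilon>\<close> spread evenly over
          \<open>?A\<close>. Subtracting it from \<open>\<mu>\<close> lowers the integral of
          \<open>Y\<close> by \<open>\<epsilon>\<close> times the mean of \<open>s * Y\<close> over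
          \<open>?A\<close>, so this mean is at most \<open>k\<close>.\<close>
        define Z where "Z \<omega> = \<epsilon> / measure P ?A * (s * indicator ?A \<omega>)" for \<omega>
        have PM: "P \<in> prob_measures M" using P Ps by blast
        interpret prob_space P by (rule prob_measuresD[OF PM])
        note [measurable] = bounded_measurableD(1)[OF Yb]
        have A: "?A \<in> sets M" by measurable
        then have AP: "?A \<in> sets P" using prob_measuresD(2)[OF PM] by simp
        have Z: "Z \<in> bounded_measurable M" unfolding Z_def[abs_def]
          by (intro bounded_measurable_mult bounded_measurable_const bounded_measurable_indicator A)
        note Z1 = density_charge_ca_c[OF PM dominated_single[OF P] Z]
          and Z2 = signed_integral_density_charge[OF PM dominated_single[OF P] Z]
        note int = integrable_bounded_measurable[OF prob_measuresD(4,2)[OF PM]]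
        let ?\<nu> = "\<lambda>B. 1 * \<mu> B + (-1) * density_charge P Z B"
        have small: "\<bar>density_charge P Z B\<bar> \<le> \<epsilon>" for B
        proof (cases "B \<in> sets M")
          case True
          have "\<bar>density_charge P Z B\<bar> = \<bar>\<integral>\<omega>. Z \<omega> * indicator B \<omega> \<partial>P\<bar>"
            by (simp only: density_charge_eq[OF PM dominated_single[OF P] Z True])
          also have "\<dots> \<le> (\<integral>\<omega>. \<bar>Z \<omega> * indicator B \<omega>\<bar> \<partial>P)" by (rule integral_abs_bound)
          also have "\<dots> \<le> (\<integral>\<omega>. \<epsilon> / measure P ?A * indicator ?A \<omega> \<partial>P)"
          proof (rule integral_mono)
            show "integrable P (\<lambda>\<omega>. \<bar>Z \<omega> * indicator B \<omega>\<bar>)"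
              using int[OF bounded_measurable_mult[OF Z bounded_measurable_indicator[OF True]]] by simp
            show "integrable P (\<lambda>\<omega>. \<epsilon> / measure P ?A * indicator ?A \<omega>)"
              by (intro int bounded_measurable_mult bounded_measurable_const bounded_measurable_indicator A)
            show "\<bar>Z \<omega> * indicator B \<omega>\<bar> \<le> \<epsilon> / measure P ?A * indicator ?A \<omega>" for \<omega>
              using s \<epsilon> by (auto simp: Z_def indicator_def abs_mult)
          qed
          also have "\<dots> = \<epsilon>" using pos sets.sets_into_space[OF AP] by (simp add: Int_absorb1 Int_absorb2)
          finally show ?thesis .
        next
          case False
          then show ?thesis using ca_outside[OF ca_c_ca[OF Z1] False] \<epsilon> by simp
        qed
        have "?\<nu> \<in> ca_c M Ps" by (rule ca_c_lincomb[OF mu Z1])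
        then have "?\<nu> \<in> U" using small by (simp add: U_def)
        from ge[OF this] have "(\<integral>\<omega>. Z \<omega> * Y \<omega> \<partial>P) \<le> \<epsilon> * k"
          unfolding signed_integral_lincomb[OF ca_c_ca[OF mu] ca_c_ca[OF Z1] Yb] Z2[OF Yb] k_def using \<epsilon> by simp
        also have "(\<integral>\<omega>. Z \<omega> * Y \<omega> \<partial>P) = (\<integral>\<omega>. \<epsilon> / measure P ?A * (s * indicator ?A \<omega> * Y \<omega>) \<partial>P)"
          by (simp add: Z_def mult_ac)
        also have "\<dots> = \<epsilon> / measure P ?A * (\<integral>\<omega>. s * indicator ?A \<omega> * Y \<omega> \<partial>P)"
          by (rule integral_mult_right_zero)
        finally show "(\<integral>\<omega>. s * indicator ?A \<omega> * Y \<omega> \<partial>P) \<le> k * measure P ?A"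
          using \<epsilon> pos by (simp add: field_simps)
      qed
      then have Yc: "qs Ps (\<lambda>\<omega>. Y \<omega> = clamp k (Y \<omega>))" by (rule qs_mp) (simp add: clamp)
      let ?Y = "\<lambda>\<omega>. clamp k (Y \<omega>)"
      have Yb': "?Y \<in> bounded_measurable M" by (rule bounded_measurable_clamp[OF bounded_measurableD(1)[OF Yb]])
      have "?Y \<in> bounded_part k"
        using qs_cong[OF bounded_partD(1)[OF Y] Yb' Yc] k by (simp add: bounded_part_def clamp)
      then have "signed_integral M \<mu> ?Y \<le> \<epsilon> * k" using pol k by (simp add: nearly_polar_def)
      then have "signed_integral M \<mu> Y \<le> \<epsilon> * k" using signed_integral_qs_cong[OF Ps mu Yb Yb' Yc] by simp
      then show False using \<epsilon> \<delta> by (simp add: k_def)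
    qed
  qed simp
  then obtain \<nu> where nu: "\<nu> \<in> U" and le: "\<And>Y. Y \<in> bounded_part 1 \<Longrightarrow> signed_integral M \<nu> Y < \<delta>" by blast
  have "nearly_polar \<delta> \<nu>"
    by (rule nearly_polarI[where k=1]) (use nu le in \<open>auto simp: U_def less_imp_le ca_c_ca\<close>)
  then show ?thesis using nu by (auto simp: U_def)
qed

text \<open>Each correction halves the defect and is no larger than the defect it removes, so all
  corrections together change the charge of a set by at most \<open>2 * \<epsilon>\<close>. The
  limit is uniform over sets and therefore stays in \<open>ca_c\<close>.\<close>

lemma polar_near_nearly_polar:
  assumes mu: "\<mu> \<in> ca_c M Ps" and pol: "nearly_polar \<epsilon> \<mu>" and \<epsilon>: "0 < \<epsilon>"
  shows "\<exists>\<nu>\<in>ca_c M Ps. (\<forall>A. \<bar>\<mu> A - \<nu> A\<bar> \<le> 2 * \<epsilon>) \<and> (\<forall>Y\<in>C. signed_integral M \<nu> Y \<le> 0)"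
proof -
  \<comment> \<open>The last clause fixes the starting charge, over which the choice principle gives
    no control.\<close>
  let ?P = "\<lambda>n \<nu>. \<nu> \<in> ca_c M Ps \<and> nearly_polar (\<epsilon> * (1/2)^n) \<nu> \<and> (n = 0 \<longrightarrow> \<nu> = \<mu>)"
  have "\<exists>m. \<forall>n. ?P n (m n) \<and> (\<forall>A. \<bar>m (Suc n) A - m n A\<bar> \<le> \<epsilon> * (1/2)^n)"
  proof (rule dependent_nat_choice)
    show "\<exists>\<nu>. ?P 0 \<nu>" using mu pol by simp
    fix \<nu> n assume nu: "?P n \<nu>"
    have "\<exists>\<nu>'\<in>ca_c M Ps. (\<forall>A. \<bar>\<nu>' A - \<nu> A\<bar> \<le> \<epsilon> * (1/2)^n) \<and> nearly_polar (\<epsilon> * (1/2)^Suc n) \<nu>'"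
      by (rule nearly_polar_improve) (use nu \<epsilon> in auto)
    then show "\<exists>\<nu>'. ?P (Suc n) \<nu>' \<and> (\<forall>A. \<bar>\<nu>' A - \<nu> A\<bar> \<le> \<epsilon> * (1/2)^n)" by auto
  qed
  then obtain m where P: "\<And>n. ?P n (m n)" and step: "\<And>n A. \<bar>m (Suc n) A - m n A\<bar> \<le> \<epsilon> * (1/2)^n"
    by blast
  have m: "m n \<in> ca_c M Ps" "nearly_polar (\<epsilon> * (1/2)^n) (m n)" "m 0 = \<mu>" for n
    using P[of n] P[of 0] by simp_all
  \<comment> \<open>Keeping the exact partial geometric sum lets the induction on \<open>j\<close>
    go through.\<close>
  have dist: "\<bar>m (n + j) A - m n A\<bar> \<le> 2 * \<epsilon> * (1/2)^n - 2 * \<epsilon> * (1/2)^(n + j)" for n j A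
  proof (induction j)
    case (Suc j)
    then show ?case using step[of "n + j" A] by simp
  qed simp
  have dist': "\<bar>m (n + j) A - m n A\<bar> \<le> 2 * \<epsilon> * (1/2)^n" for n j A
  proof -
    have "0 \<le> 2 * \<epsilon> * (1/2)^(n + j)" using \<epsilon> by simp
    then show ?thesis using dist[of n j A] by linarith
  qed
  have e0: "(\<lambda>n. 2 * \<epsilon> * (1/2)^n) \<longlonglongrightarrow> 0"
    by (rule tendsto_mult_right_zero) (rule LIMSEQ_power_zero, simp)
  have "convergent (\<lambda>n. m n A)" for A
  proof (rule Cauchy_convergent, rule metric_CauchyI)
    fix r :: real assume "0 < r"
    then obtain N where N: "2 * \<epsilon> * (1/2)^N < r / 2"
      using order_tendstoD(2)[OF e0, of "r / 2"] by (auto simp: eventually_sequentially)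
    have near: "\<bar>m n A - m N A\<bar> < r / 2" if "n \<ge> N" for n
      using dist'[of N "n - N" A] that N by simp
    have "dist (m i A) (m j A) < r" if "i \<ge> N" "j \<ge> N" for i j
      using near[OF that(1)] near[OF that(2)] unfolding dist_real_def by linarith
    then show "\<exists>N. \<forall>i\<ge>N. \<forall>j\<ge>N. dist (m i A) (m j A) < r" by blast
  qed
  then obtain \<nu> where lim: "\<And>A. (\<lambda>n. m n A) \<longlonglongrightarrow> \<nu> A" unfolding convergent_def by metis
  have near: "\<bar>m n A - \<nu> A\<bar> \<le> 2 * \<epsilon> * (1/2)^n" for n A
  proof (rule LIMSEQ_le_const2)
    show "(\<lambda>j. \<bar>m n A - m (j + n) A\<bar>) \<longlonglongrightarrow> \<bar>m n A - \<nu> A\<bar>"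
      by (intro tendsto_rabs tendsto_diff tendsto_const LIMSEQ_ignore_initial_segment lim)
    show "\<exists>N. \<forall>j\<ge>N. \<bar>m n A - m (j + n) A\<bar> \<le> 2 * \<epsilon> * (1/2)^n"
      using dist'[of n _ A] by (simp add: abs_minus_commute add.commute)
  qed
  have nu: "\<nu> \<in> ca_c M Ps" by (rule ca_c_uniform_limit[OF m(1) near e0])
  have "signed_integral M \<nu> Y \<le> 0" if Y: "Y \<in> C" for Y
  proof -
    have Yb: "Y \<in> bounded_measurable M" using Y bm by blast
    obtain k where k: "0 \<le> k" "\<And>\<omega>. \<omega> \<in> space M \<Longrightarrow> \<bar>Y \<omega>\<bar> \<le> k" using bounded_measurableD(2)[OF Yb] by auto
    \<comment> \<open>The first term is the remaining defect of \<open>m n\<close>, the second the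
      cost of replacing \<open>m n\<close> by \<open>\<nu>\<close>, with the factor 2 of
      \<open>tv_norm_le\<close>.\<close>
    have "signed_integral M \<nu> Y \<le> \<epsilon> * (1/2)^n * k + k * (2 * (2 * \<epsilon> * (1/2)^n))" for n
    proof -
      let ?d = "\<lambda>A. 1 * \<nu> A + (-1) * m n A"
      have d: "?d \<in> ca M" by (rule ca_lincomb[OF ca_c_ca[OF nu] ca_c_ca[OF m(1)]])
      have "\<bar>signed_integral M ?d Y\<bar> \<le> k * tv_norm M ?d" by (rule abs_signed_integral_le[OF d Yb k(2)])
      also have "\<dots> \<le> k * (2 * (2 * \<epsilon> * (1/2)^n))"
        using near[of n] by (intro mult_left_mono k(1) tv_norm_le[OF d]) (simp add: abs_minus_commute)
      finally have "\<bar>signed_integral M ?d Y\<bar> \<le> k * (2 * (2 * \<epsilon> * (1/2)^n))" .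
      moreover have "signed_integral M ?d Y = signed_integral M \<nu> Y - signed_integral M (m n) Y"
        using signed_integral_lincomb[OF ca_c_ca[OF nu] ca_c_ca[OF m(1)] Yb, of 1 "-1" n] by simp
      moreover have "signed_integral M (m n) Y \<le> \<epsilon> * (1/2)^n * k"
        using m(2)[of n] k Y by (simp add: nearly_polar_def bounded_part_def)
      ultimately show ?thesis by linarith
    qed
    note bound = this
    have "(\<lambda>n. \<epsilon> * (1/2)^n * k + k * (2 * (2 * \<epsilon> * (1/2)^n))) \<longlonglongrightarrow> \<epsilon> * 0 * k + k * (2 * (2 * \<epsilon> * 0))"
      by (intro tendsto_intros LIMSEQ_power_zero) simp_all
    then have "signed_integral M \<nu> Y \<le> \<epsilon> * 0 * k + k * (2 * (2 * \<epsilon> * 0))"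
      by (rule LIMSEQ_le_const) (use bound in blast)
    then show ?thesis by simp
  qed
  moreover have "\<bar>\<mu> A - \<nu> A\<bar> \<le> 2 * \<epsilon>" for A using near[of 0 A] m(3) by simp
  ultimately show ?thesis using nu by blast
qed

lemma separate_cone:
  assumes X: "X \<in> bounded_measurable M" "X \<notin> C"
  shows "\<exists>\<mu>\<in>ca_c M Ps. (\<forall>Y\<in>C. signed_integral M \<mu> Y \<le> 0) \<and> 0 < signed_integral M \<mu> X"
proof -
  obtain k where k: "0 \<le> k" "\<And>\<omega>. \<omega> \<in> space M \<Longrightarrow> \<bar>X \<omega>\<bar> \<le> k" using bounded_measurableD(2)[OF X(1)] by auto
  \<comment> \<open>With \<open>\<epsilon> = ?m / L\<close> the corrections move the integral of
    \<open>X\<close> by at most \<open>4 * k * \<epsilon>\<close>, which must stay below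
    \<open>?m\<close>: any \<open>L\<close> above \<open>4 * k\<close> will do, and the summand 8
    keeps \<open>L\<close> positive for \<open>k = 0\<close>.\<close>
  define L where "L = 8 * k + 8"
  have L: "0 < L" using k by (simp add: L_def)
  obtain \<mu> where mu: "\<mu> \<in> ca_c M Ps" and lt: "\<And>Y. Y \<in> bounded_part L \<Longrightarrow> signed_integral M \<mu> Y < signed_integral M \<mu> X"
    using separate_bounded_part[OF X, of L] L by auto
  let ?m = "signed_integral M \<mu> X"
  have "signed_integral M \<mu> (\<lambda>_. 0) = 0" by (simp add: signed_integral_def)
  then have m: "0 < ?m" using lt[OF zero_bounded_part[of L]] L by simp
  define \<epsilon> where "\<epsilon> = ?m / L"
  have \<epsilon>: "0 < \<epsilon>" using m L by (simp add: \<epsilon>_def)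
  have "nearly_polar \<epsilon> \<mu>"
    by (rule nearly_polarI[OF ca_c_ca[OF mu] L]) (use lt L in \<open>simp add: \<epsilon>_def less_imp_le\<close>)
  then obtain \<nu> where nu: "\<nu> \<in> ca_c M Ps" "\<And>A. \<bar>\<mu> A - \<nu> A\<bar> \<le> 2 * \<epsilon>" "\<forall>Y\<in>C. signed_integral M \<nu> Y \<le> 0"
    using polar_near_nearly_polar[OF mu _ \<epsilon>] by blast
  let ?d = "\<lambda>A. 1 * \<mu> A + (-1) * \<nu> A"
  have d: "?d \<in> ca M" by (rule ca_lincomb[OF ca_c_ca[OF mu] ca_c_ca[OF nu(1)]])
  have "\<bar>signed_integral M ?d X\<bar> \<le> k * tv_norm M ?d" by (rule abs_signed_integral_le[OF d X(1) k(2)])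
  also have "\<dots> \<le> k * (2 * (2 * \<epsilon>))"
    using nu(2) by (intro mult_left_mono k(1) tv_norm_le[OF d]) simp
  also have "\<dots> < ?m"
  proof -
    have "4 * k * ?m < L * ?m" using m k(1) by (intro mult_strict_right_mono) (auto simp: L_def)
    then show ?thesis using L by (simp add: \<epsilon>_def field_simps)
  qed
  finally have "0 < signed_integral M \<nu> X"
    using signed_integral_lincomb[OF ca_c_ca[OF mu] ca_c_ca[OF nu(1)] X(1), of 1 "-1"] by simp
  then show ?thesis using nu by blast
qed

text \<open>By solidity \<open>C\<close> contains all negatives of indicators, so a charge polar to
  \<open>C\<close> is nonnegative. The positive integral of \<open>X\<close> excludes total mass 0,
  and the charge can be normalised.\<close>

lemma separate_cone_prob:
  assumes X: "X \<in> bounded_measurable M" "X \<notin> C"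
  shows "\<exists>Q\<in>prob_measures M. measure Q \<in> ca_c M Ps \<and>
    (\<forall>Y\<in>C. signed_integral M (measure Q) Y \<le> 0) \<and> 0 < (\<integral>\<omega>. X \<omega> \<partial>Q)"
proof -
  obtain \<mu> where mu: "\<mu> \<in> ca_c M Ps" and pol: "\<forall>Y\<in>C. signed_integral M \<mu> Y \<le> 0" and X0: "0 < signed_integral M \<mu> X"
    using separate_cone[OF X] by blast
  note muc = ca_c_ca[OF mu]
  have nn: "0 \<le> \<mu> A" if A: "A \<in> sets M" for A
  proof -
    have "(\<lambda>\<omega>. -1 * indicator A \<omega>) \<in> C"
    proof (rule solid[OF _ zero])
      show "(\<lambda>\<omega>. -1 * indicator A \<omega>) \<in> bounded_measurable M"
        by (intro bounded_measurable_mult bounded_measurable_const bounded_measurable_indicator A)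
    qed (simp add: qs_def)
    then have "signed_integral M \<mu> (\<lambda>\<omega>. -1 * indicator A \<omega> + 0 * indicator A \<omega>) \<le> 0" using pol by simp
    then show ?thesis
      using signed_integral_lincomb_right[OF muc bounded_measurable_indicator[OF A] bounded_measurable_indicator[OF A], of "-1" 0]
        signed_integral_indicator[OF muc A] by simp
  qed
  have neg: "measure (neg_part M \<mu>) A = 0" if A: "A \<in> sets M" for A
  proof (rule antisym)
    show "measure (neg_part M \<mu>) A \<le> 0"
      unfolding neg_part_def using nn by (intro measure_pos_part_least ca_uminus muc A) auto
  qed simp
  have pos: "measure (pos_part M \<mu>) A = \<mu> A" if A: "A \<in> sets M" for A
    using ca_jordan[OF muc A] neg[OF A] by simp
  interpret p: finite_measure "pos_part M \<mu>" by (rule finite_measure_pos_part[OF muc])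
  define m where "m = \<mu> (space M)"
  have m: "0 < m"
  proof (rule ccontr)
    assume "\<not> 0 < m"
    then have "tv_norm M \<mu> = 0" using nn[of "space M"] by (simp add: tv_norm_def pos neg m_def)
    moreover obtain k where "\<And>\<omega>. \<omega> \<in> space M \<Longrightarrow> \<bar>X \<omega>\<bar> \<le> k" using bounded_measurableD(2)[OF X(1)] by auto
    ultimately show False using abs_signed_integral_le[OF muc X(1), of k] X0 by simp
  qed
  define Q where "Q = scale_measure (ennreal (1 / m)) (pos_part M \<mu>)"
  have Qs: "sets Q = sets M" "space Q = space M" by (simp_all add: Q_def space_scale_measure)
  have mQ: "measure Q A = 1 / m * \<mu> A" for A
  proof (cases "A \<in> sets M")
    case True then show ?thesis using m pos[OF True] by (simp add: Q_def measure_def enn2real_mult)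
  next
    case False then show ?thesis using ca_outside[OF muc False] Qs by (simp add: measure_notin_sets)
  qed
  have "emeasure Q (space Q) = ennreal (1 / m) * ennreal m"
    using pos[of "space M"] unfolding Qs by (simp add: Q_def p.emeasure_eq_measure m_def)
  also have "\<dots> = 1" using m by (simp flip: ennreal_mult)
  finally have prob: "prob_space Q" by (rule prob_spaceI)
  then have QM: "Q \<in> prob_measures M" using Qs by (simp add: prob_measures_def)
  have mQc: "measure Q = (\<lambda>A. 1 / m * \<mu> A + 0 * \<mu> A)" by (simp add: mQ fun_eq_iff)
  have Qc: "measure Q \<in> ca_c M Ps" unfolding mQc by (rule ca_c_lincomb[OF mu mu])
  have S: "signed_integral M (measure Q) Y = 1 / m * signed_integral M \<mu> Y" if "Y \<in> bounded_measurable M" for Y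
    unfolding mQc using signed_integral_lincomb[OF muc muc that, of "1/m" 0] by simp
  \<comment> \<open>\<open>Q\<close> with \<open>null_measure M\<close> as subtrahend is a
    decomposition of \<open>measure Q\<close>.\<close>
  have "(\<integral>\<omega>. X \<omega> \<partial>Q) = signed_integral M (measure Q) X"
    using signed_integral_eqI[OF ca_c_ca[OF Qc] prob_measuresD(4)[OF QM] _ Qs(1) _ _ X(1), of "null_measure M"]
    by (simp add: finite_measureI)
  then have "0 < (\<integral>\<omega>. X \<omega> \<partial>Q)" using S[OF X(1)] X0 m by simp
  moreover have "signed_integral M (measure Q) Y \<le> 0" if "Y \<in> C" for Y
    using S[of Y] that bm pol m by (auto simp: divide_le_0_iff)
  ultimately show ?thesis using QM Qc by blast
qed

end

section \<open>Quasi-sure closedness of the set of superreplicable claims\<close>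

text \<open>\<open>G\<close> is the information at an earlier date and \<open>V\<close> the gains
  from trading at the same date or later. The last clause pastes countably many gains along a
  \<open>G\<close>-measurable index, as random subsequences require.\<close>

definition pasting_stable :: "'a measure \<Rightarrow> ('a \<Rightarrow> real) set \<Rightarrow> bool" where
  "pasting_stable G V \<longleftrightarrow> (\<forall>v\<in>V. \<forall>w\<in>V. (\<lambda>\<omega>. v \<omega> + w \<omega>) \<in> V) \<and>
     (\<forall>v\<in>V. \<forall>a\<in>borel_measurable G. (\<lambda>\<omega>. a \<omega> * v \<omega>) \<in> V) \<and>
     (\<forall>v. (\<forall>n::nat. v n \<in> V) \<longrightarrow> (\<forall>\<sigma>\<in>measurable G (count_space UNIV). (\<lambda>\<omega>. v (\<sigma> \<omega>) \<omega>) \<in> V))"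

text \<open>Closedness is demanded of the claims dominated by \<open>V\<close>, not of
  \<open>V\<close>: the dominating gains \<open>v n\<close> need not converge, and \<open>w\<close>
  need not be related to them.\<close>

definition qs_closed :: "'a measure set \<Rightarrow> ('a \<Rightarrow> real) set \<Rightarrow> bool" where
  "qs_closed Ps V \<longleftrightarrow> (\<forall>X v Y. (\<forall>n::nat. v n \<in> V \<and> qs Ps (\<lambda>\<omega>. X n \<omega> \<le> v n \<omega>)) \<longrightarrow>
     qs Ps (\<lambda>\<omega>. (\<lambda>n. X n \<omega>) \<longlonglongrightarrow> Y \<omega>) \<longrightarrow> (\<exists>w\<in>V. qs Ps (\<lambda>\<omega>. Y \<omega> \<le> w \<omega>)))"

definition arbitrage_free :: "'a measure set \<Rightarrow> ('a \<Rightarrow> real) set \<Rightarrow> bool" where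
  "arbitrage_free Ps V \<longleftrightarrow> (\<forall>v\<in>V. qs Ps (\<lambda>\<omega>. 0 \<le> v \<omega>) \<longrightarrow> qs Ps (\<lambda>\<omega>. v \<omega> = 0))"

definition add_step :: "'a measure \<Rightarrow> ('a \<Rightarrow> real) \<Rightarrow> ('a \<Rightarrow> real) set \<Rightarrow> ('a \<Rightarrow> real) set" where
  "add_step G D V = {\<lambda>\<omega>. a \<omega> * D \<omega> + v \<omega> | a v. a \<in> borel_measurable G \<and> v \<in> V}"

lemma add_stepI: "a \<in> borel_measurable G \<Longrightarrow> v \<in> V \<Longrightarrow> (\<lambda>\<omega>. a \<omega> * D \<omega> + v \<omega>) \<in> add_step G D V"
  unfolding add_step_def by blast

text \<open>The liminf is a cluster point that depends measurably on the sequence, so indices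
  approaching it can be selected measurably. The bound \<open>B\<close> keeps it finite in
  \<open>ereal\<close>.\<close>

lemma liminf_cluster_point:
  fixes x :: "nat \<Rightarrow> real"
  assumes b: "\<And>n. \<bar>x n\<bar> \<le> B" and e: "0 < e"
  shows "\<exists>n\<ge>k. \<bar>x n - real_of_ereal (liminf (\<lambda>n. ereal (x n)))\<bar> < e"
    and "\<bar>real_of_ereal (liminf (\<lambda>n. ereal (x n)))\<bar> \<le> B"
proof -
  let ?L = "liminf (\<lambda>n. ereal (x n))"
  have b': "- B \<le> x n" "x n \<le> B" for n using b[of n] by (auto simp: abs_le_iff)
  have "ereal (- B) \<le> ?L" using b' by (intro Liminf_bounded) auto
  moreover have "?L \<le> ereal B" using b' by (intro Liminf_le) auto
  ultimately obtain U where U: "?L = ereal U" "- B \<le> U" "U \<le> B" by (cases ?L) auto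
  then show "\<bar>real_of_ereal ?L\<bar> \<le> B" by (auto simp: abs_le_iff)
  obtain r where r: "strict_mono r" "((\<lambda>n. ereal (x n)) \<circ> r) \<longlonglongrightarrow> ?L"
    using liminf_subseq_lim by blast
  then have "(\<lambda>n. x (r n)) \<longlonglongrightarrow> U" using U by (simp add: comp_def)
  then obtain N where N: "\<And>n. n \<ge> N \<Longrightarrow> \<bar>x (r n) - U\<bar> < e"
    using LIMSEQ_D[OF _ e] by (metis real_norm_def)
  have "max N k \<le> r (max N k)" by (rule seq_suble[OF r(1)])
  then show "\<exists>n\<ge>k. \<bar>x n - real_of_ereal ?L\<bar> < e"
    using N[of "max N k"] U by (intro exI[of _ "r (max N k)"]) auto
qed

text \<open>\<open>arctan\<close> compactifies the real line, so that \<open>U = \<plusminus>\<pi>/2\<close> encodes the limits \<open>\<plusminus>\<infinity>\<close>.\<close>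

lemma random_subsequence:
  fixes f :: "nat \<Rightarrow> 'a \<Rightarrow> real"
  assumes f [measurable]: "\<And>n. f n \<in> borel_measurable G"
  shows "\<exists>\<sigma> U. (\<forall>k::nat. \<sigma> k \<in> measurable G (count_space UNIV)) \<and> (\<forall>k \<omega>. k \<le> \<sigma> k \<omega>) \<and>
    U \<in> borel_measurable G \<and> (\<forall>\<omega>. \<bar>U \<omega>\<bar> \<le> pi/2) \<and> (\<forall>\<omega>. (\<lambda>k. arctan (f (\<sigma> k \<omega>) \<omega>)) \<longlonglongrightarrow> U \<omega>)"
proof -
  define U where "U \<omega> = real_of_ereal (liminf (\<lambda>n. ereal (arctan (f n \<omega>))))" for \<omega>
  have arctan_m [measurable]: "(\<lambda>\<omega>. arctan (f n \<omega>)) \<in> borel_measurable G" for n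
    by (rule borel_measurable_continuous_on[OF _ f]) (intro continuous_intros)
  have U [measurable]: "U \<in> borel_measurable G" unfolding U_def[abs_def] by measurable
  define P where "P k \<omega> n \<longleftrightarrow> k \<le> n \<and> \<bar>arctan (f n \<omega>) - U \<omega>\<bar> < 1 / real (Suc k)" for k \<omega> n
  \<comment> \<open>Taking the least admissible index makes the selection measurable.\<close>
  define \<sigma> where "\<sigma> k \<omega> = (LEAST n. P k \<omega> n)" for k \<omega>
  have b: "\<bar>arctan x\<bar> \<le> pi/2" for x
    using arctan_bounded[of x] by (auto simp: abs_le_iff)
  have "\<exists>n. P k \<omega> n" for k \<omega>
    using liminf_cluster_point(1)[of "\<lambda>n. arctan (f n \<omega>)" "pi/2" "1 / real (Suc k)" k] b
    by (auto simp: P_def U_def)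
  then have \<sigma>P: "P k \<omega> (\<sigma> k \<omega>)" for k \<omega> unfolding \<sigma>_def by (rule LeastI_ex)
  have "\<sigma> k \<in> measurable G (count_space UNIV)" for k
    unfolding \<sigma>_def[abs_def] P_def by measurable
  moreover have "k \<le> \<sigma> k \<omega>" for k \<omega> using \<sigma>P by (simp add: P_def)
  moreover have "\<bar>U \<omega>\<bar> \<le> pi/2" for \<omega>
    unfolding U_def by (rule liminf_cluster_point(2)[OF b zero_less_one])
  moreover have "(\<lambda>k. arctan (f (\<sigma> k \<omega>) \<omega>)) \<longlonglongrightarrow> U \<omega>" for \<omega>
  proof -
    have "(\<lambda>k. arctan (f (\<sigma> k \<omega>) \<omega>) - U \<omega>) \<longlonglongrightarrow> 0"
    proof (rule Lim_null_comparison)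
      show "\<forall>\<^sub>F k in sequentially. norm (arctan (f (\<sigma> k \<omega>) \<omega>) - U \<omega>) \<le> 1 / real (Suc k)"
        using \<sigma>P by (intro always_eventually) (auto simp: P_def intro: less_imp_le)
      show "(\<lambda>k. 1 / real (Suc k)) \<longlonglongrightarrow> 0" by (rule LIMSEQ_Suc[OF lim_1_over_n])
    qed
    then show ?thesis by (simp add: LIM_zero_iff)
  qed
  ultimately show ?thesis using U by blast
qed

text \<open>Inverting \<open>x = tan (arctan x)\<close> expresses the inverse as a cotangent, which
  tends to 0. The product of \<open>x\<close> with the modulus of its inverse is the sign of
  \<open>x\<close>, shared with \<open>arctan x\<close>, and \<open>sgn\<close> is continuous at
  \<open>u\<close>. As \<open>inverse 0 = 0\<close>, both formulas persist where
  \<open>x k = 0\<close>.\<close>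

lemma arctan_limit_infinite:
  fixes x :: "nat \<Rightarrow> real"
  assumes lim: "(\<lambda>k. arctan (x k)) \<longlonglongrightarrow> u" and u: "\<bar>u\<bar> = pi/2"
  shows "(\<lambda>k. \<bar>inverse (x k)\<bar>) \<longlonglongrightarrow> 0" and "(\<lambda>k. \<bar>inverse (x k)\<bar> * x k) \<longlonglongrightarrow> sgn u"
proof -
  have cases: "u = pi/2 \<or> u = - (pi/2)" using u by linarith
  have "sin u = 1 \<or> sin u = - 1" by (metis cases sin_minus sin_pi_half)
  then have sin: "sin u \<noteq> 0" by auto
  have cos: "cos u = 0" by (metis cases cos_minus cos_pi_half)
  note trig = cos sin
  have "inverse (x k) = cos (arctan (x k)) / sin (arctan (x k))" for k
  proof -
    have "x k = sin (arctan (x k)) / cos (arctan (x k))" using tan_arctan[of "x k"] by (simp add: tan_def)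
    then have "inverse (x k) = inverse (sin (arctan (x k)) / cos (arctan (x k)))" by simp
    then show ?thesis by (simp only: inverse_divide)
  qed
  moreover have "(\<lambda>k. \<bar>cos (arctan (x k)) / sin (arctan (x k))\<bar>) \<longlonglongrightarrow> \<bar>cos u / sin u\<bar>"
    using trig by (intro tendsto_intros lim) auto
  ultimately show "(\<lambda>k. \<bar>inverse (x k)\<bar>) \<longlonglongrightarrow> 0" using trig by simp
  have "\<bar>inverse y\<bar> * y = sgn (arctan y)" for y :: real
    by (cases y "0 :: real" rule: linorder_cases) (auto simp: sgn_real_def field_simps)
  moreover have "(\<lambda>k. sgn (arctan (x k))) \<longlonglongrightarrow> sgn u"
    using cases pi_gt_zero by (intro tendsto_sgn lim) auto
  ultimately show "(\<lambda>k. \<bar>inverse (x k)\<bar> * x k) \<longlonglongrightarrow> sgn u" by simp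
qed

text \<open>The limit is \<open>tan u\<close>, written as a quotient so that measurability in
  \<open>u\<close> follows from the continuity of \<open>sin\<close> and \<open>cos\<close>.\<close>

lemma arctan_limit_finite:
  fixes x :: "nat \<Rightarrow> real"
  assumes lim: "(\<lambda>k. arctan (x k)) \<longlonglongrightarrow> u" and u: "\<bar>u\<bar> < pi/2"
  shows "x \<longlonglongrightarrow> sin u / cos u"
proof -
  have "0 < cos u" using u by (intro cos_gt_zero_pi) auto
  then have "cos u \<noteq> 0" by simp
  then have "(\<lambda>k. sin (arctan (x k)) / cos (arctan (x k))) \<longlonglongrightarrow> sin u / cos u"
    by (intro tendsto_intros lim)
  moreover have "sin (arctan y) / cos (arctan y) = y" for y :: real
    using tan_arctan[of y] by (simp only: tan_def)
  ultimately show ?thesis by simp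
qed

text \<open>The Kabanov--Stricker argument for one scalar position \<open>f\<close> in the asset with increment \<open>D\<close>.
  Where the positions \<open>f n\<close> stay bounded along a random subsequence we pass to their limit. Where
  they explode, normalising produces a position \<open>e = \<plusminus>1\<close> which can be hedged by \<open>V\<close>; by absence of
  arbitrage it is replicated exactly, so that the position in \<open>D\<close> can be shifted into \<open>V\<close>.\<close>

lemma qs_closed_add_step:
  assumes st: "pasting_stable G V" and cl: "qs_closed Ps V" and na: "arbitrage_free Ps (add_step G D V)"
  shows "qs_closed Ps (add_step G D V)"
  unfolding qs_closed_def
proof (intro allI impI)
  fix X :: "nat \<Rightarrow> 'a \<Rightarrow> real" and x Y
  assume x: "\<forall>n. x n \<in> add_step G D V \<and> qs Ps (\<lambda>\<omega>. X n \<omega> \<le> x n \<omega>)"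
    and XY: "qs Ps (\<lambda>\<omega>. (\<lambda>n. X n \<omega>) \<longlonglongrightarrow> Y \<omega>)"
  have V_add: "(\<lambda>\<omega>. v \<omega> + w \<omega>) \<in> V" if "v \<in> V" "w \<in> V" for v w using st that by (simp add: pasting_stable_def)
  have V_mult: "(\<lambda>\<omega>. a \<omega> * v \<omega>) \<in> V" if "v \<in> V" "a \<in> borel_measurable G" for a v
    using st that by (simp add: pasting_stable_def)
  have "\<exists>f v. f \<in> borel_measurable G \<and> v \<in> V \<and> x n = (\<lambda>\<omega>. f \<omega> * D \<omega> + v \<omega>)" for n
    using x[rule_format, of n] unfolding add_step_def by blast
  then obtain f v where f [measurable]: "\<And>n. f n \<in> borel_measurable G" and v: "\<And>n. v n \<in> V"
    and xe: "\<And>n. x n = (\<lambda>\<omega>. f n \<omega> * D \<omega> + v n \<omega>)" by metis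
  have le: "qs Ps (\<lambda>\<omega>. \<forall>n. X n \<omega> \<le> f n \<omega> * D \<omega> + v n \<omega>)"
    using x by (simp add: qs_all_countable xe)
  obtain \<sigma> U where \<sigma> [measurable]: "\<And>k. \<sigma> k \<in> measurable G (count_space UNIV)" and \<sigma>k: "\<And>k \<omega>. k \<le> \<sigma> k \<omega>"
    and U [measurable]: "U \<in> borel_measurable G" and Ub: "\<And>\<omega>. \<bar>U \<omega>\<bar> \<le> pi/2"
    and lim: "\<And>\<omega>. (\<lambda>k. arctan (f (\<sigma> k \<omega>) \<omega>)) \<longlonglongrightarrow> U \<omega>"
    using random_subsequence[of f G, OF f] by blast
  define F where "F k \<omega> = f (\<sigma> k \<omega>) \<omega>" for k \<omega>
  define W where "W k \<omega> = v (\<sigma> k \<omega>) \<omega>" for k \<omega>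
  define X' where "X' k \<omega> = X (\<sigma> k \<omega>) \<omega>" for k \<omega>
  have F [measurable]: "F k \<in> borel_measurable G" for k
    unfolding F_def[abs_def] by (rule measurable_compose_countable[OF f \<sigma>])
  have W: "W k \<in> V" for k
    unfolding W_def[abs_def] using st v \<sigma> by (simp add: pasting_stable_def)
  have X'Y: "qs Ps (\<lambda>\<omega>. (\<lambda>k. X' k \<omega>) \<longlonglongrightarrow> Y \<omega>)"
    using XY
  proof (rule qs_mp)
    fix \<omega> assume "(\<lambda>n. X n \<omega>) \<longlonglongrightarrow> Y \<omega>"
    moreover have "filterlim (\<lambda>k. \<sigma> k \<omega>) at_top sequentially"
      by (rule filterlim_at_top_mono[OF filterlim_ident]) (simp add: \<sigma>k)
    ultimately show "(\<lambda>k. X' k \<omega>) \<longlonglongrightarrow> Y \<omega>"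
      unfolding X'_def by (rule filterlim_compose)
  qed
  have le': "qs Ps (\<lambda>\<omega>. \<forall>k. X' k \<omega> \<le> F k \<omega> * D \<omega> + W k \<omega>)"
    using le by (rule qs_mp) (simp add: X'_def F_def W_def)
  \<comment> \<open>The direction of the explosion, and 0 where there is none; thus
    \<open>e * e\<close> is the indicator of the explosion set.\<close>
  define e where "e \<omega> = (if \<bar>U \<omega>\<bar> = pi/2 then sgn (U \<omega>) else 0)" for \<omega>
  have e [measurable]: "e \<in> borel_measurable G" unfolding e_def[abs_def] by measurable
  have e_sq: "e \<omega> * e \<omega> = (if \<bar>U \<omega>\<bar> = pi/2 then 1 else 0)" for \<omega>
  proof (cases "\<bar>U \<omega>\<bar> = pi/2")
    case True
    then have "U \<omega> \<noteq> 0" using pi_gt_zero by auto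
    then have "sgn (U \<omega>) * sgn (U \<omega>) = 1" by (simp add: sgn_real_def)
    then show ?thesis unfolding e_def if_P[OF True] .
  qed (simp add: e_def)
  define b where "b k \<omega> = (if \<bar>U \<omega>\<bar> = pi/2 then \<bar>inverse (F k \<omega>)\<bar> else 0)" for k \<omega>
  have b [measurable]: "b k \<in> borel_measurable G" for k unfolding b_def[abs_def] by measurable
  have b_lim: "(\<lambda>k. b k \<omega>) \<longlonglongrightarrow> 0" "(\<lambda>k. b k \<omega> * F k \<omega>) \<longlonglongrightarrow> e \<omega>" for \<omega>
  proof -
    have "(\<lambda>k. b k \<omega>) \<longlonglongrightarrow> 0 \<and> (\<lambda>k. b k \<omega> * F k \<omega>) \<longlonglongrightarrow> e \<omega>"
    proof (cases "\<bar>U \<omega>\<bar> = pi/2")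
      case True
      then show ?thesis
        using arctan_limit_infinite[OF lim True] unfolding b_def e_def F_def if_P[OF True] by blast
    next
      case False
      then show ?thesis unfolding b_def e_def if_not_P[OF False] by simp
    qed
    then show "(\<lambda>k. b k \<omega>) \<longlonglongrightarrow> 0" "(\<lambda>k. b k \<omega> * F k \<omega>) \<longlonglongrightarrow> e \<omega>" by blast+
  qed
  \<comment> \<open>Scaled by \<open>b k\<close>, the claims \<open>X' k\<close> die out and the
    positions \<open>F k\<close> tend to \<open>e\<close>, so in the limit \<open>V\<close> hedges
    \<open>- (e * D)\<close>.\<close>
  have "\<exists>w\<in>V. qs Ps (\<lambda>\<omega>. - (e \<omega> * D \<omega>) \<le> w \<omega>)"
  proof (rule cl[unfolded qs_closed_def, rule_format])
    show "(\<lambda>\<omega>. b k \<omega> * W k \<omega>) \<in> V \<and>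
        qs Ps (\<lambda>\<omega>. b k \<omega> * X' k \<omega> - b k \<omega> * F k \<omega> * D \<omega> \<le> b k \<omega> * W k \<omega>)" for k
    proof
      show "qs Ps (\<lambda>\<omega>. b k \<omega> * X' k \<omega> - b k \<omega> * F k \<omega> * D \<omega> \<le> b k \<omega> * W k \<omega>)"
        using le'
      proof (rule qs_mp)
        fix \<omega> assume *: "\<forall>k. X' k \<omega> \<le> F k \<omega> * D \<omega> + W k \<omega>"
        have "b k \<omega> * X' k \<omega> \<le> b k \<omega> * (F k \<omega> * D \<omega> + W k \<omega>)"
          using * by (intro mult_left_mono) (auto simp: b_def)
        then show "b k \<omega> * X' k \<omega> - b k \<omega> * F k \<omega> * D \<omega> \<le> b k \<omega> * W k \<omega>"
          by (simp add: algebra_simps)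
      qed
    qed (rule V_mult[OF W b])
    show "qs Ps (\<lambda>\<omega>. (\<lambda>k. b k \<omega> * X' k \<omega> - b k \<omega> * F k \<omega> * D \<omega>) \<longlonglongrightarrow> - (e \<omega> * D \<omega>))"
      using X'Y
    proof (rule qs_mp)
      fix \<omega> assume "(\<lambda>k. X' k \<omega>) \<longlonglongrightarrow> Y \<omega>"
      then have "(\<lambda>k. b k \<omega> * X' k \<omega> - b k \<omega> * F k \<omega> * D \<omega>) \<longlonglongrightarrow> 0 * Y \<omega> - e \<omega> * D \<omega>"
        by (intro tendsto_diff tendsto_mult b_lim tendsto_const)
      then show "(\<lambda>k. b k \<omega> * X' k \<omega> - b k \<omega> * F k \<omega> * D \<omega>) \<longlonglongrightarrow> - (e \<omega> * D \<omega>)" by simp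
    qed
  qed
  then obtain w where w: "w \<in> V" and we: "qs Ps (\<lambda>\<omega>. - (e \<omega> * D \<omega>) \<le> w \<omega>)" by blast
  \<comment> \<open>Restricting the hedge to the explosion set makes its sum with
    \<open>e * D\<close> nonnegative everywhere that the hedge works, so that absence of arbitrage
    applies.\<close>
  let ?w = "\<lambda>\<omega>. e \<omega> * e \<omega> * w \<omega>"
  have w1: "?w \<in> V" by (rule V_mult[OF w]) measurable
  have "(\<lambda>\<omega>. e \<omega> * D \<omega> + ?w \<omega>) \<in> add_step G D V" using e w1 by (rule add_stepI)
  moreover have "qs Ps (\<lambda>\<omega>. 0 \<le> e \<omega> * D \<omega> + ?w \<omega>)"
    using we
  proof (rule qs_mp)
    fix \<omega> assume *: "- (e \<omega> * D \<omega>) \<le> w \<omega>"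
    show "0 \<le> e \<omega> * D \<omega> + ?w \<omega>"
    proof (cases "\<bar>U \<omega>\<bar> = pi/2")
      case True
      then show ?thesis using * unfolding e_sq by simp
    next
      case False
      then have "e \<omega> = 0" by (simp only: e_def if_False)
      then show ?thesis by simp
    qed
  qed
  ultimately have repl: "qs Ps (\<lambda>\<omega>. e \<omega> * D \<omega> + ?w \<omega> = 0)"
    by (rule na[unfolded arbitrage_free_def, rule_format])
  \<comment> \<open>Only the position off the explosion set is kept, and there it converges. On the
    explosion set \<open>D = e * (e * D)\<close>, and the replication \<open>e * D = - ?w\<close>
    turns \<open>F k * D\<close> into the gain \<open>- (F k * e) * ?w\<close> in
    \<open>V\<close>.\<close>
  define F' where "F' k \<omega> = F k \<omega> * (1 - e \<omega> * e \<omega>)" for k \<omega>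
  define h where "h \<omega> = (sin (U \<omega>) / cos (U \<omega>)) * (1 - e \<omega> * e \<omega>)" for \<omega>
  have [measurable]: "(\<lambda>\<omega>. sin (U \<omega>)) \<in> borel_measurable G" "(\<lambda>\<omega>. cos (U \<omega>)) \<in> borel_measurable G"
    by (rule borel_measurable_continuous_on[OF _ U], intro continuous_intros)+
  have h [measurable]: "h \<in> borel_measurable G" unfolding h_def[abs_def] by measurable
  have F'h: "(\<lambda>k. F' k \<omega>) \<longlonglongrightarrow> h \<omega>" for \<omega>
  proof (cases "\<bar>U \<omega>\<bar> = pi/2")
    case False
    then have "\<bar>U \<omega>\<bar> < pi/2" using Ub[of \<omega>] by linarith
    then have "(\<lambda>k. F k \<omega>) \<longlonglongrightarrow> sin (U \<omega>) / cos (U \<omega>)"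
      unfolding F_def by (rule arctan_limit_finite[OF lim])
    then show ?thesis unfolding F'_def h_def by (intro tendsto_mult tendsto_const)
  qed (simp add: F'_def h_def e_sq)
  have "\<exists>w\<in>V. qs Ps (\<lambda>\<omega>. Y \<omega> - h \<omega> * D \<omega> \<le> w \<omega>)"
  proof (rule cl[unfolded qs_closed_def, rule_format])
    show "(\<lambda>\<omega>. W k \<omega> + (- (F k \<omega> * e \<omega>)) * ?w \<omega>) \<in> V \<and>
        qs Ps (\<lambda>\<omega>. X' k \<omega> - F' k \<omega> * D \<omega> \<le> W k \<omega> + (- (F k \<omega> * e \<omega>)) * ?w \<omega>)" for k
    proof
      show "(\<lambda>\<omega>. W k \<omega> + (- (F k \<omega> * e \<omega>)) * ?w \<omega>) \<in> V"
        by (rule V_add[OF W V_mult[OF w1]]) measurable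
      show "qs Ps (\<lambda>\<omega>. X' k \<omega> - F' k \<omega> * D \<omega> \<le> W k \<omega> + (- (F k \<omega> * e \<omega>)) * ?w \<omega>)"
        using le' repl
      proof (rule qs_mp2)
        fix \<omega> assume *: "\<forall>k. X' k \<omega> \<le> F k \<omega> * D \<omega> + W k \<omega>" and "e \<omega> * D \<omega> + ?w \<omega> = 0"
        then have "?w \<omega> = - (e \<omega> * D \<omega>)" by linarith
        then have "(- (F k \<omega> * e \<omega>)) * ?w \<omega> + F' k \<omega> * D \<omega> = F k \<omega> * D \<omega>"
          by (simp only: F'_def) (simp add: algebra_simps)
        then show "X' k \<omega> - F' k \<omega> * D \<omega> \<le> W k \<omega> + (- (F k \<omega> * e \<omega>)) * ?w \<omega>"
          using *[rule_format, of k] by linarith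
      qed
    qed
    show "qs Ps (\<lambda>\<omega>. (\<lambda>k. X' k \<omega> - F' k \<omega> * D \<omega>) \<longlonglongrightarrow> Y \<omega> - h \<omega> * D \<omega>)"
      using X'Y by (rule qs_mp) (intro tendsto_diff tendsto_mult F'h tendsto_const)
  qed
  then obtain w' where w': "w' \<in> V" "qs Ps (\<lambda>\<omega>. Y \<omega> - h \<omega> * D \<omega> \<le> w' \<omega>)" by blast
  have "qs Ps (\<lambda>\<omega>. Y \<omega> \<le> h \<omega> * D \<omega> + w' \<omega>)" using w'(2) by (rule qs_mp) simp
  moreover have "(\<lambda>\<omega>. h \<omega> * D \<omega> + w' \<omega>) \<in> add_step G D V" using h w'(1) by (rule add_stepI)
  ultimately show "\<exists>w\<in>add_step G D V. qs Ps (\<lambda>\<omega>. Y \<omega> \<le> w \<omega>)" by (rule bexI)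
qed

section \<open>Gains built from scalar positions\<close>

definition scalar_gains ::
    "(nat \<Rightarrow> 'a measure) \<Rightarrow> (nat \<Rightarrow> 'a \<Rightarrow> real ^ 'd) \<Rightarrow> (nat \<times> 'd) set \<Rightarrow> ('a \<Rightarrow> real) set" where
  "scalar_gains F S I = {\<lambda>\<omega>. \<Sum>i\<in>I. h i \<omega> * (S (fst i) \<omega> $ snd i - S (fst i - 1) \<omega> $ snd i) | h.
     \<forall>i\<in>I. h i \<in> borel_measurable (F (fst i - 1))}"

lemma scalar_gainsI:
  "(\<And>i. i \<in> I \<Longrightarrow> h i \<in> borel_measurable (F (fst i - 1))) \<Longrightarrow>
    (\<lambda>\<omega>. \<Sum>i\<in>I. h i \<omega> * (S (fst i) \<omega> $ snd i - S (fst i - 1) \<omega> $ snd i)) \<in> scalar_gains F S I"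
  unfolding scalar_gains_def by (rule CollectI, rule exI[of _ h], rule conjI[OF refl], rule ballI)

lemma scalar_gainsE:
  assumes "v \<in> scalar_gains F S I"
  obtains h where "\<And>i. i \<in> I \<Longrightarrow> h i \<in> borel_measurable (F (fst i - 1))"
    "v = (\<lambda>\<omega>. \<Sum>i\<in>I. h i \<omega> * (S (fst i) \<omega> $ snd i - S (fst i - 1) \<omega> $ snd i))"
proof -
  from assms obtain h where
    "v = (\<lambda>\<omega>. \<Sum>i\<in>I. h i \<omega> * (S (fst i) \<omega> $ snd i - S (fst i - 1) \<omega> $ snd i)) \<and>
      (\<forall>i\<in>I. h i \<in> borel_measurable (F (fst i - 1)))"
    unfolding scalar_gains_def mem_Collect_eq ..
  then show ?thesis using that[of h] by simp
qed

text \<open>\<open>G\<close> is contained in the information before every date in \<open>I\<close>,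
  so multiplying by \<open>G\<close>-measurable factors or pasting along a
  \<open>G\<close>-measurable index keeps the positions predictable.\<close>

lemma pasting_stable_scalar_gains:
  fixes F :: "nat \<Rightarrow> 'a measure" and S :: "nat \<Rightarrow> 'a \<Rightarrow> real ^ 'd"
  assumes sub: "\<And>i. i \<in> I \<Longrightarrow> subalgebra (F (fst i - 1)) G"
  shows "pasting_stable G (scalar_gains F S I)"
proof -
  let ?\<Delta> = "\<lambda>i \<omega>. S (fst i) \<omega> $ snd i - S (fst i - 1) \<omega> $ snd i"
  let ?gain = "\<lambda>h \<omega>. \<Sum>i\<in>I. h i \<omega> * ?\<Delta> i \<omega>"
  have mG: "a \<in> measurable (F (fst i - 1)) N" if "i \<in> I" "a \<in> measurable G N" for a i N
    using that(2) by (rule measurable_from_subalg[OF sub[OF that(1)]])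
  show ?thesis
    unfolding pasting_stable_def
  proof (intro conjI ballI allI impI)
    fix v w assume v: "v \<in> scalar_gains F S I" and w: "w \<in> scalar_gains F S I"
    obtain h where h: "\<And>i. i \<in> I \<Longrightarrow> h i \<in> borel_measurable (F (fst i - 1))" "v = ?gain h"
      using v by (rule scalar_gainsE) (rule that)
    obtain h' where h': "\<And>i. i \<in> I \<Longrightarrow> h' i \<in> borel_measurable (F (fst i - 1))" "w = ?gain h'"
      using w by (rule scalar_gainsE) (rule that)
    have "?gain (\<lambda>i \<omega>. h i \<omega> + h' i \<omega>) \<in> scalar_gains F S I"
      by (rule scalar_gainsI) (rule borel_measurable_add[OF h(1) h'(1)])
    then show "(\<lambda>\<omega>. v \<omega> + w \<omega>) \<in> scalar_gains F S I"
      unfolding h(2) h'(2) by (simp only: distrib_right sum.distrib)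
  next
    fix v and a :: "'a \<Rightarrow> real" assume v: "v \<in> scalar_gains F S I" and a: "a \<in> borel_measurable G"
    obtain h where h: "\<And>i. i \<in> I \<Longrightarrow> h i \<in> borel_measurable (F (fst i - 1))" "v = ?gain h"
      using v by (rule scalar_gainsE) (rule that)
    have "?gain (\<lambda>i \<omega>. a \<omega> * h i \<omega>) \<in> scalar_gains F S I"
      by (rule scalar_gainsI) (rule borel_measurable_times[OF mG[OF _ a] h(1)])
    then show "(\<lambda>\<omega>. a \<omega> * v \<omega>) \<in> scalar_gains F S I"
      unfolding h(2) by (simp only: sum_distrib_left mult.assoc)
  next
    fix v :: "nat \<Rightarrow> 'a \<Rightarrow> real" and \<sigma> :: "'a \<Rightarrow> nat"
    assume v: "\<forall>n. v n \<in> scalar_gains F S I" and \<sigma>: "\<sigma> \<in> measurable G (count_space UNIV)"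
    have "\<exists>h. (\<forall>i\<in>I. h i \<in> borel_measurable (F (fst i - 1))) \<and> v n = ?gain h" for n
    proof -
      obtain h where "\<And>i. i \<in> I \<Longrightarrow> h i \<in> borel_measurable (F (fst i - 1))" "v n = ?gain h"
        using spec[OF v] by (rule scalar_gainsE) (rule that)
      then show ?thesis by (intro exI[of _ h] conjI ballI)
    qed
    then obtain h where h: "\<forall>n. (\<forall>i\<in>I. h n i \<in> borel_measurable (F (fst i - 1))) \<and> v n = ?gain (h n)"
      using choice[of "\<lambda>n h. (\<forall>i\<in>I. h i \<in> borel_measurable (F (fst i - 1))) \<and> v n = ?gain h"] by blast
    have h1: "h n i \<in> borel_measurable (F (fst i - 1))" if "i \<in> I" for n i
      using h that by blast
    have h2: "v n = ?gain (h n)" for n using h by blast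
    have "?gain (\<lambda>i \<omega>. h (\<sigma> \<omega>) i \<omega>) \<in> scalar_gains F S I"
      by (rule scalar_gainsI) (rule measurable_compose_countable[OF h1 mG[OF _ \<sigma>]])
    then show "(\<lambda>\<omega>. v (\<sigma> \<omega>) \<omega>) \<in> scalar_gains F S I"
      unfolding h2 .
  qed
qed

lemma scalar_gains_insert:
  fixes S :: "nat \<Rightarrow> 'a \<Rightarrow> real ^ 'd"
  assumes "finite I" "i \<notin> I"
  shows "scalar_gains F S (insert i I) = add_step (F (fst i - 1))
    (\<lambda>\<omega>. S (fst i) \<omega> $ snd i - S (fst i - 1) \<omega> $ snd i) (scalar_gains F S I)" (is "?L = ?R")
proof (intro set_eqI iffI)
  let ?\<Delta> = "\<lambda>i \<omega>. S (fst i) \<omega> $ snd i - S (fst i - 1) \<omega> $ snd i"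
  fix v assume "v \<in> ?L"
  then obtain h where "\<forall>i\<in>insert i I. h i \<in> borel_measurable (F (fst i - 1))"
    "v = (\<lambda>\<omega>. \<Sum>i\<in>insert i I. h i \<omega> * ?\<Delta> i \<omega>)" by (auto simp: scalar_gains_def)
  then show "v \<in> ?R" using assms unfolding add_step_def scalar_gains_def
    by (intro CollectI exI[of _ "h i"] exI[of _ "\<lambda>\<omega>. \<Sum>i\<in>I. h i \<omega> * ?\<Delta> i \<omega>"]) auto
next
  let ?\<Delta> = "\<lambda>i \<omega>. S (fst i) \<omega> $ snd i - S (fst i - 1) \<omega> $ snd i"
  fix v assume "v \<in> ?R"
  then obtain a h where a: "a \<in> borel_measurable (F (fst i - 1))" and h: "\<forall>i\<in>I. h i \<in> borel_measurable (F (fst i - 1))"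
    and v: "v = (\<lambda>\<omega>. a \<omega> * ?\<Delta> i \<omega> + (\<Sum>i\<in>I. h i \<omega> * ?\<Delta> i \<omega>))" by (auto simp: add_step_def scalar_gains_def)
  have "(\<Sum>j\<in>insert i I. (h(i := a)) j \<omega> * ?\<Delta> j \<omega>) = a \<omega> * ?\<Delta> i \<omega> + (\<Sum>j\<in>I. h j \<omega> * ?\<Delta> j \<omega>)" for \<omega>
  proof -
    have "(\<Sum>j\<in>I. (h(i := a)) j \<omega> * ?\<Delta> j \<omega>) = (\<Sum>j\<in>I. h j \<omega> * ?\<Delta> j \<omega>)"
      using assms(2) by (intro sum.cong) auto
    then show ?thesis using assms by simp
  qed
  then show "v \<in> ?L"
    unfolding scalar_gains_def v using a h
    by (intro CollectI exI[of _ "h(i := a)"]) auto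
qed

text \<open>The additional positions are set to 0. Absence of arbitrage is inherited by fewer
  positions in this way.\<close>

lemma scalar_gains_mono:
  assumes "finite J" "I \<subseteq> J" shows "scalar_gains F S I \<subseteq> scalar_gains F S J"
proof
  let ?\<Delta> = "\<lambda>i \<omega>. S (fst i) \<omega> $ snd i - S (fst i - 1) \<omega> $ snd i"
  fix v assume "v \<in> scalar_gains F S I"
  then obtain h where h: "\<forall>i\<in>I. h i \<in> borel_measurable (F (fst i - 1))"
    "v = (\<lambda>\<omega>. \<Sum>i\<in>I. h i \<omega> * ?\<Delta> i \<omega>)" by (auto simp: scalar_gains_def)
  have "(\<Sum>i\<in>I. h i \<omega> * ?\<Delta> i \<omega>) = (\<Sum>i\<in>J. (if i \<in> I then h i else (\<lambda>_. 0)) \<omega> * ?\<Delta> i \<omega>)" for \<omega>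
    using assms by (intro sum.mono_neutral_cong_left) auto
  then show "v \<in> scalar_gains F S J"
    unfolding scalar_gains_def h(2) using h(1)
    by (intro CollectI exI[of _ "\<lambda>i. if i \<in> I then h i else (\<lambda>_. 0)"]) auto
qed

text \<open>Steps are added in order of decreasing time, so that each new \<open>\<sigma>\<close>-algebra is contained in the
  previous ones.\<close>

lemma qs_closed_scalar_gains:
  fixes F :: "nat \<Rightarrow> 'a measure" and S :: "nat \<Rightarrow> 'a \<Rightarrow> real ^ 'd"
  assumes fin: "finite J" and na: "arbitrage_free Ps (scalar_gains F S J)"
    and sub: "\<And>i j. i \<in> J \<Longrightarrow> j \<in> J \<Longrightarrow> fst i \<le> fst j \<Longrightarrow> subalgebra (F (fst j - 1)) (F (fst i - 1))"
    and IJ: "I \<subseteq> J"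
  shows "qs_closed Ps (scalar_gains F S I)"
  using finite_subset[OF IJ fin] IJ
\<comment> \<open>The rule inserts an element of maximal rank, so minus the date makes the new date
  the earliest one.\<close>
proof (induction rule: finite_ranking_induct[where f="\<lambda>i. - int (fst i)"])
  case empty
  have *: "qs Ps (\<lambda>\<omega>. Y \<omega> \<le> 0)"
    if X: "\<And>n::nat. qs Ps (\<lambda>\<omega>. X n \<omega> \<le> 0)" and lim: "qs Ps (\<lambda>\<omega>. (\<lambda>n. X n \<omega>) \<longlonglongrightarrow> Y \<omega>)" for X and Y :: "'a \<Rightarrow> real"
  proof -
    have "qs Ps (\<lambda>\<omega>. \<forall>n. X n \<omega> \<le> 0)" using X by (simp add: qs_all_countable)
    then show ?thesis using lim by (rule qs_mp2) (rule LIMSEQ_le_const2, auto)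
  qed
  have e: "scalar_gains F S {} = {\<lambda>_. 0}" by (auto simp: scalar_gains_def)
  show ?case
    unfolding qs_closed_def e
  proof (intro allI impI)
    fix X v :: "nat \<Rightarrow> 'a \<Rightarrow> real" and Y
    assume v: "\<forall>n. v n \<in> {\<lambda>_. 0} \<and> qs Ps (\<lambda>\<omega>. X n \<omega> \<le> v n \<omega>)"
      and lim: "qs Ps (\<lambda>\<omega>. (\<lambda>n. X n \<omega>) \<longlonglongrightarrow> Y \<omega>)"
    have "qs Ps (\<lambda>\<omega>. X n \<omega> \<le> 0)" for n
    proof -
      have "v n = (\<lambda>_. 0)" using v by simp
      moreover have "qs Ps (\<lambda>\<omega>. X n \<omega> \<le> v n \<omega>)" using v by blast
      ultimately show ?thesis by (simp only:)
    qed
    then show "\<exists>w\<in>{\<lambda>_. 0}. qs Ps (\<lambda>\<omega>. Y \<omega> \<le> w \<omega>)" using *[OF _ lim] by simp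
  qed
next
  case (insert i I)
  show ?case
  proof (cases "i \<in> I")
    case True then show ?thesis using insert by (simp add: insert_absorb)
  next
    case False
    have "arbitrage_free Ps (scalar_gains F S (insert i I))"
      using na scalar_gains_mono[OF fin insert.prems] unfolding arbitrage_free_def by blast
    moreover have "pasting_stable (F (fst i - 1)) (scalar_gains F S I)"
    proof (rule pasting_stable_scalar_gains)
      fix j assume "j \<in> I"
      then show "subalgebra (F (fst j - 1)) (F (fst i - 1))"
        using insert.hyps(2)[of j] insert.prems by (intro sub) auto
    qed
    ultimately show ?thesis
      unfolding scalar_gains_insert[OF insert.hyps(1) False]
      using insert.IH insert.prems by (intro qs_closed_add_step) auto
  qed
qed

lemma scalar_gains_eq_gain:
  fixes S :: "nat \<Rightarrow> 'a \<Rightarrow> real ^ 'd"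
  shows "scalar_gains F S ({1..T} \<times> UNIV) = {gain H S T | H. H \<in> strategies T F}" (is "?L = ?R")
proof (intro set_eqI iffI)
  let ?\<Delta> = "\<lambda>i \<omega>. S (fst i) \<omega> $ snd i - S (fst i - 1) \<omega> $ snd i"
  have flat: "(\<Sum>k=1..T. \<Sum>j\<in>UNIV. h (k, j) * (S k \<omega> $ j - S (k - 1) \<omega> $ j)) =
      (\<Sum>i\<in>{1..T} \<times> UNIV. h i * ?\<Delta> i \<omega>)" for h \<omega>
    by (simp add: sum.cartesian_product case_prod_unfold)
  {
    fix v assume "v \<in> ?L"
    then obtain h where h: "\<forall>i\<in>{1..T} \<times> UNIV. h i \<in> borel_measurable (F (fst i - 1))"
      "v = (\<lambda>\<omega>. \<Sum>i\<in>{1..T} \<times> UNIV. h i \<omega> * ?\<Delta> i \<omega>)" by (auto simp: scalar_gains_def)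
    define H where "H k \<omega> = (\<chi> j. h (k, j) \<omega>)" for k \<omega>
    have "H k \<in> borel_measurable (F (k - 1))" if k: "k \<in> {1..T}" for k
      unfolding borel_measurable_euclidean_space[of "H k"]
    proof
      fix b :: "real ^ 'd" assume "b \<in> Basis"
      then obtain j where b: "b = axis j 1" by (auto simp: Basis_vec_def)
      have "(\<lambda>\<omega>. H k \<omega> \<bullet> b) = h (k, j)" by (simp add: b inner_axis H_def fun_eq_iff)
      then show "(\<lambda>\<omega>. H k \<omega> \<bullet> b) \<in> borel_measurable (F (k - 1))" using h(1) k by force
    qed
    then have "H \<in> strategies T F" by (simp add: strategies_def)
    moreover have "v = gain H S T"
    proof
      fix \<omega>
      show "v \<omega> = gain H S T \<omega>"
        unfolding h(2) gain_def H_def vec_lambda_beta by (rule flat[symmetric])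
    qed
    ultimately show "v \<in> ?R" by blast
  }
  {
    fix v assume "v \<in> ?R"
    then obtain H where H: "H \<in> strategies T F" "v = gain H S T" by blast
    have "v = (\<lambda>\<omega>. \<Sum>i\<in>{1..T} \<times> UNIV. (\<lambda>i \<omega>. H (fst i) \<omega> $ snd i) i \<omega> * ?\<Delta> i \<omega>)"
    proof
      fix \<omega>
      show "v \<omega> = (\<Sum>i\<in>{1..T} \<times> UNIV. (\<lambda>i \<omega>. H (fst i) \<omega> $ snd i) i \<omega> * ?\<Delta> i \<omega>)"
        unfolding H(2) gain_def using flat[of "\<lambda>i. H (fst i) \<omega> $ snd i" \<omega>] by (simp only: fst_conv snd_conv)
    qed
    moreover have "(\<lambda>\<omega>. H k \<omega> $ j) \<in> borel_measurable (F (k - 1))" if "k \<in> {1..T}" for k j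
    proof -
      have "H k \<in> borel_measurable (F (k - 1))" using H(1) that by (simp add: strategies_def)
      then show ?thesis by (intro borel_measurable_continuous_on[of "\<lambda>x. x $ j"] continuous_intros)
    qed
    ultimately show "v \<in> ?L"
      unfolding scalar_gains_def by (intro CollectI exI[of _ "\<lambda>i \<omega>. H (fst i) \<omega> $ snd i"]) auto
  }
qed

section \<open>The market model\<close>

lemma signed_integral_prob:
  assumes "Q \<in> prob_measures M" "measure Q \<in> ca M" "X \<in> bounded_measurable M"
  shows "signed_integral M (measure Q) X = (\<integral>\<omega>. X \<omega> \<partial>Q)"
  using signed_integral_eqI[OF assms(2) prob_measuresD(4)[OF assms(1)] _ prob_measuresD(2)[OF assms(1)] _ _ assms(3),
      of "null_measure M"]
  by (simp add: finite_measureI)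

text \<open>The union of the classes in \<open>hedge_cone\<close>, as \<open>mem_hedge_cone\<close>
  shows. It carries the locale argument, which works with functions.\<close>

definition superhedgeable ::
    "'a measure \<Rightarrow> 'a measure set \<Rightarrow> nat \<Rightarrow> (nat \<Rightarrow> 'a measure) \<Rightarrow> (nat \<Rightarrow> 'a \<Rightarrow> real ^ 'd) \<Rightarrow> ('a \<Rightarrow> real) set" where
  "superhedgeable M Ps T F S = {X \<in> bounded_measurable M. \<exists>H\<in>strategies T F. qs Ps (\<lambda>\<omega>. X \<omega> \<le> gain H S T \<omega>)}"

section \<open>Passing between quasi-sure classes and representatives\<close>

lemma qs_class_self: "X \<in> bounded_measurable M \<Longrightarrow> X \<in> qs_rel M Ps `` {X}"
  by (simp add: qs_rel_def qs_def)

lemma qs_class_Linf: "X \<in> bounded_measurable M \<Longrightarrow> qs_rel M Ps `` {X} \<in> Linf M Ps"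
  unfolding Linf_def by (rule quotientI)

lemma LinfD:
  assumes "\<xi> \<in> Linf M Ps" "X \<in> \<xi>"
  shows "X \<in> bounded_measurable M" and "Y \<in> \<xi> \<Longrightarrow> qs Ps (\<lambda>\<omega>. X \<omega> = Y \<omega>)"
proof -
  obtain Z where Z: "Z \<in> bounded_measurable M" "\<xi> = qs_rel M Ps `` {Z}"
    using assms(1) by (auto simp: Linf_def elim: quotientE)
  show "X \<in> bounded_measurable M" using assms(2) Z by (simp add: qs_rel_def)
  have X: "qs Ps (\<lambda>\<omega>. Z \<omega> = X \<omega>)" using assms(2) Z by (simp add: qs_rel_def)
  assume "Y \<in> \<xi>"
  then have "qs Ps (\<lambda>\<omega>. Z \<omega> = Y \<omega>)" using Z by (simp add: qs_rel_def)
  with X show "qs Ps (\<lambda>\<omega>. X \<omega> = Y \<omega>)" by (rule qs_mp2) simp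
qed

lemma mem_hedge_cone:
  assumes "\<xi> \<in> Linf M Ps" "X \<in> \<xi>"
  shows "\<xi> \<in> hedge_cone M Ps T F S \<longleftrightarrow> X \<in> superhedgeable M Ps T F S"
proof
  assume "\<xi> \<in> hedge_cone M Ps T F S"
  then show "X \<in> superhedgeable M Ps T F S"
    using assms(2) LinfD(1)[OF assms] by (auto simp: hedge_cone_def superhedgeable_def)
next
  assume "X \<in> superhedgeable M Ps T F S"
  then obtain H where H: "H \<in> strategies T F" "qs Ps (\<lambda>\<omega>. X \<omega> \<le> gain H S T \<omega>)"
    by (auto simp: superhedgeable_def)
  have "qs Ps (\<lambda>\<omega>. Y \<omega> \<le> gain H S T \<omega>)" if "Y \<in> \<xi>" for Y
    using LinfD(2)[OF assms that] H(2) by (rule qs_mp2) simp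
  then show "\<xi> \<in> hedge_cone M Ps T F S" using assms(1) H(1) by (auto simp: hedge_cone_def)
qed

text \<open>Domination of \<open>Q\<close> by \<open>Ps\<close> makes quasi-sure equality imply
  equality \<open>Q\<close>-a.s., so the image does not depend on the chosen representative.\<close>

lemma mem_j_map:
  assumes Ps: "Ps \<subseteq> prob_measures M" and Q: "Q \<in> prob_measures M" "dominated M {Q} Ps" and X: "X \<in> bounded_measurable M"
  shows "Z \<in> j_map M Q (qs_rel M Ps `` {X}) \<longleftrightarrow> Z \<in> bounded_measurable M \<and> (AE \<omega> in Q. X \<omega> = Z \<omega>)"
proof
  assume "Z \<in> j_map M Q (qs_rel M Ps `` {X})"
  then obtain Y where Y: "Y \<in> bounded_measurable M" "qs Ps (\<lambda>\<omega>. X \<omega> = Y \<omega>)"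
    and Z: "Z \<in> bounded_measurable M" "AE \<omega> in Q. Y \<omega> = Z \<omega>"
    by (auto simp: j_map_def qs_rel_def qs_def)
  note [measurable] = bounded_measurableD(1)[OF X] bounded_measurableD(1)[OF Y(1)]
  have "{\<omega> \<in> space M. \<not> X \<omega> = Y \<omega>} \<in> sets M" by measurable
  then have "qs {Q} (\<lambda>\<omega>. X \<omega> = Y \<omega>)" using qs_dominated[OF Ps _ Q(2) _ Y(2)] Q(1) by simp
  then have "AE \<omega> in Q. X \<omega> = Y \<omega>" by (simp add: qs_def)
  then show "Z \<in> bounded_measurable M \<and> (AE \<omega> in Q. X \<omega> = Z \<omega>)" using Z by auto
next
  assume "Z \<in> bounded_measurable M \<and> (AE \<omega> in Q. X \<omega> = Z \<omega>)"
  then show "Z \<in> j_map M Q (qs_rel M Ps `` {X})"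
    using X qs_class_self[OF X, of Ps] unfolding j_map_def
    by (intro UN_I[of X]) (auto simp: qs_rel_def qs_def)
qed

section \<open>The superhedgeable claims form a sensitive cone\<close>

lemma strategies_lincomb:
  fixes H H' :: "nat \<Rightarrow> 'a \<Rightarrow> real ^ 'd"
  assumes "H \<in> strategies T F" "H' \<in> strategies T F"
  shows "(\<lambda>k \<omega>. a *\<^sub>R H k \<omega> + b *\<^sub>R H' k \<omega>) \<in> strategies T F"
    and "gain (\<lambda>k \<omega>. a *\<^sub>R H k \<omega> + b *\<^sub>R H' k \<omega>) S T \<omega> = a * gain H S T \<omega> + b * gain H' S T \<omega>"
proof -
  show "(\<lambda>k \<omega>. a *\<^sub>R H k \<omega> + b *\<^sub>R H' k \<omega>) \<in> strategies T F"
    unfolding strategies_def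
  proof (intro CollectI ballI)
    fix t assume "t \<in> {1..T}"
    then have "H t \<in> borel_measurable (F (t - 1))" "H' t \<in> borel_measurable (F (t - 1))"
      using assms by (simp_all add: strategies_def)
    then show "(\<lambda>\<omega>. a *\<^sub>R H t \<omega> + b *\<^sub>R H' t \<omega>) \<in> borel_measurable (F (t - 1))" by measurable
  qed
  show "gain (\<lambda>k \<omega>. a *\<^sub>R H k \<omega> + b *\<^sub>R H' k \<omega>) S T \<omega> = a * gain H S T \<omega> + b * gain H' S T \<omega>"
    by (simp add: gain_def sum_distrib_left distrib_right sum.distrib mult.assoc)
qed

lemma borel_measurable_gain:
  fixes S :: "nat \<Rightarrow> 'a \<Rightarrow> real ^ 'd"
  assumes F: "filtration_upto M T F" and S: "adapted_upto T F S" and H: "H \<in> strategies T F"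
  shows "gain H S T \<in> borel_measurable M"
proof -
  have M: "X \<in> borel_measurable M" if "X \<in> borel_measurable (F t)" "t \<le> T" for X :: "'a \<Rightarrow> real ^ 'd" and t
    using F that by (intro measurable_from_subalg[of M "F t"]) (auto simp: filtration_upto_def)
  have nth: "(\<lambda>\<omega>. X \<omega> $ j) \<in> borel_measurable M" if "X \<in> borel_measurable M" for X :: "'a \<Rightarrow> real ^ 'd" and j
    using that by (intro borel_measurable_continuous_on[of "\<lambda>x. x $ j"] continuous_intros)
  have H': "H k \<in> borel_measurable M" if "k \<in> {1..T}" for k
    using H that by (intro M[of _ "k - 1"]) (auto simp: strategies_def)
  have S': "S k \<in> borel_measurable M" if "k \<le> T" for k
    using S that by (intro M[of _ k]) (auto simp: adapted_upto_def)
  show ?thesis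
    unfolding gain_def[abs_def]
    by (intro borel_measurable_sum borel_measurable_times borel_measurable_diff nth H' S') auto
qed

lemma fatou_superhedgeable:
  fixes S :: "nat \<Rightarrow> 'a \<Rightarrow> real ^ 'd"
  assumes F: "filtration_upto M T F" and na: "no_arbitrage Ps T F S"
    and Y: "\<And>n::nat. Y n \<in> superhedgeable M Ps T F S" and X: "X \<in> bounded_measurable M"
    and lim: "qs Ps (\<lambda>\<omega>. (\<lambda>n. Y n \<omega>) \<longlonglongrightarrow> X \<omega>)"
  shows "X \<in> superhedgeable M Ps T F S"
proof -
  let ?J = "{1..T} \<times> (UNIV :: 'd set)"
  have closed: "qs_closed Ps (scalar_gains F S ?J)"
  proof (rule qs_closed_scalar_gains[where J="?J"])
    show "arbitrage_free Ps (scalar_gains F S ?J)"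
      using na unfolding scalar_gains_eq_gain arbitrage_free_def no_arbitrage_def by blast
    fix i j assume "i \<in> ?J" "j \<in> ?J" and le: "fst i \<le> fst j"
    then have "fst i - 1 \<le> fst j - 1" "fst j - 1 \<le> T" "fst i - 1 \<le> T" by auto
    then show "subalgebra (F (fst j - 1)) (F (fst i - 1))"
      using F unfolding filtration_upto_def subalgebra_def by simp
  qed auto
  have "\<exists>v\<in>scalar_gains F S ?J. qs Ps (\<lambda>\<omega>. Y n \<omega> \<le> v \<omega>)" for n
    using Y[of n] unfolding scalar_gains_eq_gain superhedgeable_def by blast
  then obtain v where "\<And>n. v n \<in> scalar_gains F S ?J" "\<And>n. qs Ps (\<lambda>\<omega>. Y n \<omega> \<le> v n \<omega>)" by metis
  with closed lim have "\<exists>w\<in>scalar_gains F S ?J. qs Ps (\<lambda>\<omega>. X \<omega> \<le> w \<omega>)"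
    unfolding qs_closed_def by blast
  then show ?thesis using X unfolding scalar_gains_eq_gain superhedgeable_def by blast
qed

lemma sensitive_cone_superhedgeable:
  fixes S :: "nat \<Rightarrow> 'a \<Rightarrow> real ^ 'd"
  assumes Ps: "Ps \<subseteq> prob_measures M" and dual: "ca_c_dual_eq_Linf M Ps" and F: "filtration_upto M T F"
    and sens: "sensitive M Ps (hedge_cone M Ps T F S)" and na: "no_arbitrage Ps T F S"
  shows "sensitive_cone M Ps (superhedgeable M Ps T F S)"
proof
  let ?C = "superhedgeable M Ps T F S"
  show "Ps \<subseteq> prob_measures M" "ca_c_dual_eq_Linf M Ps" by fact+
  show "?C \<subseteq> bounded_measurable M" by (auto simp: superhedgeable_def)
  have "(\<lambda>_ _. 0) \<in> strategies T F" "gain (\<lambda>_ _. 0) S T \<omega> = 0" for \<omega>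
    by (simp_all add: strategies_def gain_def)
  then show "(\<lambda>_. 0) \<in> ?C"
    by (auto simp: superhedgeable_def bounded_measurable_const qs_def intro!: bexI[of _ "\<lambda>_ _. 0"])
  show "(\<lambda>\<omega>. a * X \<omega> + b * Y \<omega>) \<in> ?C" if X: "X \<in> ?C" and Y: "Y \<in> ?C" and ab: "0 \<le> a" "0 \<le> b" for X Y a b
  proof -
    obtain H where H: "H \<in> strategies T F" "qs Ps (\<lambda>\<omega>. X \<omega> \<le> gain H S T \<omega>)"
      using X by (auto simp: superhedgeable_def)
    obtain H' where H': "H' \<in> strategies T F" "qs Ps (\<lambda>\<omega>. Y \<omega> \<le> gain H' S T \<omega>)"
      using Y by (auto simp: superhedgeable_def)
    have "qs Ps (\<lambda>\<omega>. a * X \<omega> + b * Y \<omega> \<le> gain (\<lambda>k \<omega>. a *\<^sub>R H k \<omega> + b *\<^sub>R H' k \<omega>) S T \<omega>)"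
      unfolding strategies_lincomb(2)[OF H(1) H'(1)] using H(2) H'(2)
      by (rule qs_mp2) (intro add_mono mult_left_mono ab)
    moreover have "(\<lambda>\<omega>. a * X \<omega> + b * Y \<omega>) \<in> bounded_measurable M"
      using X Y by (intro bounded_measurable_lincomb) (auto simp: superhedgeable_def)
    ultimately show ?thesis
      using strategies_lincomb(1)[OF H(1) H'(1)] unfolding superhedgeable_def by blast
  qed
  show "Y \<in> ?C" if Yb: "Y \<in> bounded_measurable M" and X: "X \<in> ?C" and le: "qs Ps (\<lambda>\<omega>. Y \<omega> \<le> X \<omega>)" for X Y
  proof -
    obtain H where H: "H \<in> strategies T F" "qs Ps (\<lambda>\<omega>. X \<omega> \<le> gain H S T \<omega>)"
      using X by (auto simp: superhedgeable_def)
    have "qs Ps (\<lambda>\<omega>. Y \<omega> \<le> gain H S T \<omega>)" using le H(2) by (rule qs_mp2) simp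
    then show ?thesis using Yb H(1) by (auto simp: superhedgeable_def)
  qed
  show "X \<in> ?C" if "\<And>n::nat. Y n \<in> ?C" "X \<in> bounded_measurable M" "qs Ps (\<lambda>\<omega>. (\<lambda>n. Y n \<omega>) \<longlonglongrightarrow> X \<omega>)" for X Y
    using F na that by (rule fatou_superhedgeable)
  obtain Qs where Qs: "Qs \<subseteq> prob_measures M" "dominated M Qs Ps"
    and eq: "hedge_cone M Ps T F S = Linf M Ps \<inter> (\<Inter>Q\<in>Qs. j_map M Q -` (j_map M Q ` hedge_cone M Ps T F S))"
    using sens unfolding sensitive_def by blast
  have "X \<in> ?C" if X: "X \<in> bounded_measurable M" and *: "\<forall>Q\<in>Qs. \<exists>Y\<in>?C. AE \<omega> in Q. Y \<omega> = X \<omega>" for X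
  proof -
    let ?\<xi> = "qs_rel M Ps `` {X}"
    have "j_map M Q ?\<xi> \<in> j_map M Q ` hedge_cone M Ps T F S" if Q: "Q \<in> Qs" for Q
    proof -
      have QM: "Q \<in> prob_measures M" and Qd: "dominated M {Q} Ps"
        using Q Qs by (auto simp: dominated_def upper_prob_eq_0_iff)
      obtain Y where Y: "Y \<in> ?C" and YX: "AE \<omega> in Q. Y \<omega> = X \<omega>" using * Q by blast
      have Yb: "Y \<in> bounded_measurable M" using Y by (simp add: superhedgeable_def)
      \<comment> \<open>Equality \<open>Q\<close>-a.s. of \<open>X\<close> and \<open>Y\<close>
        means that their classes have the same image under \<open>j_map M Q\<close>.\<close>
      have "(AE \<omega> in Q. X \<omega> = Z \<omega>) \<longleftrightarrow> (AE \<omega> in Q. Y \<omega> = Z \<omega>)" for Z using YX by auto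
      then have "j_map M Q ?\<xi> = j_map M Q (qs_rel M Ps `` {Y})"
        by (intro set_eqI) (simp only: mem_j_map[OF Ps QM Qd X] mem_j_map[OF Ps QM Qd Yb])
      moreover have "qs_rel M Ps `` {Y} \<in> hedge_cone M Ps T F S"
        using mem_hedge_cone[OF qs_class_Linf[OF Yb] qs_class_self[OF Yb]] Y by blast
      ultimately show ?thesis by (intro image_eqI)
    qed
    then have "?\<xi> \<in> Linf M Ps \<inter> (\<Inter>Q\<in>Qs. j_map M Q -` (j_map M Q ` hedge_cone M Ps T F S))"
      using qs_class_Linf[OF X] by simp
    then have "?\<xi> \<in> hedge_cone M Ps T F S" unfolding eq[symmetric] .
    then show ?thesis using mem_hedge_cone[OF qs_class_Linf[OF X] qs_class_self[OF X]] by blast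
  qed
  then show "\<exists>Qs. Qs \<subseteq> prob_measures M \<and> dominated M Qs Ps \<and>
      (\<forall>X\<in>bounded_measurable M. (\<forall>Q\<in>Qs. \<exists>Y\<in>?C. AE \<omega> in Q. Y \<omega> = X \<omega>) \<longrightarrow> X \<in> ?C)"
    using Qs by blast
qed

section \<open>Polar probability measures and absence of arbitrage\<close>

lemma mem_polar_prob:
  "Q \<in> polar_prob M Ps (hedge_cone M Ps T F S) \<longleftrightarrow> Q \<in> prob_measures M \<and> measure Q \<in> ca_c M Ps \<and>
    (\<forall>X\<in>superhedgeable M Ps T F S. signed_integral M (measure Q) X \<le> 0)"
proof -
  have "(\<forall>\<xi>\<in>hedge_cone M Ps T F S. \<forall>X\<in>\<xi>. signed_integral M (measure Q) X \<le> 0) \<longleftrightarrow>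
      (\<forall>X\<in>superhedgeable M Ps T F S. signed_integral M (measure Q) X \<le> 0)"
  proof (intro iffI ballI)
    fix X assume *: "\<forall>\<xi>\<in>hedge_cone M Ps T F S. \<forall>X\<in>\<xi>. signed_integral M (measure Q) X \<le> 0"
      and X: "X \<in> superhedgeable M Ps T F S"
    have Xb: "X \<in> bounded_measurable M" using X by (simp add: superhedgeable_def)
    show "signed_integral M (measure Q) X \<le> 0"
      using * X mem_hedge_cone[OF qs_class_Linf[OF Xb] qs_class_self[OF Xb]] qs_class_self[OF Xb] by blast
  next
    fix \<xi> X assume *: "\<forall>X\<in>superhedgeable M Ps T F S. signed_integral M (measure Q) X \<le> 0"
      and xi: "\<xi> \<in> hedge_cone M Ps T F S" and X: "X \<in> \<xi>"
    have "\<xi> \<in> Linf M Ps" using xi by (simp add: hedge_cone_def)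
    then have "X \<in> superhedgeable M Ps T F S" using mem_hedge_cone[OF _ X] xi by blast
    then show "signed_integral M (measure Q) X \<le> 0" using * by blast
  qed
  then show ?thesis by (auto simp: polar_prob_def polar_def)
qed

lemma polar_prob_integral_le:
  assumes "Q \<in> polar_prob M Ps (hedge_cone M Ps T F S)" "X \<in> superhedgeable M Ps T F S"
  shows "(\<integral>\<omega>. X \<omega> \<partial>Q) \<le> 0"
  using assms signed_integral_prob[of Q M X] by (auto simp: mem_polar_prob superhedgeable_def ca_c_ca)

lemma dominated_polar_prob: "dominated M (polar_prob M Ps (hedge_cone M Ps T F S)) Ps"
  unfolding dominated_def
proof (intro ballI impI)
  fix A assume A: "A \<in> sets M" "upper_prob Ps A = 0"
  have "emeasure Q A = 0" if "Q \<in> polar_prob M Ps (hedge_cone M Ps T F S)" for Q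
  proof -
    have Q: "Q \<in> prob_measures M" "measure Q A = 0" using that A by (auto simp: mem_polar_prob ca_c_def)
    then show ?thesis using finite_measure.emeasure_eq_measure[OF prob_measuresD(4)[OF Q(1)]] by simp
  qed
  then show "upper_prob (polar_prob M Ps (hedge_cone M Ps T F S)) A = 0" by (simp add: upper_prob_eq_0_iff)
qed

text \<open>A gain may be unbounded, so polarity is applied to a truncation of it. The truncation
  has integral 0 under every polar \<open>Q\<close>, hence the gain is nonpositive
  \<open>Q\<close>-a.s., and domination carries this back to \<open>Ps\<close>.\<close>

lemma no_arbitrageI_polar_prob:
  fixes S :: "nat \<Rightarrow> 'a \<Rightarrow> real ^ 'd"
  assumes Ps: "Ps \<subseteq> prob_measures M" and F: "filtration_upto M T F" and S: "adapted_upto T F S"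
    and dom: "dominated M Ps (polar_prob M Ps (hedge_cone M Ps T F S))"
  shows "no_arbitrage Ps T F S"
  unfolding no_arbitrage_def
proof (intro ballI impI)
  let ?\<C> = "polar_prob M Ps (hedge_cone M Ps T F S)"
  fix H :: "nat \<Rightarrow> 'a \<Rightarrow> real ^ 'd"
  assume H: "H \<in> strategies T F" and nn: "qs Ps (\<lambda>\<omega>. 0 \<le> gain H S T \<omega>)"
  note g [measurable] = borel_measurable_gain[OF F S H]
  \<comment> \<open>The lower truncation makes \<open>X\<close> nonnegative everywhere; quasi-surely
    it changes nothing, so \<open>X\<close> stays below the gain.\<close>
  define X where "X \<omega> = max 0 (min 1 (gain H S T \<omega>))" for \<omega>
  have Xb: "X \<in> bounded_measurable M"
    unfolding X_def[abs_def]
    by (rule bounded_measurableI[where K=1]) (auto intro!: borel_measurable_max borel_measurable_min g)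
  have "qs Ps (\<lambda>\<omega>. X \<omega> \<le> gain H S T \<omega>)" using nn by (rule qs_mp) (simp add: X_def)
  then have X: "X \<in> superhedgeable M Ps T F S" using Xb H by (auto simp: superhedgeable_def)
  have "AE \<omega> in Q. gain H S T \<omega> \<le> 0" if Q: "Q \<in> ?\<C>" for Q
  proof -
    have QM: "Q \<in> prob_measures M" using Q by (simp add: mem_polar_prob)
    have "(\<integral>\<omega>. X \<omega> \<partial>Q) = 0"
      using polar_prob_integral_le[OF Q X] by (intro antisym Bochner_Integration.integral_nonneg) (auto simp: X_def)
    then have "AE \<omega> in Q. X \<omega> = 0"
      using integrable_bounded_measurable[OF prob_measuresD(4,2)[OF QM] Xb]
      by (subst (asm) integral_nonneg_eq_0_iff_AE) (auto simp: X_def)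
    then show ?thesis by eventually_elim (auto simp: X_def max_def min_def split: if_splits)
  qed
  then have "qs ?\<C> (\<lambda>\<omega>. gain H S T \<omega> \<le> 0)" by (simp add: qs_def)
  moreover have "{\<omega> \<in> space M. \<not> gain H S T \<omega> \<le> 0} \<in> sets M" by measurable
  moreover have "?\<C> \<subseteq> prob_measures M" by (auto simp: mem_polar_prob)
  ultimately have "qs Ps (\<lambda>\<omega>. gain H S T \<omega> \<le> 0)" using Ps dom by (intro qs_dominated[of ?\<C> M Ps]) auto
  with nn show "qs Ps (\<lambda>\<omega>. gain H S T \<omega> = 0)" by (rule qs_mp2) simp
qed

theorem theorem4p7:
  fixes M :: "'a measure" and Ps :: "'a measure set"
    and T :: nat and F :: "nat \<Rightarrow> 'a measure" and S :: "nat \<Rightarrow> 'a \<Rightarrow> real ^ 'd"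
  assumes "Ps \<subseteq> prob_measures M" and "Ps \<noteq> {}"
    and "ca_c_dual_eq_Linf M Ps"
    and "filtration_upto M T F"
    and "adapted_upto T F S"
    and "qs_bounded Ps T S"
    and "sensitive M Ps (hedge_cone M Ps T F S)"
  shows "(no_arbitrage Ps T F S \<longleftrightarrow> equivalent M (polar_prob M Ps (hedge_cone M Ps T F S)) Ps) \<and>
    (no_arbitrage Ps T F S \<longrightarrow>
      (\<forall>\<xi>\<in>Linf M Ps. \<forall>X\<in>\<xi>. superhedging_price Ps T F S \<xi> =
        (SUP Q\<in>polar_prob M Ps (hedge_cone M Ps T F S). ereal (\<integral>\<omega>. X \<omega> \<partial>Q))))"
proof -
  let ?C = "superhedgeable M Ps T F S" and ?\<C> = "polar_prob M Ps (hedge_cone M Ps T F S)"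
  have separate: "\<exists>Q\<in>?\<C>. 0 < (\<integral>\<omega>. X \<omega> \<partial>Q)"
    if na: "no_arbitrage Ps T F S" and X: "X \<in> bounded_measurable M" "X \<notin> ?C" for X
    using sensitive_cone.separate_cone_prob[OF sensitive_cone_superhedgeable[OF assms(1,3,4,7) na] X]
    unfolding mem_polar_prob Bex_def by blast
  have "dominated M Ps ?\<C>" if na: "no_arbitrage Ps T F S"
    unfolding dominated_def
  proof (intro ballI impI)
    fix A assume A: "A \<in> sets M" and null: "upper_prob ?\<C> A = 0"
    have "(\<integral>\<omega>. indicator A \<omega> \<partial>Q) = (0::real)" if "Q \<in> ?\<C>" for Q
    proof -
      have "sets Q = sets M" using that prob_measuresD(2) by (auto simp: mem_polar_prob)
      then show ?thesis
        using that null A sets.sets_into_space[of A Q] by (simp add: upper_prob_eq_0_iff measure_def Int_absorb2)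
    qed
    \<comment> \<open>A claim that no polar probability measure prices above 0 can be superhedged
      from 0. Here the hedge dominates \<open>indicator A\<close>, so no arbitrage forces it to
      vanish and \<open>A\<close> to be null.\<close>
    then have "indicator A \<in> ?C" using separate[OF na bounded_measurable_indicator[OF A]] by fastforce
    then obtain H where H: "H \<in> strategies T F" and le: "qs Ps (\<lambda>\<omega>. indicator A \<omega> \<le> gain H S T \<omega>)"
      by (auto simp: superhedgeable_def)
    have "qs Ps (\<lambda>\<omega>. 0 \<le> gain H S T \<omega>)" using le by (rule qs_mp) (rule order_trans[OF indicator_pos_le])
    then have "qs Ps (\<lambda>\<omega>. gain H S T \<omega> = 0)" using na H by (simp add: no_arbitrage_def)
    with le have "qs Ps (\<lambda>\<omega>. \<omega> \<notin> A)" by (rule qs_mp2) (auto simp: indicator_def split: if_splits)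
    moreover have "{\<omega> \<in> space M. \<not> \<omega> \<notin> A} = A" using sets.sets_into_space[OF A] by auto
    ultimately show "upper_prob Ps A = 0" using qs_iff_upper_prob[OF assms(1), of "\<lambda>\<omega>. \<omega> \<notin> A"] A by simp
  qed
  then have "no_arbitrage Ps T F S \<longleftrightarrow> equivalent M ?\<C> Ps"
    using dominated_polar_prob[of M Ps T F S] no_arbitrageI_polar_prob[OF assms(1,4,5)]
    unfolding equivalent_def by blast
  moreover have "superhedging_price Ps T F S \<xi> = (SUP Q\<in>?\<C>. ereal (\<integral>\<omega>. X \<omega> \<partial>Q))"
    if na: "no_arbitrage Ps T F S" and xi: "\<xi> \<in> Linf M Ps" and X: "X \<in> \<xi>" for \<xi> X
  proof -
    note Xb = LinfD(1)[OF xi X]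
    have bm: "(\<lambda>\<omega>. X \<omega> - x) \<in> bounded_measurable M" for x
      using bounded_measurable_lincomb[OF Xb bounded_measurable_const[of 1], of 1 "- x"] by simp
    have int: "(\<integral>\<omega>. X \<omega> - x \<partial>Q) = (\<integral>\<omega>. X \<omega> \<partial>Q) - x" if "Q \<in> ?\<C>" for Q x
    proof -
      have QM: "Q \<in> prob_measures M" using that by (simp add: mem_polar_prob)
      interpret prob_space Q by (rule prob_measuresD[OF QM])
      show ?thesis
        using integrable_bounded_measurable[OF prob_measuresD(4,2)[OF QM] Xb] by (simp add: prob_space)
    qed
    let ?P = "{x. \<exists>H\<in>strategies T F. \<forall>X\<in>\<xi>. qs Ps (\<lambda>\<omega>. X \<omega> \<le> x + gain H S T \<omega>)}"
    \<comment> \<open>Cash invariance: superhedging \<open>X\<close> from \<open>x\<close> is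
      superhedging \<open>X - x\<close> from 0.\<close>
    have P: "x \<in> ?P \<longleftrightarrow> (\<lambda>\<omega>. X \<omega> - x) \<in> ?C" for x
    proof -
      have "(\<forall>Y\<in>\<xi>. qs Ps (\<lambda>\<omega>. Y \<omega> \<le> x + gain H S T \<omega>)) \<longleftrightarrow> qs Ps (\<lambda>\<omega>. X \<omega> - x \<le> gain H S T \<omega>)" for H
      proof
        assume "\<forall>Y\<in>\<xi>. qs Ps (\<lambda>\<omega>. Y \<omega> \<le> x + gain H S T \<omega>)"
        then have "qs Ps (\<lambda>\<omega>. X \<omega> \<le> x + gain H S T \<omega>)" using X by blast
        then show "qs Ps (\<lambda>\<omega>. X \<omega> - x \<le> gain H S T \<omega>)" by (rule qs_mp) simp
      next
        assume le: "qs Ps (\<lambda>\<omega>. X \<omega> - x \<le> gain H S T \<omega>)"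
        have "qs Ps (\<lambda>\<omega>. Y \<omega> \<le> x + gain H S T \<omega>)" if "Y \<in> \<xi>" for Y
          using LinfD(2)[OF xi X that] le by (rule qs_mp2) simp
        then show "\<forall>Y\<in>\<xi>. qs Ps (\<lambda>\<omega>. Y \<omega> \<le> x + gain H S T \<omega>)" by blast
      qed
      then show ?thesis using bm by (simp add: superhedgeable_def)
    qed
    show ?thesis
      unfolding superhedging_price_def
    proof (rule antisym)
      show "(SUP Q\<in>?\<C>. ereal (\<integral>\<omega>. X \<omega> \<partial>Q)) \<le> Inf (ereal ` ?P)"
      proof (rule INF_greatest, rule SUP_least)
        fix x Q assume x: "x \<in> ?P" and Q: "Q \<in> ?\<C>"
        have "(\<integral>\<omega>. X \<omega> - x \<partial>Q) \<le> 0" using x unfolding P by (rule polar_prob_integral_le[OF Q])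
        then show "ereal (\<integral>\<omega>. X \<omega> \<partial>Q) \<le> ereal x" using int[OF Q, of x] by simp
      qed
      show "Inf (ereal ` ?P) \<le> (SUP Q\<in>?\<C>. ereal (\<integral>\<omega>. X \<omega> \<partial>Q))"
      \<comment> \<open>Testing with real upper bounds \<open>z\<close> of the supremum also covers
        infinite values. Were \<open>X - z\<close> outside the cone, some polar \<open>Q\<close>
        would give \<open>X\<close> an expectation above \<open>z\<close>.\<close>
      proof (rule ereal_le_real)
        fix z assume z: "(SUP Q\<in>?\<C>. ereal (\<integral>\<omega>. X \<omega> \<partial>Q)) \<le> ereal z"
        have "(\<integral>\<omega>. X \<omega> - z \<partial>Q) \<le> 0" if "Q \<in> ?\<C>" for Q
          using order_trans[OF SUP_upper[OF that] z] int[OF that, of z] by simp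
        then have "(\<lambda>\<omega>. X \<omega> - z) \<in> ?C" using separate[OF na bm[of z]] by (auto simp: not_less[symmetric])
        then have "z \<in> ?P" unfolding P .
        then show "Inf (ereal ` ?P) \<le> ereal z" by (rule INF_lower)
      qed
    qed
  qed
  ultimately show ?thesis by blast
qed

end
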